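(* Consider the class of equations $$f(x)u_{tt}=(h(x)H(u)u_x)_x+h(x)K(u)u_x$$ for $u=u(t,x)$, with arbitrary elements $f,h,H,K$ (smooth real-valued functions of the indicated variables, $f(x)h(x)H(u)\neq0$, $(H_u,K_u)\neq(0,0)$). The extended equivalence transformation group $\hat G_h^{\sim}$ of this class is formed by the transformations $$\tilde t=\epsilon_1t+\epsilon_2,\quad \tilde x=\epsilon_5x+\epsilon_6,\quad \tilde u=\epsilon_3u+\epsilon_4,$$ $$\tilde f=\epsilon_1^2\epsilon_5^{-1}\epsilon_9\,f\,e^{\epsilon_8x},\quad \tilde h=\epsilon_9\epsilon_7^{-1}\,h\,e^{\epsilon_8x},\quad \tilde H=\epsilon_5\epsilon_7H,\quad \tilde K=\epsilon_7(K-\epsilon_8H),$$ where $\epsilon_1,\ldots,\epsilon_9$ are arbitrary constants and $\epsilon_1\epsilon_3\epsilon_5\epsilon_7\epsilon_9\neq0$.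
   Context: The extended equivalence group $\hat G_h^{\sim}$ of the class consists of the transformations that map every equation of the class for $u=u(t,x)$ with arbitrary elements $(f,h,H,K)$ to an equation of the same class for $\tilde u=\tilde u(\tilde t,\tilde x)$ with arbitrary elements $(\tilde f,\tilde h,\tilde H,\tilde K)$ ($\tilde f,\tilde h$ functions of $\tilde x$; $\tilde H,\tilde K$ functions of $\tilde u$), that are (nondegenerate) point transformations with respect to $(t,x,u)$, and in which the new arbitrary elements are determined via $(t,x,u,f,h,H,K)$ in some not prescribed, possibly nonlocal, way.
   Formalization: The constants ε7, ε8, ε9 may depend on the arbitrary elements (f,h,H,K), while ε1,…,ε6 are common to the whole class; with an unrestricted rule for the new elements, the claim with common ε7, ε8, ε9 is false. *)

theory Defs
  imports "HOL-Analysis.Analysis"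
begin

text \<open>
  Infinite differentiability on a set, which is open in all uses below. In finite dimension
  \<open>Ck_on k S f\<close> says that \<open>f\<close> is \<open>k\<close> times continuously differentiable on the open set \<open>S\<close>.
\<close>

primrec Ck_on ::
  "nat \<Rightarrow> 'a::real_normed_vector set \<Rightarrow> ('a \<Rightarrow> 'b::real_normed_vector) \<Rightarrow> bool" where
  "Ck_on 0 S f \<longleftrightarrow> continuous_on S f"
| "Ck_on (Suc k) S f \<longleftrightarrow>
     (\<forall>x\<in>S. f differentiable (at x)) \<and> (\<forall>v. Ck_on k S (\<lambda>x. frechet_derivative f (at x) v))"

definition smooth_on ::
  "'a::real_normed_vector set \<Rightarrow> ('a \<Rightarrow> 'b::real_normed_vector) \<Rightarrow> bool" where
  "smooth_on S f \<longleftrightarrow> (\<forall>k. Ck_on k S f)"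

text \<open>
  Points of the space of the variables are triples \<open>(t, x, u)\<close>; arbitrary elements are
  quadruples \<open>(f, h, H, K)\<close>.
\<close>

type_synonym point = "real \<times> real \<times> real"
type_synonym arbitrary_elements =
  "(real \<Rightarrow> real) \<times> (real \<Rightarrow> real) \<times> (real \<Rightarrow> real) \<times> (real \<Rightarrow> real)"

definition x_range :: "point set \<Rightarrow> real set" where
  "x_range \<Omega> = (\<lambda>(t, x, u). x) ` \<Omega>"

definition u_range :: "point set \<Rightarrow> real set" where
  "u_range \<Omega> = (\<lambda>(t, x, u). u) ` \<Omega>"

text \<open>
  The arbitrary elements of the class of equations considered on an open domain \<open>\<Omega>\<close> of the
  \<open>(t, x, u)\<close>-space. Values of \<open>f, h\<close> outside \<open>x_range \<Omega>\<close> and of \<open>H, K\<close> outside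
  \<open>u_range \<Omega>\<close> are irrelevant. The condition that \<open>(H_u, K_u)\<close> is not \<open>(0, 0)\<close> is a condition
  on functions: the two derivatives do not both vanish identically.
\<close>

definition admissible_elements :: "point set \<Rightarrow> arbitrary_elements set" where
  "admissible_elements \<Omega> = {(f, h, H, K).
     smooth_on (x_range \<Omega>) f \<and> smooth_on (x_range \<Omega>) h \<and>
     smooth_on (u_range \<Omega>) H \<and> smooth_on (u_range \<Omega>) K \<and>
     (\<forall>x\<in>x_range \<Omega>. \<forall>u\<in>u_range \<Omega>. f x * h x * H u \<noteq> 0) \<and>
     (\<exists>u\<in>u_range \<Omega>. (deriv H u, deriv K u) \<noteq> (0, 0))}"

definition equation_holds_at ::
  "arbitrary_elements \<Rightarrow> (real \<times> real \<Rightarrow> real) \<Rightarrow> real \<times> real \<Rightarrow> bool" where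
  "equation_holds_at = (\<lambda>(f, h, H, K) v (t, x).
     f x * deriv (\<lambda>s. deriv (\<lambda>r. v (r, x)) s) t =
       deriv (\<lambda>y. h y * H (v (t, y)) * deriv (\<lambda>z. v (t, z)) y) x
       + h x * K (v (t, x)) * deriv (\<lambda>z. v (t, z)) x)"

definition graph_over :: "(real \<times> real) set \<Rightarrow> (real \<times> real \<Rightarrow> real) \<Rightarrow> point set" where
  "graph_over W v = (\<lambda>(t, x). (t, x, v (t, x))) ` W"

definition point_transformation :: "point set \<Rightarrow> (point \<Rightarrow> point) \<Rightarrow> bool" where
  "point_transformation \<Omega> \<Phi> \<longleftrightarrow>
     smooth_on \<Omega> \<Phi> \<and> inj_on \<Phi> \<Omega> \<and> (\<forall>p\<in>\<Omega>. bij (frechet_derivative \<Phi> (at p)))"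

text \<open>
  The point transformation \<open>\<Phi>\<close> maps the equation with arbitrary elements \<open>\<theta>\<close> to the one with
  arbitrary elements \<open>\<theta>'\<close>: whenever \<open>\<Phi>\<close> carries (the graph of) a function \<open>v\<close> of \<open>(t, x)\<close> to
  (the graph of) a function \<open>v'\<close> of the new independent variables, the change of variables
  turns the equation for \<open>v\<close> into the equation for \<open>v'\<close>. An equation is understood, as usual,
  as a submanifold of the space of 2-jets, so the equivalence is required at each point, for
  all smooth \<open>v\<close> (every 2-jet over \<open>\<Omega>\<close> is the jet of such a \<open>v\<close>); it implies in particular
  that solutions correspond to solutions.
\<close>

definition maps_equation ::
  "point set \<Rightarrow> (point \<Rightarrow> point) \<Rightarrow> arbitrary_elements \<Rightarrow> arbitrary_elements \<Rightarrow> bool" where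
  "maps_equation \<Omega> \<Phi> \<theta> \<theta>' \<longleftrightarrow>
     (\<forall>W v W' v'.
        open W \<and> smooth_on W v \<and> graph_over W v \<subseteq> \<Omega> \<and>
        open W' \<and> smooth_on W' v' \<and> \<Phi> ` graph_over W v = graph_over W' v' \<longrightarrow>
        (\<forall>t x t' x' u'. (t, x) \<in> W \<and> \<Phi> (t, x, v (t, x)) = (t', x', u') \<longrightarrow>
           (equation_holds_at \<theta> v (t, x) \<longleftrightarrow> equation_holds_at \<theta>' v' (t', x'))))"

text \<open>
  The extended equivalence group on \<open>\<Omega>\<close>. Its members are pairs of a point transformation
  \<open>\<Phi>\<close>, common to all equations of the class, and a rule \<open>\<Psi>\<close> that assigns new arbitrary
  elements to the old ones. No restriction, such as locality or a functional form, is
  imposed on \<open>\<Psi>\<close>.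
\<close>

definition extended_equivalence_group ::
  "point set \<Rightarrow> ((point \<Rightarrow> point) \<times> (arbitrary_elements \<Rightarrow> arbitrary_elements)) set" where
  "extended_equivalence_group \<Omega> = {(\<Phi>, \<Psi>).
     point_transformation \<Omega> \<Phi> \<and>
     (\<forall>\<theta>\<in>admissible_elements \<Omega>.
        \<Psi> \<theta> \<in> admissible_elements (\<Phi> ` \<Omega>) \<and> maps_equation \<Omega> \<Phi> \<theta> (\<Psi> \<theta>))}"

end

theory Submission
  imports Defs
begin

text \<open>
  A point transformation \<open>(T, X, U)\<close> of the class induces a map of 2-jets wherever the total
  Jacobian of \<open>(T, X)\<close> does not vanish; the inverse function theorem realises every such jet by a
  pair of smooth graphs. The image of an equation of the class contains no mixed second derivative,
  and comparing two jets of the equation whose images differ only in the mixed derivative gives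
  \<open>f D\<^sub>tT D\<^sub>tX = h H D\<^sub>xT D\<^sub>xX\<close> for all first jets. As \<open>h H / f\<close> is arbitrary, either
  \<open>T = T(t)\<close>, \<open>X = X(x)\<close>, or locally \<open>T = T(x)\<close>, \<open>X = X(t)\<close>. The second case would force
  \<open>U\<^sub>u\<^sub>u H = U\<^sub>u H\<^sub>u\<close>, which fails for \<open>H = 1\<close> or for \<open>H = exp u\<close>. In the first case the
  coefficients of the transformed equation, taken for \<open>f = h = 1\<close>, \<open>K = u\<close> and
  \<open>H = exp (c u + d u\<^sup>2 / 2)\<close> with a few values of \<open>c, d\<close>, make \<open>T\<close>, \<open>X\<close>, \<open>U\<close> affine. For
  arbitrary elements they then equate a function of \<open>x\<close> with a function of \<open>u\<close>, twice; the two
  separation constants are \<open>\<epsilon>7\<close> (up to a factor) and \<open>\<epsilon>8\<close>.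
\<close>

subsection \<open>Smooth maps and directional derivatives\<close>

text \<open>The map \<open>(T, X, U)\<close> is shared by all equations of the class, while nothing
  is known about how the new elements depend on the old ones. Relations obtained from different test
  elements therefore have only \<open>T, X, U\<close> in common, and each argument has to eliminate
  the new elements before two tests can be compared.

  The choice \<open>K = u\<close> serves two ends. It makes every nowhere vanishing smooth
  \<open>H\<close> admissible, and it puts the variable \<open>u\<close> itself into the coefficient
  of \<open>u_x\<close>, from which the least visible condition, \<open>X_xx = 0\<close>, is
  obtained. The exponent of \<open>H\<close> is quadratic so that \<open>H_u / H = c + d * u\<close>
  can be any affine function.

  The domain is connected but need not be a product of intervals, so a relation between a function
  of \<open>x\<close> and a function of \<open>u\<close> separates locally, and connectedness then
  joins the local constants. The remaining constant \<epsilon>9 comes from a linear differential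
  equation in \<open>x\<close> with coefficient \<epsilon>8: it is \<epsilon>5 times the constant of
  integration.\<close>

definition dird :: "'a \<Rightarrow> ('a::real_normed_vector \<Rightarrow> 'b::real_normed_vector) \<Rightarrow> 'a \<Rightarrow> 'b" where
  "dird w f = (\<lambda>x. frechet_derivative f (at x) w)"

lemma dird_eq: "(f has_derivative D) (at x) \<Longrightarrow> dird w f x = D w"
  by (metis dird_def frechet_derivative_at)

text \<open>\<open>frechet_derivative\<close> is a choice from the set of derivatives at the point,
  and this set is the same for functions that agree nearby. The equality thus holds also at points
  where no derivative exists.\<close>

lemma dird_cong:
  assumes "open S" "x \<in> S" "\<And>y. y \<in> S \<Longrightarrow> f y = g y"
  shows "dird w f x = dird w g x"
proof -
  have "(f has_derivative D) (at x) \<longleftrightarrow> (g has_derivative D) (at x)" for D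
    using has_derivative_transform_within_open[of f D x UNIV S g]
      has_derivative_transform_within_open[of g D x UNIV S f] assms by auto
  then show ?thesis by (simp add: dird_def frechet_derivative_def)
qed

lemma differentiable_cong_open:
  assumes "open S" "x \<in> S" "\<And>y. y \<in> S \<Longrightarrow> f y = g y" "f differentiable (at x)"
  shows "g differentiable (at x)"
  using assms has_derivative_transform_within_open[of f _ x UNIV S g]
  unfolding differentiable_def by blast

lemma Ck_on_Suc: "Ck_on (Suc k) S f \<longleftrightarrow>
    (\<forall>x\<in>S. f differentiable (at x)) \<and> (\<forall>v. Ck_on k S (dird v f))"
  by (simp add: dird_def)

declare Ck_on.simps(2) [simp del]

lemma has_derivative_frechet: "f differentiable F \<Longrightarrow> (f has_derivative frechet_derivative f F) F"
  by (simp add: frechet_derivative_works)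

lemma dird_has_derivative: "f differentiable (at x) \<Longrightarrow> (f has_derivative (\<lambda>w. dird w f x)) (at x)"
  unfolding dird_def by (rule has_derivative_frechet)

lemma Ck_on_cong:
  assumes "open S" "\<And>x. x \<in> S \<Longrightarrow> f x = g x" "Ck_on k S f"
  shows "Ck_on k S g"
  using assms(2,3)
proof (induction k arbitrary: f g)
  case 0
  then show ?case using continuous_on_cong[of S S f g] by simp
next
  case (Suc k)
  have "Ck_on k S (dird v g)" for v
  proof (rule Suc.IH[of "dird v f"])
    show "dird v f x = dird v g x" if "x \<in> S" for x
      by (rule dird_cong[OF assms(1) that]) (rule Suc.prems(1))
    show "Ck_on k S (dird v f)"
      using Suc.prems(2) unfolding Ck_on_Suc by blast
  qed
  moreover have "g differentiable (at x)" if "x \<in> S" for x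
  proof (rule differentiable_cong_open[OF assms(1) that])
    show "f differentiable (at x)"
      using Suc.prems(2) that unfolding Ck_on_Suc by blast
  qed (rule Suc.prems(1))
  ultimately show ?case unfolding Ck_on_Suc by blast
qed

text \<open>The closure properties below all go through this rule: it replaces the chosen derivative
  by an explicit formula \<open>D\<close> that is valid on the open set only.\<close>

lemma Ck_on_SucI:
  assumes "open S" "\<And>x. x \<in> S \<Longrightarrow> (f has_derivative (\<lambda>w. D w x)) (at x)"
    and "\<And>w. Ck_on k S (D w)"
  shows "Ck_on (Suc k) S f"
proof -
  have "Ck_on k S (dird w f)" for w
    by (rule Ck_on_cong[OF assms(1) _ assms(3)[of w]]) (simp add: dird_eq[OF assms(2)])
  then show ?thesis
    unfolding Ck_on_Suc differentiable_def using assms(2) by blast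
qed

lemma Ck_on_Suc_dird: "Ck_on (Suc k) S f \<Longrightarrow> Ck_on k S (dird w f)"
  unfolding Ck_on_Suc by blast

lemma Ck_on_Suc_has_derivative:
  "Ck_on (Suc k) S f \<Longrightarrow> x \<in> S \<Longrightarrow> (f has_derivative (\<lambda>w. dird w f x)) (at x)"
  unfolding Ck_on_Suc by (blast intro: dird_has_derivative)

lemma Ck_on_SucD: "Ck_on (Suc k) S f \<Longrightarrow> Ck_on k S f"
proof (induction k arbitrary: f)
  case 0
  then show ?case
    by (auto simp: Ck_on_Suc intro!: differentiable_imp_continuous_on differentiable_at_imp_differentiable_on)
next
  case (Suc k)
  then show ?case using Ck_on_Suc[of "Suc k"] Ck_on_Suc[of k S f] by blast
qed

lemma Ck_on_subset: "Ck_on k S f \<Longrightarrow> T \<subseteq> S \<Longrightarrow> Ck_on k T f"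
proof (induction k arbitrary: f)
  case 0
  then show ?case using continuous_on_subset by auto
next
  case (Suc k)
  then show ?case unfolding Ck_on_Suc by blast
qed

lemma Ck_on_const [simp]: "Ck_on k S (\<lambda>x. c)"
proof (induction k arbitrary: c)
  case (Suc k)
  have "dird v (\<lambda>x. c) = (\<lambda>x. 0)" for v :: 'a
    by (rule ext) (rule dird_eq, rule has_derivative_const)
  then show ?case using Suc by (simp add: Ck_on_Suc)
qed auto

lemma Ck_on_ident: "Ck_on k S (\<lambda>x. x)"
proof (cases k)
  case (Suc j)
  have "dird v (\<lambda>x. x) = (\<lambda>x. v)" for v :: 'a
    by (rule ext) (rule dird_eq, rule has_derivative_ident)
  then show ?thesis using Suc by (simp add: Ck_on_Suc)
qed auto

lemma Ck_on_linear:
  assumes "bounded_linear L" "Ck_on k S f" "open S"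
  shows "Ck_on k S (\<lambda>x. L (f x))"
  using assms(2)
proof (induction k arbitrary: f)
  case 0
  then show ?case using assms(1) by (simp add: bounded_linear.continuous_on)
next
  case (Suc k)
  show ?case
  proof (rule Ck_on_SucI[OF assms(3)])
    show "((\<lambda>x. L (f x)) has_derivative (\<lambda>w. L (dird w f x))) (at x)" if "x \<in> S" for x
      using Ck_on_Suc_has_derivative[OF Suc.prems that] by (rule bounded_linear.has_derivative[OF assms(1)])
    show "Ck_on k S (\<lambda>x. L (dird w f x))" for w
      using Ck_on_Suc_dird[OF Suc.prems] by (rule Suc.IH)
  qed
qed

lemma Ck_on_add:
  assumes "Ck_on k S f" "Ck_on k S g" "open S"
  shows "Ck_on k S (\<lambda>x. f x + g x)"
  using assms(1,2)
proof (induction k arbitrary: f g)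
  case 0
  then show ?case by (simp add: continuous_on_add)
next
  case (Suc k)
  show ?case
  proof (rule Ck_on_SucI[OF assms(3)])
    show "((\<lambda>x. f x + g x) has_derivative (\<lambda>w. dird w f x + dird w g x)) (at x)" if "x \<in> S" for x
      by (rule has_derivative_add; rule Ck_on_Suc_has_derivative[OF _ that]) (rule Suc.prems)+
    show "Ck_on k S (\<lambda>x. dird w f x + dird w g x)" for w
      by (rule Suc.IH; rule Ck_on_Suc_dird) (rule Suc.prems)+
  qed
qed

lemma Ck_on_bilinear:
  assumes "bounded_bilinear B" "Ck_on k S f" "Ck_on k S g" "open S"
  shows "Ck_on k S (\<lambda>x. B (f x) (g x))"
  using assms(2,3)
proof (induction k arbitrary: f g)
  case 0
  then show ?case by (simp add: bounded_bilinear.continuous_on[OF assms(1)])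
next
  case (Suc k)
  show ?case
  proof (rule Ck_on_SucI[OF assms(4)])
    show "((\<lambda>x. B (f x) (g x)) has_derivative
        (\<lambda>w. B (f x) (dird w g x) + B (dird w f x) (g x))) (at x)" if "x \<in> S" for x
      by (rule bounded_bilinear.FDERIV[OF assms(1)]; rule Ck_on_Suc_has_derivative[OF _ that])
        (rule Suc.prems)+
    show "Ck_on k S (\<lambda>x. B (f x) (dird w g x) + B (dird w f x) (g x))" for w
    proof (rule Ck_on_add[OF _ _ assms(4)])
      show "Ck_on k S (\<lambda>x. B (f x) (dird w g x))"
        using Suc.prems by (intro Suc.IH) (auto intro: Ck_on_SucD Ck_on_Suc_dird)
      show "Ck_on k S (\<lambda>x. B (dird w f x) (g x))"
        using Suc.prems by (intro Suc.IH) (auto intro: Ck_on_SucD Ck_on_Suc_dird)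
    qed
  qed
qed

lemma Ck_on_sum:
  assumes "\<And>i. i \<in> I \<Longrightarrow> Ck_on k S (f i)" "open S"
  shows "Ck_on k S (\<lambda>x. \<Sum>i\<in>I. f i x)"
  using assms(1) by (induction I rule: infinite_finite_induct) (auto intro: Ck_on_add assms(2))

text \<open>The chain rule differentiates \<open>g\<close> in the direction
  \<open>dird w f x\<close>, which moves with \<open>x\<close>, whereas the induction hypothesis
  concerns fixed directions. Expansion in the basis of the euclidean space between the two maps
  separates the direction from the derivative.\<close>

lemma Ck_on_compose:
  fixes f :: "'a::real_normed_vector \<Rightarrow> 'b::euclidean_space"
  assumes "Ck_on k T g" "Ck_on k S f" "open S" "\<And>x. x \<in> S \<Longrightarrow> f x \<in> T"
  shows "Ck_on k S (\<lambda>x. g (f x))"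
  using assms(1,2)
proof (induction k arbitrary: g)
  case 0
  then show ?case using continuous_on_compose2[of T g S f] assms(4) by auto
next
  case (Suc k)
  have L: "dird w g y = (\<Sum>b\<in>Basis. (w \<bullet> b) *\<^sub>R dird b g y)" if "y \<in> T" for w y
  proof -
    have lin: "linear (\<lambda>w. dird w g y)"
      using Ck_on_Suc_has_derivative[OF Suc.prems(1) that] by (rule has_derivative_linear)
    have "dird w g y = dird (\<Sum>b\<in>Basis. (w \<bullet> b) *\<^sub>R b) g y"
      by (simp add: euclidean_representation)
    also have "\<dots> = (\<Sum>b\<in>Basis. (w \<bullet> b) *\<^sub>R dird b g y)"
      using linear_sum[OF lin, of "\<lambda>b. (w \<bullet> b) *\<^sub>R b" Basis] linear_scale[OF lin] by simp
    finally show ?thesis .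
  qed
  show ?case
  proof (rule Ck_on_SucI[OF assms(3)])
    fix x assume x: "x \<in> S"
    have "((\<lambda>x. g (f x)) has_derivative (\<lambda>w. dird (dird w f x) g (f x))) (at x)"
      by (rule has_derivative_compose[OF Ck_on_Suc_has_derivative[OF Suc.prems(2) x]
            Ck_on_Suc_has_derivative[OF Suc.prems(1) assms(4)[OF x]]])
    then show "((\<lambda>x. g (f x)) has_derivative
        (\<lambda>w. \<Sum>b\<in>Basis. (dird w f x \<bullet> b) *\<^sub>R dird b g (f x))) (at x)"
      by (rule has_derivative_eq_rhs) (rule ext, rule L[OF assms(4)[OF x]])
  next
    fix w
    show "Ck_on k S (\<lambda>x. \<Sum>b\<in>Basis. (dird w f x \<bullet> b) *\<^sub>R dird b g (f x))"
    proof (intro Ck_on_sum assms(3) Ck_on_bilinear[OF bounded_bilinear_scaleR])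
      fix b :: 'b
      show "Ck_on k S (\<lambda>x. dird w f x \<bullet> b)"
        by (rule Ck_on_linear[OF bounded_linear_inner_left Ck_on_Suc_dird[OF Suc.prems(2)] assms(3)])
      show "Ck_on k S (\<lambda>x. dird b g (f x))"
        by (rule Suc.IH[OF Ck_on_Suc_dird[OF Suc.prems(1)] Ck_on_SucD[OF Suc.prems(2)]])
    qed
  qed
qed

lemma smooth_on_iff_dird:
  "smooth_on S f \<longleftrightarrow> (\<forall>x\<in>S. f differentiable (at x)) \<and> (\<forall>w. smooth_on S (dird w f))"
proof (intro iffI conjI ballI allI)
  assume f: "smooth_on S f"
  then have *: "Ck_on (Suc k) S f" for k unfolding smooth_on_def by blast
  show "f differentiable (at x)" if "x \<in> S" for x using *[of 0] that unfolding Ck_on_Suc by blast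
  show "smooth_on S (dird w f)" for w using * unfolding Ck_on_Suc smooth_on_def by blast
next
  assume "(\<forall>x\<in>S. f differentiable (at x)) \<and> (\<forall>w. smooth_on S (dird w f))"
  then have "Ck_on (Suc k) S f" for k unfolding Ck_on_Suc smooth_on_def by blast
  then show "smooth_on S f" unfolding smooth_on_def using Ck_on_SucD by blast
qed

lemma smooth_on_dird: "smooth_on S f \<Longrightarrow> smooth_on S (dird w f)"
  unfolding smooth_on_iff_dird[of S f] by blast

lemma smooth_on_differentiable: "smooth_on S f \<Longrightarrow> x \<in> S \<Longrightarrow> f differentiable (at x)"
  unfolding smooth_on_iff_dird[of S f] by blast

lemma smooth_on_has_derivative:
  "smooth_on S f \<Longrightarrow> x \<in> S \<Longrightarrow> (f has_derivative (\<lambda>w. dird w f x)) (at x)"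
  by (simp add: smooth_on_differentiable dird_has_derivative)

lemma smooth_on_continuous: "smooth_on S f \<Longrightarrow> continuous_on S f"
  unfolding smooth_on_def by (metis Ck_on.simps(1))

lemma smooth_on_cong: "open S \<Longrightarrow> (\<And>x. x \<in> S \<Longrightarrow> f x = g x) \<Longrightarrow> smooth_on S f \<Longrightarrow> smooth_on S g"
  unfolding smooth_on_def using Ck_on_cong by blast

lemma smooth_on_subset: "smooth_on S f \<Longrightarrow> T \<subseteq> S \<Longrightarrow> smooth_on T f"
  unfolding smooth_on_def using Ck_on_subset by blast

lemma smooth_on_const [simp]: "smooth_on S (\<lambda>x. c)"
  by (simp add: smooth_on_def)

lemma smooth_on_ident [simp]: "smooth_on S (\<lambda>x. x)"
  by (simp add: smooth_on_def Ck_on_ident)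

lemma smooth_on_linear: "bounded_linear L \<Longrightarrow> open S \<Longrightarrow> smooth_on S f \<Longrightarrow> smooth_on S (\<lambda>x. L (f x))"
  by (simp add: smooth_on_def Ck_on_linear)

lemma smooth_on_add: "open S \<Longrightarrow> smooth_on S f \<Longrightarrow> smooth_on S g \<Longrightarrow> smooth_on S (\<lambda>x. f x + g x)"
  by (simp add: smooth_on_def Ck_on_add)

lemma smooth_on_mult:
  fixes f g :: "'a::real_normed_vector \<Rightarrow> real"
  shows "open S \<Longrightarrow> smooth_on S f \<Longrightarrow> smooth_on S g \<Longrightarrow> smooth_on S (\<lambda>x. f x * g x)"
  by (simp add: smooth_on_def Ck_on_bilinear[OF bounded_bilinear_mult])

lemma smooth_on_minus: "open S \<Longrightarrow> smooth_on S f \<Longrightarrow> smooth_on S (\<lambda>x. - f x)"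
  by (rule smooth_on_linear[of uminus]) (simp_all add: bounded_linear_minus bounded_linear_ident)

lemma smooth_on_diff:
  "open S \<Longrightarrow> smooth_on S f \<Longrightarrow> smooth_on S g \<Longrightarrow> smooth_on S (\<lambda>x. f x - g x)"
  using smooth_on_add[of S f "\<lambda>x. - g x"] smooth_on_minus by auto

lemma smooth_on_compose:
  fixes f :: "'a::real_normed_vector \<Rightarrow> 'b::euclidean_space"
  shows "open S \<Longrightarrow> smooth_on T g \<Longrightarrow> smooth_on S f \<Longrightarrow> (\<And>x. x \<in> S \<Longrightarrow> f x \<in> T) \<Longrightarrow>
    smooth_on S (\<lambda>x. g (f x))"
  unfolding smooth_on_def by (blast intro: Ck_on_compose)

lemma smooth_on_fst: "open S \<Longrightarrow> smooth_on S f \<Longrightarrow> smooth_on S (\<lambda>x. fst (f x))"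
  by (rule smooth_on_linear[OF bounded_linear_fst])

lemma smooth_on_snd: "open S \<Longrightarrow> smooth_on S f \<Longrightarrow> smooth_on S (\<lambda>x. snd (f x))"
  by (rule smooth_on_linear[OF bounded_linear_snd])

lemma Ck_on_Pair: "open S \<Longrightarrow> Ck_on k S f \<Longrightarrow> Ck_on k S g \<Longrightarrow> Ck_on k S (\<lambda>x. (f x, g x))"
  using Ck_on_add[of k S "\<lambda>x. (f x, 0)" "\<lambda>x. (0, g x)"]
    Ck_on_linear[of "\<lambda>y. (y, 0)" k S f] Ck_on_linear[of "\<lambda>y. (0, y)" k S g]
  by (simp add: bounded_linear_Pair bounded_linear_ident bounded_linear_zero)

lemma smooth_on_Pair: "open S \<Longrightarrow> smooth_on S f \<Longrightarrow> smooth_on S g \<Longrightarrow> smooth_on S (\<lambda>x. (f x, g x))"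
  by (simp add: smooth_on_def Ck_on_Pair)

text \<open>The derivative of \<open>inverse\<close> is a polynomial in \<open>inverse\<close>, so
  the induction hypothesis covers it.\<close>

lemma Ck_on_real_inverse: "Ck_on k (- {0}) (inverse :: real \<Rightarrow> real)"
proof (induction k)
  case 0
  show ?case by (auto intro!: continuous_intros)
next
  case (Suc k)
  have op: "open (- {0::real})" by auto
  show ?case
  proof (rule Ck_on_SucI[OF op])
    show "(inverse has_derivative (\<lambda>w. - (inverse x * w * inverse x))) (at x)"
      if "x \<in> - {0}" for x :: real
      using that by (intro has_derivative_inverse') auto
    show "Ck_on k (- {0}) (\<lambda>x. - (inverse x * w * inverse x))" for w :: real
      by (intro Ck_on_linear[OF bounded_linear_minus[OF bounded_linear_ident]]
          Ck_on_bilinear[OF bounded_bilinear_mult] Suc Ck_on_const op)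
  qed
qed

lemma Ck_on_inverse:
  fixes f :: "'a::real_normed_vector \<Rightarrow> real"
  shows "open S \<Longrightarrow> Ck_on k S f \<Longrightarrow> (\<And>x. x \<in> S \<Longrightarrow> f x \<noteq> 0) \<Longrightarrow> Ck_on k S (\<lambda>x. inverse (f x))"
  by (rule Ck_on_compose[OF Ck_on_real_inverse]) auto

lemma smooth_on_inverse:
  fixes f :: "'a::real_normed_vector \<Rightarrow> real"
  shows "open S \<Longrightarrow> smooth_on S f \<Longrightarrow> (\<And>x. x \<in> S \<Longrightarrow> f x \<noteq> 0) \<Longrightarrow> smooth_on S (\<lambda>x. inverse (f x))"
  by (simp add: smooth_on_def Ck_on_inverse)

lemma Ck_on_real_exp: "Ck_on k UNIV (exp :: real \<Rightarrow> real)"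
proof (induction k)
  case 0
  show ?case by (auto intro!: continuous_intros)
next
  case (Suc k)
  show ?case
  proof (rule Ck_on_SucI[OF open_UNIV])
    show "(exp has_derivative (\<lambda>w. exp x * w)) (at x)" for x :: real
      using DERIV_exp[of x] by (simp add: has_field_derivative_def)
    show "Ck_on k UNIV (\<lambda>x. exp x * w)" for w :: real
      by (intro Ck_on_bilinear[OF bounded_bilinear_mult] Suc Ck_on_const open_UNIV)
  qed
qed

lemma smooth_on_exp:
  fixes f :: "'a::real_normed_vector \<Rightarrow> real"
  shows "open S \<Longrightarrow> smooth_on S f \<Longrightarrow> smooth_on S (\<lambda>x. exp (f x))"
  using smooth_on_compose[of S UNIV exp f] Ck_on_real_exp by (auto simp: smooth_on_def)

lemmas smooth_on_intros = smooth_on_const smooth_on_ident smooth_on_add smooth_on_mult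
  smooth_on_minus smooth_on_diff smooth_on_fst smooth_on_snd smooth_on_Pair smooth_on_exp

subsection \<open>Local inverses and total derivatives\<close>

abbreviation e1 :: "real \<times> real" where "e1 \<equiv> (1, 0)"
abbreviation e2 :: "real \<times> real" where "e2 \<equiv> (0, 1)"
abbreviation et :: point where "et \<equiv> (1, 0, 0)"
abbreviation ex :: point where "ex \<equiv> (0, 1, 0)"
abbreviation eu :: point where "eu \<equiv> (0, 0, 1)"

lemma dird_linear: "f differentiable (at x) \<Longrightarrow> linear (\<lambda>w. dird w f x)"
  by (rule has_derivative_linear[OF dird_has_derivative])

lemma dird_prod:
  fixes f :: "real \<times> real \<Rightarrow> 'b::real_normed_vector"
  assumes "f differentiable (at x)"
  shows "dird w f x = fst w *\<^sub>R dird e1 f x + snd w *\<^sub>R dird e2 f x"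
proof -
  have "w = fst w *\<^sub>R e1 + snd w *\<^sub>R e2" by (cases w) simp
  then have "dird w f x = dird (fst w *\<^sub>R e1 + snd w *\<^sub>R e2) f x" by simp
  also have "\<dots> = fst w *\<^sub>R dird e1 f x + snd w *\<^sub>R dird e2 f x"
    unfolding linear_add[OF dird_linear[OF assms]] linear_scale[OF dird_linear[OF assms]] ..
  finally show ?thesis .
qed

lemma dird_triple:
  fixes f :: "point \<Rightarrow> 'b::real_normed_vector"
  assumes "f differentiable (at x)"
  shows "dird (a, b, c) f x = a *\<^sub>R dird et f x + b *\<^sub>R dird ex f x + c *\<^sub>R dird eu f x"
proof -
  have "(a, b, c) = a *\<^sub>R et + b *\<^sub>R ex + c *\<^sub>R eu" by simp
  then have "dird (a, b, c) f x = dird (a *\<^sub>R et + b *\<^sub>R ex + c *\<^sub>R eu) f x" by simp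
  also have "\<dots> = a *\<^sub>R dird et f x + b *\<^sub>R dird ex f x + c *\<^sub>R dird eu f x"
    unfolding linear_add[OF dird_linear[OF assms]] linear_scale[OF dird_linear[OF assms]] ..
  finally show ?thesis .
qed

lemma dird_add:
  "f differentiable (at x) \<Longrightarrow> g differentiable (at x) \<Longrightarrow>
    dird w (\<lambda>x. f x + g x) x = dird w f x + dird w g x"
  by (rule dird_eq) (intro has_derivative_add dird_has_derivative)

lemma dird_mult:
  fixes f g :: "'a::real_normed_vector \<Rightarrow> real"
  shows "f differentiable (at x) \<Longrightarrow> g differentiable (at x) \<Longrightarrow>
    dird w (\<lambda>x. f x * g x) x = f x * dird w g x + dird w f x * g x"
  by (rule dird_eq) (intro has_derivative_mult dird_has_derivative)

lemma dird_compose_pair: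
  fixes G :: "real \<times> real \<Rightarrow> real"
  assumes "a differentiable (at q)" "b differentiable (at q)" "G differentiable (at (a q, b q))"
  shows "dird w (\<lambda>q. G (a q, b q)) q =
    dird e1 G (a q, b q) * dird w a q + dird e2 G (a q, b q) * dird w b q"
proof -
  have "((\<lambda>q. G (a q, b q)) has_derivative (\<lambda>w. dird (dird w a q, dird w b q) G (a q, b q))) (at q)"
    by (rule has_derivative_compose[of "\<lambda>q. (a q, b q)"])
      (intro has_derivative_Pair dird_has_derivative assms)+
  then have "dird w (\<lambda>q. G (a q, b q)) q = dird (dird w a q, dird w b q) G (a q, b q)"
    by (rule dird_eq)
  then show ?thesis
    using dird_prod[OF assms(3), of "(dird w a q, dird w b q)"] by (simp add: algebra_simps)
qed

lemma dird_compose_pair2: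
  fixes G :: "real \<times> real \<Rightarrow> real"
  assumes "open W" "smooth_on W a" "smooth_on W b" "smooth_on W' G"
    and "\<And>q. q \<in> W \<Longrightarrow> (a q, b q) \<in> W'" and "q \<in> W"
  shows "dird z (dird w (\<lambda>q. G (a q, b q))) q =
    (dird e1 (dird e1 G) (a q, b q) * dird z a q + dird e2 (dird e1 G) (a q, b q) * dird z b q) * dird w a q
    + dird e1 G (a q, b q) * dird z (dird w a) q
    + (dird e1 (dird e2 G) (a q, b q) * dird z a q + dird e2 (dird e2 G) (a q, b q) * dird z b q) * dird w b q
    + dird e2 G (a q, b q) * dird z (dird w b) q"
proof -
  have ab: "a differentiable (at q)" "b differentiable (at q)"
    using assms smooth_on_differentiable by blast+
  have dab: "dird w a differentiable (at q)" "dird w b differentiable (at q)"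
    using assms smooth_on_differentiable smooth_on_dird by blast+
  have G: "dird v G differentiable (at (a q, b q))" for v
    using smooth_on_differentiable[OF smooth_on_dird[OF assms(4)]] assms(5,6) by blast
  have sm: "smooth_on W (\<lambda>q. dird v G (a q, b q))" for v
    using smooth_on_compose[OF assms(1) smooth_on_dird[OF assms(4)] smooth_on_Pair[OF assms(1-3)] assms(5)] .
  have dG: "(\<lambda>q. dird v G (a q, b q)) differentiable (at q)" for v
    using smooth_on_differentiable[OF sm assms(6)] .
  have "dird w (\<lambda>q. G (a q, b q)) y =
      dird e1 G (a y, b y) * dird w a y + dird e2 G (a y, b y) * dird w b y" if "y \<in> W" for y
    using assms that by (intro dird_compose_pair) (auto intro: smooth_on_differentiable)
  then have "dird z (dird w (\<lambda>q. G (a q, b q))) q =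
      dird z (\<lambda>y. dird e1 G (a y, b y) * dird w a y + dird e2 G (a y, b y) * dird w b y) q"
    by (intro dird_cong[OF assms(1,6)])
  also have "\<dots> = dird z (\<lambda>y. dird e1 G (a y, b y) * dird w a y) q + dird z (\<lambda>y. dird e2 G (a y, b y) * dird w b y) q"
    by (intro dird_add differentiable_mult dG dab)
  finally show ?thesis
    unfolding dird_mult[OF dG dab(1)] dird_mult[OF dG dab(2)] dird_compose_pair[OF ab G]
    by (simp add: algebra_simps)
qed

text \<open>
  First and second total derivatives along a graph \<open>u = v(t, x)\<close>, with the derivatives of \<open>v\<close> as
  parameters: \<open>c = \<partial>\<^sub>w v\<close> in \<open>total1\<close>; \<open>c = \<partial>\<^sub>z v\<close>, \<open>d = \<partial>\<^sub>w v\<close>, \<open>k = \<partial>\<^sub>z \<partial>\<^sub>w v\<close> in \<open>total2\<close>.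
\<close>

definition total1 :: "real \<times> real \<Rightarrow> real \<Rightarrow> (point \<Rightarrow> real) \<Rightarrow> point \<Rightarrow> real" where
  "total1 w c F p = dird (fst w, snd w, 0) F p + c * dird eu F p"

definition total2 ::
  "real \<times> real \<Rightarrow> real \<times> real \<Rightarrow> real \<Rightarrow> real \<Rightarrow> real \<Rightarrow> (point \<Rightarrow> real) \<Rightarrow> point \<Rightarrow> real" where
  "total2 z w c d k F p =
    total1 z c (dird (fst w, snd w, 0) F) p + k * dird eu F p + d * total1 z c (dird eu F) p"

lemma dird_compose_graph:
  fixes F :: "point \<Rightarrow> real" and q :: "real \<times> real"
  assumes "v differentiable (at q)" "F differentiable (at (fst q, snd q, v q))"
  shows "dird w (\<lambda>q. F (fst q, snd q, v q)) q = total1 w (dird w v q) F (fst q, snd q, v q)"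
proof -
  have "((\<lambda>q. F (fst q, snd q, v q)) has_derivative
      (\<lambda>w. dird (fst w, snd w, dird w v q) F (fst q, snd q, v q))) (at q)"
    by (rule has_derivative_compose[of "\<lambda>q. (fst q, snd q, v q)"])
      (intro derivative_intros dird_has_derivative assms)+
  then have "dird w (\<lambda>q. F (fst q, snd q, v q)) q = dird (fst w, snd w, dird w v q) F (fst q, snd q, v q)"
    by (rule dird_eq)
  then show ?thesis
    using dird_triple[OF assms(2), of "fst w" "snd w" "dird w v q"]
      dird_triple[OF assms(2), of "fst w" "snd w" 0] by (simp add: total1_def)
qed

lemma smooth_on_compose_graph:
  fixes F :: "point \<Rightarrow> real"
  assumes "open W" "smooth_on W v" "smooth_on \<Omega> F"
    and "\<And>q. q \<in> W \<Longrightarrow> (fst q, snd q, v q) \<in> \<Omega>"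
  shows "smooth_on W (\<lambda>q. F (fst q, snd q, v q))"
  by (rule smooth_on_compose[OF assms(1,3) _ assms(4)]) (intro smooth_on_intros assms)+

lemma dird_compose_graph2:
  fixes F :: "point \<Rightarrow> real"
  assumes "open W" "smooth_on W v" "smooth_on \<Omega> F"
    and "\<And>q. q \<in> W \<Longrightarrow> (fst q, snd q, v q) \<in> \<Omega>" and "q \<in> W"
  shows "dird z (dird w (\<lambda>q. F (fst q, snd q, v q))) q =
    total2 z w (dird z v q) (dird w v q) (dird z (dird w v) q) F (fst q, snd q, v q)"
proof -
  have v: "v differentiable (at q)" and dv: "dird w v differentiable (at q)"
    using assms smooth_on_differentiable smooth_on_dird by blast+
  have F: "dird y F differentiable (at (fst q, snd q, v q))" for y
    using smooth_on_differentiable[OF smooth_on_dird[OF assms(3)]] assms(4,5) by blast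
  have dF: "(\<lambda>q. dird y F (fst q, snd q, v q)) differentiable (at q)" for y
    by (rule smooth_on_differentiable[OF _ assms(5)])
      (rule smooth_on_compose_graph[OF assms(1,2) smooth_on_dird[OF assms(3)] assms(4)])
  have "dird w (\<lambda>q. F (fst q, snd q, v q)) y =
      dird (fst w, snd w, 0) F (fst y, snd y, v y) + dird w v y * dird eu F (fst y, snd y, v y)"
    if "y \<in> W" for y
    unfolding total1_def[symmetric]
    by (rule dird_compose_graph[OF smooth_on_differentiable[OF assms(2) that]
          smooth_on_differentiable[OF assms(3) assms(4)[OF that]]])
  then have "dird z (dird w (\<lambda>q. F (fst q, snd q, v q))) q =
      dird z (\<lambda>y. dird (fst w, snd w, 0) F (fst y, snd y, v y)
        + dird w v y * dird eu F (fst y, snd y, v y)) q"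
    by (intro dird_cong[OF assms(1,5)])
  also have "\<dots> = dird z (\<lambda>y. dird (fst w, snd w, 0) F (fst y, snd y, v y)) q
      + dird z (\<lambda>y. dird w v y * dird eu F (fst y, snd y, v y)) q"
    by (intro dird_add differentiable_mult dF dv)
  finally show ?thesis
    by (simp add: dird_mult[OF dv dF] dird_compose_graph[OF v F] total2_def)
qed

text \<open>The inverse function theorem yields a homeomorphism whose inverse \<open>g\<close> is
  differentiable. Higher regularity is bootstrapped: the derivative of \<open>g\<close> at
  \<open>y\<close> is \<open>I (g y)\<close>, a smooth function of \<open>g y\<close>, so each order
  of differentiability of \<open>g\<close> entails the next.\<close>

lemma smooth_local_inverse:
  fixes a b :: "real \<times> real \<Rightarrow> real"
  assumes "open W0" "smooth_on W0 a" "smooth_on W0 b" "q0 \<in> W0"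
    and "dird e1 a q0 * dird e2 b q0 - dird e2 a q0 * dird e1 b q0 \<noteq> 0"
  obtains W W' g where "open W" "W \<subseteq> W0" "q0 \<in> W" "open W'" "smooth_on W' g"
    "\<And>q. q \<in> W \<Longrightarrow> (a q, b q) \<in> W' \<and> g (a q, b q) = q"
    "\<And>y. y \<in> W' \<Longrightarrow> g y \<in> W \<and> (a (g y), b (g y)) = y"
proof -
  define J where "J q = dird e1 a q * dird e2 b q - dird e2 a q * dird e1 b q" for q
  define F where "F q = (a q, b q)" for q
  define F' where "F' q w = (fst w * dird e1 a q + snd w * dird e2 a q, fst w * dird e1 b q + snd w * dird e2 b q)" for q w
  \<comment> \<open>The adjugate matrix divided by the determinant. This explicit inverse of
    \<open>F' q\<close> shows that it depends smoothly on \<open>q\<close> wherever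
    \<open>J q\<close> is nonzero.\<close>
  define I where "I q w = (inverse (J q) * (dird e2 b q * fst w - dird e2 a q * snd w),
    inverse (J q) * (dird e1 a q * snd w - dird e1 b q * fst w))" for q and w :: "real \<times> real"
  have J: "smooth_on W0 J"
    unfolding J_def using assms by (intro smooth_on_intros smooth_on_dird)
  define S where "S = {q \<in> W0. J q \<noteq> 0}"
  have "S = W0 \<inter> J -` (- {0})" by (auto simp: S_def)
  then have S: "open S"
    using continuous_open_preimage[OF smooth_on_continuous[OF J] assms(1), of "- {0}"] by auto
  have SW: "S \<subseteq> W0" by (auto simp: S_def)
  have bl: "bounded_linear (F' q)" "bounded_linear (I q)" for q
    unfolding linear_conv_bounded_linear[symmetric]
    by (rule linearI; simp add: F'_def I_def algebra_simps)+
  have IF: "I q (F' q w) = w" "F' q (I q w) = w" if "J q \<noteq> 0" for q w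
  proof -
    show "I q (F' q w) = w"
      using that by (cases w) (simp add: I_def F'_def inverse_eq_divide divide_eq_eq,
          simp add: J_def algebra_simps)
    show "F' q (I q w) = w"
      using that by (cases w) (simp add: I_def F'_def inverse_eq_divide field_simps,
          simp add: J_def algebra_simps)
  qed
  have der: "(F has_derivative F' q) (at q)" if "q \<in> S" for q
  proof -
    have d: "a differentiable (at q)" "b differentiable (at q)"
      using that SW assms smooth_on_differentiable by blast+
    have "(F has_derivative (\<lambda>w. (dird w a q, dird w b q))) (at q)"
      unfolding F_def by (intro has_derivative_Pair dird_has_derivative d)
    moreover have "(\<lambda>w. (dird w a q, dird w b q)) = F' q"
    proof (rule ext)
      show "(dird w a q, dird w b q) = F' q w" for w
        using dird_prod[OF d(1), of w] dird_prod[OF d(2), of w] unfolding F'_def by (simp only: real_scaleR_def)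
    qed
    ultimately show ?thesis by simp
  qed
  have ap: "blinfun_apply (Blinfun (F' q)) = F' q" for q
    by (simp add: bounded_linear_Blinfun_apply bl)
  \<comment> \<open>Continuity into the space of bounded operators, tested on each vector separately
    since the domain has finite dimension.\<close>
  have cont: "continuous_on S (\<lambda>q. Blinfun (F' q))"
  proof (rule continuous_on_blinfun_componentwise)
    show "continuous_on S (\<lambda>q. blinfun_apply (Blinfun (F' q)) i)" for i
      unfolding ap F'_def using assms(2,3) SW
      by (intro continuous_intros smooth_on_continuous smooth_on_dird) (auto intro: smooth_on_subset)
  qed
  have "q0 \<in> S" using assms by (simp add: S_def J_def)
  then have inv: "Blinfun (I q0) o\<^sub>L Blinfun (F' q0) = id_blinfun"
    by (intro blinfun_eqI) (simp add: ap bounded_linear_Blinfun_apply bl IF S_def)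
  have der': "(F has_derivative blinfun_apply (Blinfun (F' q))) (at q)" if "q \<in> S" for q
    unfolding ap by (rule der[OF that])
  obtain U V g g' where U: "open U" "U \<subseteq> S" "q0 \<in> U" "open V" "F q0 \<in> V" "homeomorphism U V F g"
    and g: "\<And>y. y \<in> V \<Longrightarrow> (g has_derivative (g' y)) (at y)"
    and g': "\<And>y. y \<in> V \<Longrightarrow> g' y = inv (blinfun_apply (Blinfun (F' (g y))))"
    by (rule inverse_function_theorem[OF S der' cont \<open>q0 \<in> S\<close> inv]) (assumption, rule that)
  have gV: "g y \<in> U" "F (g y) = y" if "y \<in> V" for y
    using U(6) that by (auto simp: homeomorphism_def)
  have gU: "F q \<in> V" "g (F q) = q" if "q \<in> U" for q
    using U(6) that by (auto simp: homeomorphism_def)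
  have der_g: "(g has_derivative (\<lambda>w. I (g y) w)) (at y)" if "y \<in> V" for y
  proof -
    have "J (g y) \<noteq> 0" using gV[OF that] U(2) by (auto simp: S_def)
    then have "inv (F' (g y)) = I (g y)"
      by (intro inv_equality) (auto simp: IF)
    then show ?thesis using g[OF that] g'[OF that] by (simp add: ap)
  qed
  have "Ck_on k V g" for k
  proof (induction k)
    case 0
    show ?case using U(6) by (simp add: homeomorphism_def)
  next
    case (Suc k)
    show ?case
    proof (rule Ck_on_SucI[OF U(4), of g "\<lambda>w y. I (g y) w"])
      fix w
      have "smooth_on S a" "smooth_on S b" "smooth_on S J"
        using assms(2,3) J SW smooth_on_subset by blast+
      then have "smooth_on S (\<lambda>q. I q w)"
        unfolding I_def
        by (intro smooth_on_Pair smooth_on_mult smooth_on_diff smooth_on_inverse smooth_on_const S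
            smooth_on_dird) (auto simp: S_def)
      then show "Ck_on k V (\<lambda>y. I (g y) w)"
        using gV(1) U(2) by (intro Ck_on_compose[OF _ Suc U(4), of S]) (auto simp: smooth_on_def)
    qed (rule der_g)
  qed
  then have "smooth_on V g" by (simp add: smooth_on_def)
  with that[OF U(1) _ U(3,4)] U(2) SW gV gU show thesis
    unfolding F_def by (metis (no_types, lifting) order_trans)
qed

subsection \<open>Transformation of jets\<close>

lemma has_real_derivative_fst:
  fixes v :: "real \<times> real \<Rightarrow> real"
  assumes "v differentiable (at (t, x))"
  shows "((\<lambda>s. v (s, x)) has_real_derivative dird e1 v (t, x)) (at t)"
proof -
  have "((\<lambda>s. v (s, x)) has_derivative (\<lambda>w. dird (w, 0) v (t, x))) (at t)"
    by (rule has_derivative_compose[of "\<lambda>s. (s, x)"])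
      (intro derivative_intros dird_has_derivative assms)+
  moreover have "(\<lambda>w. dird (w, 0) v (t, x)) = (*) (dird e1 v (t, x))"
  proof (rule ext)
    show "dird (w, 0) v (t, x) = dird e1 v (t, x) * w" for w
      by (subst dird_prod[OF assms]) simp
  qed
  ultimately show ?thesis by (simp only: has_field_derivative_def)
qed

lemma has_real_derivative_snd:
  fixes v :: "real \<times> real \<Rightarrow> real"
  assumes "v differentiable (at (t, x))"
  shows "((\<lambda>y. v (t, y)) has_real_derivative dird e2 v (t, x)) (at x)"
proof -
  have "((\<lambda>y. v (t, y)) has_derivative (\<lambda>w. dird (0, w) v (t, x))) (at x)"
    by (rule has_derivative_compose[of "\<lambda>y. (t, y)"])
      (intro derivative_intros dird_has_derivative assms)+
  moreover have "(\<lambda>w. dird (0, w) v (t, x)) = (*) (dird e2 v (t, x))"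
  proof (rule ext)
    show "dird (0, w) v (t, x) = dird e2 v (t, x) * w" for w
      by (subst dird_prod[OF assms]) simp
  qed
  ultimately show ?thesis by (simp only: has_field_derivative_def)
qed

text \<open>The equation with its outer derivative expanded, as an algebraic condition on a 2-jet;
  \<open>b\<close>, \<open>r\<close>, \<open>m\<close> stand for \<open>u_x\<close>,
  \<open>u_tt\<close>, \<open>u_xx\<close>. The derivatives \<open>u_t\<close> and
  \<open>u_tx\<close> do not occur in it, which the later arguments exploit.\<close>

definition jet_equation :: "arbitrary_elements \<Rightarrow> real \<Rightarrow> real \<Rightarrow> real \<Rightarrow> real \<Rightarrow> real \<Rightarrow> bool" where
  "jet_equation = (\<lambda>(f, h, H, K) x u b r m.
     f x * r = h x * H u * m + deriv h x * H u * b + h x * deriv H u * b\<^sup>2 + h x * K u * b)"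

lemma equation_holds_at_iff:
  assumes W: "open W" and v: "smooth_on W v" and q: "(t, x) \<in> W"
    and h: "h differentiable (at x)" and H: "H differentiable (at (v (t, x)))"
  shows "equation_holds_at (f, h, H, K) v (t, x) \<longleftrightarrow>
    jet_equation (f, h, H, K) x (v (t, x)) (dird e2 v (t, x))
      (dird e1 (dird e1 v) (t, x)) (dird e2 (dird e2 v) (t, x))"
proof -
  \<comment> \<open>The inner derivatives are differentiated again, so they must agree with partial
    derivatives on open slices of \<open>W\<close> through the point and not merely at the
    point.\<close>
  define S1 where "S1 = {s. (s, x) \<in> W}"
  define S2 where "S2 = {y. (t, y) \<in> W}"
  have "S1 = (\<lambda>s. (s, x)) -` W" "S2 = (\<lambda>y. (t, y)) -` W"
    by (auto simp: S1_def S2_def)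
  then have S: "open S1" "open S2" "t \<in> S1" "x \<in> S2"
    using W q by (auto intro!: open_vimage continuous_intros)
  have d: "v differentiable (at q)" "dird w v differentiable (at q)" if "q \<in> W" for q w
    using smooth_on_differentiable[OF v that] smooth_on_differentiable[OF smooth_on_dird[OF v] that] .
  have d1: "deriv (\<lambda>r. v (r, x)) s = dird e1 v (s, x)" if "s \<in> S1" for s
    using that d by (intro DERIV_imp_deriv has_real_derivative_fst) (auto simp: S1_def)
  have d2: "deriv (\<lambda>z. v (t, z)) y = dird e2 v (t, y)" if "y \<in> S2" for y
    using that d by (intro DERIV_imp_deriv has_real_derivative_snd) (auto simp: S2_def)
  have "((\<lambda>s. deriv (\<lambda>r. v (r, x)) s) has_real_derivative dird e1 (dird e1 v) (t, x)) (at t)"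
    by (rule has_field_derivative_transform_within_open[OF has_real_derivative_fst[OF d(2)[OF q]] S(1,3)])
      (simp add: d1)
  then have tt: "deriv (\<lambda>s. deriv (\<lambda>r. v (r, x)) s) t = dird e1 (dird e1 v) (t, x)"
    by (rule DERIV_imp_deriv)
  have dh: "(h has_real_derivative deriv h x) (at x)"
    and dH: "(H has_real_derivative deriv H (v (t, x))) (at (v (t, x)))"
    using h H by (simp_all add: DERIV_deriv_iff_real_differentiable)
  note dv = has_real_derivative_snd[OF d(1)[OF q]]
  note dv2 = has_real_derivative_snd[OF d(2)[OF q], of e2]
  have dHv: "((\<lambda>y. H (v (t, y))) has_real_derivative deriv H (v (t, x)) * dird e2 v (t, x)) (at x)"
    by (rule DERIV_chain2[OF dH dv])
  have "((\<lambda>y. h y * H (v (t, y)) * dird e2 v (t, y)) has_real_derivative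
      (deriv h x * H (v (t, x)) + deriv H (v (t, x)) * dird e2 v (t, x) * h x) * dird e2 v (t, x)
       + dird e2 (dird e2 v) (t, x) * (h x * H (v (t, x)))) (at x)"
    by (rule DERIV_mult[OF DERIV_mult[OF dh dHv] dv2])
  then have "((\<lambda>y. h y * H (v (t, y)) * deriv (\<lambda>z. v (t, z)) y) has_real_derivative
      (deriv h x * H (v (t, x)) + deriv H (v (t, x)) * dird e2 v (t, x) * h x) * dird e2 v (t, x)
       + dird e2 (dird e2 v) (t, x) * (h x * H (v (t, x)))) (at x)"
    by (rule has_field_derivative_transform_within_open[OF _ S(2,4)]) (simp add: d2)
  then have xx: "deriv (\<lambda>y. h y * H (v (t, y)) * deriv (\<lambda>z. v (t, z)) y) x =
      (deriv h x * H (v (t, x)) + deriv H (v (t, x)) * dird e2 v (t, x) * h x) * dird e2 v (t, x)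
       + dird e2 (dird e2 v) (t, x) * (h x * H (v (t, x)))"
    by (rule DERIV_imp_deriv)
  show ?thesis
    unfolding equation_holds_at_def jet_equation_def prod.case tt xx d2[OF S(4)]
    by (simp add: algebra_simps power2_eq_square)
qed

text \<open>The identity \<open>U = v' (T, X)\<close> holds along the whole graph over
  \<open>W\<close>. The last two claims are its first and second derivatives, with the chain rule
  along a graph on the left and, on the right, the one for a function of two variables.\<close>

lemma graph_transformation:
  fixes T X U :: "point \<Rightarrow> real" and v v' :: "real \<times> real \<Rightarrow> real" and q :: "real \<times> real"
  assumes sm: "smooth_on \<Omega> T" "smooth_on \<Omega> X" "smooth_on \<Omega> U"
    and \<Phi>: "\<forall>p\<in>\<Omega>. \<Phi> p = (T p, X p, U p)"
    and W: "open W" "smooth_on W v" "graph_over W v \<subseteq> \<Omega>"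
    and W': "open W'" "smooth_on W' v'" "\<Phi> ` graph_over W v = graph_over W' v'"
    and q: "q \<in> W"
  defines "p \<equiv> (fst q, snd q, v q)"
  defines "q' \<equiv> (T p, X p)"
  shows "q' \<in> W'" and "U p = v' q'"
    and "total1 w (dird w v q) U p = dird e1 v' q' * total1 w (dird w v q) T p
      + dird e2 v' q' * total1 w (dird w v q) X p"
    and "total2 z w (dird z v q) (dird w v q) (dird z (dird w v) q) U p =
      (dird e1 (dird e1 v') q' * total1 z (dird z v q) T p
        + dird e2 (dird e1 v') q' * total1 z (dird z v q) X p) * total1 w (dird w v q) T p
      + dird e1 v' q' * total2 z w (dird z v q) (dird w v q) (dird z (dird w v) q) T p
      + (dird e1 (dird e2 v') q' * total1 z (dird z v q) T p
        + dird e2 (dird e2 v') q' * total1 z (dird z v q) X p) * total1 w (dird w v q) X p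
      + dird e2 v' q' * total2 z w (dird z v q) (dird w v q) (dird z (dird w v) q) X p"
proof -
  define g where "g q = (fst q, snd q, v q)" for q
  have g\<Omega>: "(fst q, snd q, v q) \<in> \<Omega>" if "q \<in> W" for q
    using W(3) that by (cases q) (auto simp: graph_over_def)
  have gr: "(T (fst q, snd q, v q), X (fst q, snd q, v q)) \<in> W' \<and>
      U (fst q, snd q, v q) = v' (T (fst q, snd q, v q), X (fst q, snd q, v q))"
    if "q \<in> W" for q
  proof -
    have "(fst q, snd q, v q) \<in> graph_over W v"
      using that by (cases q) (force simp: graph_over_def)
    then have "\<Phi> (fst q, snd q, v q) \<in> graph_over W' v'" using W'(3) by blast
    then show ?thesis by (auto simp: bspec[OF \<Phi> g\<Omega>[OF that]] graph_over_def)
  qed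
  from gr have T'X': "(T (fst y, snd y, v y), X (fst y, snd y, v y)) \<in> W'" if "y \<in> W" for y
    using that by blast
  have D2: "dird z (dird w (\<lambda>q. F (fst q, snd q, v q))) q =
      total2 z w (dird z v q) (dird w v q) (dird z (dird w v) q) F (fst q, snd q, v q)"
    if "smooth_on \<Omega> F" for F :: "point \<Rightarrow> real" and z w
    by (rule dird_compose_graph2[OF W(1,2) that _ q]) (rule g\<Omega>)
  from gr show "q' \<in> W'" "U p = v' q'" using q by (auto simp: p_def q'_def)
  have sT: "smooth_on W (\<lambda>q. T (fst q, snd q, v q))" and sX: "smooth_on W (\<lambda>q. X (fst q, snd q, v q))"
    by (rule smooth_on_compose_graph[OF W(1,2) sm(1)] smooth_on_compose_graph[OF W(1,2) sm(2)],
        rule g\<Omega>, assumption)+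
  have dw: "dird w (\<lambda>q. U (fst q, snd q, v q)) y =
      dird w (\<lambda>q. v' (T (fst q, snd q, v q), X (fst q, snd q, v q))) y" if "y \<in> W" for w y
    by (rule dird_cong[OF W(1) that]) (use gr in blast)
  have d: "v differentiable (at q)" "F differentiable (at (fst q, snd q, v q))"
    if "smooth_on \<Omega> F" for F :: "point \<Rightarrow> real"
    using smooth_on_differentiable[OF W(2) q] smooth_on_differentiable[OF that g\<Omega>[OF q]] .
  have "dird w (\<lambda>q. U (fst q, snd q, v q)) q =
      dird w (\<lambda>q. v' (T (fst q, snd q, v q), X (fst q, snd q, v q))) q"
    by (rule dw[OF q])
  also have "\<dots> = dird e1 v' (T (fst q, snd q, v q), X (fst q, snd q, v q)) * dird w (\<lambda>q. T (fst q, snd q, v q)) q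
     + dird e2 v' (T (fst q, snd q, v q), X (fst q, snd q, v q)) * dird w (\<lambda>q. X (fst q, snd q, v q)) q"
    by (rule dird_compose_pair[OF smooth_on_differentiable[OF sT q] smooth_on_differentiable[OF sX q]
          smooth_on_differentiable[OF W'(2)]]) (use gr q in blast)
  finally show "total1 w (dird w v q) U p = dird e1 v' q' * total1 w (dird w v q) T p
      + dird e2 v' q' * total1 w (dird w v q) X p"
    unfolding dird_compose_graph[OF d[OF sm(1)]] dird_compose_graph[OF d[OF sm(2)]]
      dird_compose_graph[OF d[OF sm(3)]] p_def q'_def .
  have "dird z (dird w (\<lambda>q. U (fst q, snd q, v q))) q =
      dird z (dird w (\<lambda>q. v' (T (fst q, snd q, v q), X (fst q, snd q, v q)))) q"
    by (rule dird_cong[OF W(1) q dw])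
  also note dird_compose_pair2[OF W(1) sT sX W'(2) T'X' q]
  finally show "total2 z w (dird z v q) (dird w v q) (dird z (dird w v) q) U p =
      (dird e1 (dird e1 v') q' * total1 z (dird z v q) T p
        + dird e2 (dird e1 v') q' * total1 z (dird z v q) X p) * total1 w (dird w v q) T p
      + dird e1 v' q' * total2 z w (dird z v q) (dird w v q) (dird z (dird w v) q) T p
      + (dird e1 (dird e2 v') q' * total1 z (dird z v q) T p
        + dird e2 (dird e2 v') q' * total1 z (dird z v q) X p) * total1 w (dird w v q) X p
      + dird e2 v' q' * total2 z w (dird z v q) (dird w v q) (dird z (dird w v) q) X p"
    unfolding dird_compose_graph[OF d[OF sm(1)]] dird_compose_graph[OF d[OF sm(2)]]
      D2[OF sm(1)] D2[OF sm(2)] D2[OF sm(3)] p_def q'_def .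
qed

text \<open>A Taylor polynomial. Through it the condition of \<open>maps_equation\<close> on all
  smooth functions becomes a condition on all 2-jets.\<close>

lemma quadratic_jet:
  fixes t x u a b r s m :: real
  obtains v where "smooth_on UNIV v" "v (t, x) = u"
    "dird e1 v (t, x) = a" "dird e2 v (t, x) = b"
    "dird e1 (dird e1 v) (t, x) = r" "dird e2 (dird e2 v) (t, x) = m"
    "dird e1 (dird e2 v) (t, x) = s" "dird e2 (dird e1 v) (t, x) = s"
proof -
  define v where "v q = u + a * (fst q - t) + b * (snd q - x) + r / 2 * (fst q - t)\<^sup>2
    + s * (fst q - t) * (snd q - x) + m / 2 * (snd q - x)\<^sup>2" for q :: "real \<times> real"
  have D1: "dird w v q = fst w * (a + r * (fst q - t) + s * (snd q - x))
      + snd w * (b + s * (fst q - t) + m * (snd q - x))" for w q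
    unfolding v_def by (rule dird_eq) (auto intro!: derivative_eq_intros simp: field_simps)
  have "dird z (\<lambda>q. fst w * (a + r * (fst q - t) + s * (snd q - x))
      + snd w * (b + s * (fst q - t) + m * (snd q - x))) q =
      fst w * (r * fst z + s * snd z) + snd w * (s * fst z + m * snd z)" for w z :: "real \<times> real" and q
    by (rule dird_eq) (auto intro!: derivative_eq_intros simp: algebra_simps)
  moreover have "dird w v = (\<lambda>q. fst w * (a + r * (fst q - t) + s * (snd q - x))
      + snd w * (b + s * (fst q - t) + m * (snd q - x)))" for w
    by (rule ext) (rule D1)
  ultimately have D2: "dird z (dird w v) q = fst w * (r * fst z + s * snd z) + snd w * (s * fst z + m * snd z)"
    for w z q by simp
  have "smooth_on UNIV v"
    unfolding v_def power2_eq_square by (intro smooth_on_intros open_UNIV)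
  then show thesis by (rule that) (simp_all add: D1 D2, simp add: v_def)
qed

lemma total1_simps [simp]:
  "total1 e1 c F p = dird et F p + c * dird eu F p"
  "total1 e2 c F p = dird ex F p + c * dird eu F p"
  by (simp_all add: total1_def)

text \<open>
  The 2-jet with derivatives \<open>a = u\<^sub>t\<close>, \<open>b = u\<^sub>x\<close>, \<open>r = u\<^sub>t\<^sub>t\<close>, \<open>s = u\<^sub>t\<^sub>x\<close>, \<open>m = u\<^sub>x\<^sub>x\<close> at \<open>p\<close> is
  carried to the one with derivatives \<open>P1, P2\<close> and \<open>N11, N12, N21, N22\<close>. Symmetry of the latter
  is not needed, so both mixed derivatives are kept.
\<close>

definition jet_relation ::
  "(point \<Rightarrow> real) \<Rightarrow> (point \<Rightarrow> real) \<Rightarrow> (point \<Rightarrow> real) \<Rightarrow> point \<Rightarrow>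
    real \<Rightarrow> real \<Rightarrow> real \<Rightarrow> real \<Rightarrow> real \<Rightarrow>
    real \<Rightarrow> real \<Rightarrow> real \<Rightarrow> real \<Rightarrow> real \<Rightarrow> real \<Rightarrow> bool" where
  "jet_relation T X U p a b r s m P1 P2 N11 N12 N21 N22 \<longleftrightarrow>
    (total1 e1 a U p = P1 * total1 e1 a T p + P2 * total1 e1 a X p) \<and>
    (total1 e2 b U p = P1 * total1 e2 b T p + P2 * total1 e2 b X p) \<and>
    (total2 e1 e1 a a r U p = (N11 * total1 e1 a T p + N21 * total1 e1 a X p) * total1 e1 a T p
      + P1 * total2 e1 e1 a a r T p
      + (N12 * total1 e1 a T p + N22 * total1 e1 a X p) * total1 e1 a X p
      + P2 * total2 e1 e1 a a r X p) \<and>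
    (total2 e1 e2 a b s U p = (N11 * total1 e1 a T p + N21 * total1 e1 a X p) * total1 e2 b T p
      + P1 * total2 e1 e2 a b s T p
      + (N12 * total1 e1 a T p + N22 * total1 e1 a X p) * total1 e2 b X p
      + P2 * total2 e1 e2 a b s X p) \<and>
    (total2 e2 e1 b a s U p = (N11 * total1 e2 b T p + N21 * total1 e2 b X p) * total1 e1 a T p
      + P1 * total2 e2 e1 b a s T p
      + (N12 * total1 e2 b T p + N22 * total1 e2 b X p) * total1 e1 a X p
      + P2 * total2 e2 e1 b a s X p) \<and>
    (total2 e2 e2 b b m U p = (N11 * total1 e2 b T p + N21 * total1 e2 b X p) * total1 e2 b T p
      + P1 * total2 e2 e2 b b m T p
      + (N12 * total1 e2 b T p + N22 * total1 e2 b X p) * total1 e2 b X p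
      + P2 * total2 e2 e2 b b m X p)"

text \<open>\<open>J\<close> is the Jacobian of \<open>(T, X)\<close> along the graph of the
  polynomial with the given jet. Near the point the new independent variables can therefore be
  inverted, and \<open>v'\<close> is \<open>U\<close> on the graph composed with this inverse.
  Shrinking \<open>W\<close> to the domain of the local inverse makes the image of the graph exactly
  a graph, as \<open>maps_equation\<close> demands.\<close>

lemma jet_transformation:
  fixes T X U :: "point \<Rightarrow> real" and t x u a b r s m :: real
  assumes \<Omega>: "open \<Omega>" and sm: "smooth_on \<Omega> T" "smooth_on \<Omega> X" "smooth_on \<Omega> U"
    and \<Phi>: "\<forall>p\<in>\<Omega>. \<Phi> p = (T p, X p, U p)"
    and maps: "maps_equation \<Omega> \<Phi> (f, h, H, K) (f', h', H', K')"
  defines "p \<equiv> (t, x, u)"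
  assumes p: "p \<in> \<Omega>"
    and d: "h differentiable (at x)" "H differentiable (at u)"
    and d': "h' differentiable (at (X p))" "H' differentiable (at (U p))"
    and J: "total1 e1 a T p * total1 e2 b X p - total1 e2 b T p * total1 e1 a X p \<noteq> 0"
  obtains P1 P2 N11 N12 N21 N22 where "jet_relation T X U p a b r s m P1 P2 N11 N12 N21 N22" and
    "jet_equation (f, h, H, K) x u b r m \<longleftrightarrow> jet_equation (f', h', H', K') (X p) (U p) P2 N11 N22"
proof -
  obtain v where v: "smooth_on UNIV v" and vq: "v (t, x) = u"
    "dird e1 v (t, x) = a" "dird e2 v (t, x) = b"
    "dird e1 (dird e1 v) (t, x) = r" "dird e2 (dird e2 v) (t, x) = m"
    "dird e1 (dird e2 v) (t, x) = s" "dird e2 (dird e1 v) (t, x) = s"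
    by (rule quadratic_jet)
  define W0 where "W0 = (\<lambda>q. (fst q, snd q, v q)) -` \<Omega>"
  have W0: "open W0"
    unfolding W0_def using smooth_on_continuous[OF v] by (intro open_vimage \<Omega> continuous_intros)
  have v0: "smooth_on W0 v" using v by (rule smooth_on_subset) simp
  have g: "(fst q, snd q, v q) \<in> \<Omega>" if "q \<in> W0" for q using that by (simp add: W0_def)
  have q0: "(t, x) \<in> W0" using p by (simp add: W0_def vq p_def)
  have tot: "dird w (\<lambda>q. F (fst q, snd q, v q)) (t, x) = total1 w (dird w v (t, x)) F p"
    if "smooth_on \<Omega> F" for w and F :: "point \<Rightarrow> real"
    using dird_compose_graph[OF smooth_on_differentiable[OF v0 q0] smooth_on_differentiable[OF that g[OF q0]], of w]
    by (simp add: vq p_def del: total1_simps)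
  have sW0: "smooth_on W0 (\<lambda>q. F (fst q, snd q, v q))" if "smooth_on \<Omega> F" for F :: "point \<Rightarrow> real"
    by (rule smooth_on_compose_graph[OF W0 v0 that]) (rule g)
  obtain W W' g' where W: "open W" "W \<subseteq> W0" "(t, x) \<in> W" "open W'" "smooth_on W' g'"
    and gW: "\<And>q. q \<in> W \<Longrightarrow> (T (fst q, snd q, v q), X (fst q, snd q, v q)) \<in> W' \<and>
        g' (T (fst q, snd q, v q), X (fst q, snd q, v q)) = q"
    and gW': "\<And>y. y \<in> W' \<Longrightarrow> g' y \<in> W \<and>
        (T (fst (g' y), snd (g' y), v (g' y)), X (fst (g' y), snd (g' y), v (g' y))) = y"
  proof (rule smooth_local_inverse[OF W0 sW0[OF sm(1)] sW0[OF sm(2)] q0], goal_cases)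
    case 1
    show ?case unfolding tot[OF sm(1)] tot[OF sm(2)] vq by (rule J)
  qed blast
  define v' where "v' y = U (fst (g' y), snd (g' y), v (g' y))" for y
  have sv': "smooth_on W' v'"
    unfolding v'_def
    by (rule smooth_on_compose[OF W(4) sW0[OF sm(3)] W(5)])
      (use gW' W(2) in blast)
  have vW: "smooth_on W v" using v0 W(2) by (rule smooth_on_subset)
  have sub: "graph_over W v \<subseteq> \<Omega>" using W(2) by (auto simp: graph_over_def W0_def)
  have img: "\<Phi> ` graph_over W v = graph_over W' v'"
  proof (intro equalityI subsetI)
    fix z assume "z \<in> \<Phi> ` graph_over W v"
    then obtain q where q: "q \<in> W" "z = \<Phi> (fst q, snd q, v q)" by (force simp: graph_over_def)
    have "z = (T (fst q, snd q, v q), X (fst q, snd q, v q), U (fst q, snd q, v q))"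
      using q W(2) \<Phi> g by blast
    with gW[OF q(1)] show "z \<in> graph_over W' v'"
      unfolding graph_over_def v'_def by (force simp: image_iff)
  next
    fix z assume "z \<in> graph_over W' v'"
    then obtain y where y: "y \<in> W'" "z = (fst y, snd y, v' y)" by (force simp: graph_over_def)
    define q where "q = g' y"
    have q: "q \<in> W" "(T (fst q, snd q, v q), X (fst q, snd q, v q)) = y"
      using gW'[OF y(1)] by (simp_all add: q_def)
    have "z = \<Phi> (fst q, snd q, v q)"
      using q y(2) W(2) \<Phi> g[of q] by (auto simp: v'_def q_def[symmetric])
    moreover have "(fst q, snd q, v q) \<in> graph_over W v"
      using q(1) by (cases q) (force simp: graph_over_def)
    ultimately show "z \<in> \<Phi> ` graph_over W v" by blast
  qed
  note gt = graph_transformation[OF sm \<Phi> W(1) vW sub W(4) sv' img W(3), unfolded fst_conv snd_conv vq, folded p_def]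
  have "equation_holds_at (f, h, H, K) v (t, x) \<longleftrightarrow> equation_holds_at (f', h', H', K') v' (T p, X p)"
    using maps W vW sub sv' img unfolding maps_equation_def
    by (metis \<Phi> p p_def vq(1))
  moreover have "equation_holds_at (f, h, H, K) v (t, x) \<longleftrightarrow> jet_equation (f, h, H, K) x u b r m"
    using equation_holds_at_iff[OF W(1) vW W(3), of h H f K] d by (simp add: vq)
  moreover have "equation_holds_at (f', h', H', K') v' (T p, X p) \<longleftrightarrow>
    jet_equation (f', h', H', K') (X p) (U p) (dird e2 v' (T p, X p)) (dird e1 (dird e1 v') (T p, X p))
      (dird e2 (dird e2 v') (T p, X p))"
    using equation_holds_at_iff[OF W(4) sv' gt(1), of h' H' f' K'] d' gt(2) by simp
  ultimately have jet: "jet_equation (f, h, H, K) x u b r m \<longleftrightarrow>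
    jet_equation (f', h', H', K') (X p) (U p) (dird e2 v' (T p, X p)) (dird e1 (dird e1 v') (T p, X p))
      (dird e2 (dird e2 v') (T p, X p))" by simp
  from gt(3)[of e1] gt(3)[of e2] gt(4)[of e1 e1] gt(4)[of e1 e2] gt(4)[of e2 e1] gt(4)[of e2 e2]
  have "jet_relation T X U p a b r s m (dird e1 v' (T p, X p)) (dird e2 v' (T p, X p))
      (dird e1 (dird e1 v') (T p, X p)) (dird e1 (dird e2 v') (T p, X p))
      (dird e2 (dird e1 v') (T p, X p)) (dird e2 (dird e2 v') (T p, X p))"
    unfolding vq jet_relation_def by (intro conjI)
  from this jet show thesis by (rule that)
qed

section \<open>Functions with vanishing directional derivatives\<close>

lemma dird_zero_on:
  assumes "open S" "p \<in> S" "\<And>q. q \<in> S \<Longrightarrow> F q = 0"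
  shows "dird w F p = 0"
  using dird_cong[OF assms(1,2), of F "\<lambda>_. 0" w] assms(3) dird_eq[OF has_derivative_const, of w 0 p] by simp

lemma dird_direction:
  assumes "F differentiable (at (q + s *\<^sub>R w))"
  shows "((\<lambda>s. F (q + s *\<^sub>R w)) has_derivative (\<lambda>r. r *\<^sub>R dird w F (q + s *\<^sub>R w))) (at s within A)"
proof -
  have "((\<lambda>s. F (q + s *\<^sub>R w)) has_derivative (\<lambda>r. dird (r *\<^sub>R w) F (q + s *\<^sub>R w))) (at s within A)"
    by (rule has_derivative_compose[of "\<lambda>s. q + s *\<^sub>R w" _ _ _ F])
      (auto intro!: derivative_eq_intros dird_has_derivative assms)
  then show ?thesis unfolding linear_scale[OF dird_linear[OF assms]] .
qed

text \<open>
  The only case of the symmetry of second derivatives that is needed: \<open>F\<close> is locally invariant under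
  translations along \<open>w\<close>, hence so is every directional derivative of \<open>F\<close>.
\<close>

lemma dird_commute_zero:
  fixes F :: "'a::real_normed_vector \<Rightarrow> 'b::real_normed_vector"
  assumes "open S" "smooth_on S F" "\<And>q. q \<in> S \<Longrightarrow> dird w F q = 0" "p \<in> S"
  shows "dird w (dird z F) p = 0"
proof -
  \<comment> \<open>Twice the radius: a point within \<delta> of \<open>p\<close>, moved by less
    than \<delta> along \<open>w\<close>, still lies in \<open>S\<close>.\<close>
  obtain \<delta> where \<delta>: "\<delta> > 0" "ball p (2 * \<delta>) \<subseteq> S"
    using openE[OF assms(1,4)] by (metis field_sum_of_halves half_gt_zero_iff mult_2)
  define A where "A = {s. norm (s *\<^sub>R w) < \<delta>}"
  have A: "open A" "0 \<in> A"
    using \<delta> by (auto simp: A_def intro!: open_Collect_less continuous_intros)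
  have A_convex: "convex A"
  proof -
    have "A = (\<lambda>s. s *\<^sub>R w) -` ball 0 \<delta>" by (auto simp: A_def)
    then show ?thesis
      using convex_linear_vimage[OF linear_scaleR_left convex_ball, of w 0 \<delta>] by simp
  qed
  have in_S: "q + s *\<^sub>R w \<in> S" if "q \<in> ball p \<delta>" "s \<in> A" for q s
  proof -
    have "norm (q - p + s *\<^sub>R w) < 2 * \<delta>"
      using norm_triangle_ineq[of "q - p" "s *\<^sub>R w"] that by (auto simp: A_def dist_norm norm_minus_commute)
    then show ?thesis using \<delta>(2) by (auto simp: subset_iff dist_norm norm_minus_commute algebra_simps)
  qed
  have F_shift: "F (q + s *\<^sub>R w) = F q" if "q \<in> ball p \<delta>" "s \<in> A" for q s
  proof -
    have "((\<lambda>s. F (q + s *\<^sub>R w)) has_derivative (\<lambda>r. 0)) (at s' within A)" if "s' \<in> A" for s'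
      using dird_direction[OF smooth_on_differentiable[OF assms(2) in_S[OF \<open>q \<in> ball p \<delta>\<close> that]], of A]
        assms(3)[OF in_S[OF \<open>q \<in> ball p \<delta>\<close> that]] by simp
    from has_derivative_zero_unique[OF A_convex this \<open>s \<in> A\<close> A(2)] show ?thesis by simp
  qed
  have dF_shift: "dird z F (p + s *\<^sub>R w) = dird z F p" if "s \<in> A" for s
  proof -
    have pS: "p \<in> ball p \<delta>" using \<delta> by simp
    have "((\<lambda>q. F (q + s *\<^sub>R w)) has_derivative (\<lambda>v. dird v F (p + s *\<^sub>R w))) (at p)"
      by (rule has_derivative_compose[of "\<lambda>q. q + s *\<^sub>R w" "\<lambda>v. v" _ _ F])
        (auto intro!: derivative_eq_intros smooth_on_has_derivative[OF assms(2)] in_S that pS)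
    then have "dird z F (p + s *\<^sub>R w) = dird z (\<lambda>q. F (q + s *\<^sub>R w)) p"
      by (rule dird_eq[symmetric])
    also have "\<dots> = dird z F p"
      by (rule dird_cong[OF open_ball pS]) (rule F_shift[OF _ that])
    finally show ?thesis .
  qed
  have "((\<lambda>s. dird z F (p + s *\<^sub>R w)) has_derivative (\<lambda>r. r *\<^sub>R dird w (dird z F) p)) (at 0)"
    using dird_direction[of "dird z F" p 0 w UNIV] smooth_on_differentiable[OF smooth_on_dird[OF assms(2)] assms(4)]
    by simp
  moreover have "((\<lambda>s. dird z F (p + s *\<^sub>R w)) has_derivative (\<lambda>r. 0)) (at 0)"
    by (rule has_derivative_transform_within_open[OF has_derivative_const A]) (simp add: dF_shift)
  ultimately have "(\<lambda>r. r *\<^sub>R dird w (dird z F) p) = (\<lambda>r::real. 0)"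
    by (rule has_derivative_unique)
  then show ?thesis by (metis scaleR_one)
qed

lemma constant_if_dird_zero:
  fixes F :: "point \<Rightarrow> real"
  assumes "open S" "connected S" "smooth_on S F"
    and "\<And>p. p \<in> S \<Longrightarrow> dird et F p = 0" "\<And>p. p \<in> S \<Longrightarrow> dird ex F p = 0" "\<And>p. p \<in> S \<Longrightarrow> dird eu F p = 0"
  obtains c where "\<And>p. p \<in> S \<Longrightarrow> F p = c"
proof (cases "S = {}")
  case False
  then obtain p0 where p0: "p0 \<in> S" by blast
  have der: "(F has_derivative (\<lambda>w. 0)) (at p)" if "p \<in> S" for p
  proof -
    have "dird (a, b, c) F p = 0" for a b c
      using assms(4-6)[OF that] by (subst dird_triple[OF smooth_on_differentiable[OF assms(3) that]]) simp
    then have "(\<lambda>w. dird w F p) = (\<lambda>w. 0)" by (auto simp: fun_eq_iff)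
    then show ?thesis using smooth_on_has_derivative[OF assms(3) that] by simp
  qed
  have "F p = F p0" if "p \<in> S" for p
    by (rule has_derivative_zero_unique_connected[OF assms(1,2) der that p0])
  then show ?thesis by (rule that)
qed (use that in blast)

lemma dird_compose_real:
  fixes \<phi> :: "real \<Rightarrow> real" and X :: "'a::real_normed_vector \<Rightarrow> real"
  assumes "X differentiable (at p)" "\<phi> differentiable (at (X p))"
  shows "dird w (\<lambda>p. \<phi> (X p)) p = deriv \<phi> (X p) * dird w X p"
proof (rule dird_eq)
  have "(\<phi> has_derivative (*) (deriv \<phi> (X p))) (at (X p))"
    using assms(2) by (simp add: DERIV_deriv_iff_real_differentiable flip: has_field_derivative_def)
  then show "((\<lambda>p. \<phi> (X p)) has_derivative (\<lambda>w. deriv \<phi> (X p) * dird w X p)) (at p)"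
    using has_derivative_compose[OF dird_has_derivative[OF assms(1)]] by blast
qed

lemma deriv_eq_dird:
  fixes \<phi> :: "real \<Rightarrow> real"
  assumes "\<phi> differentiable (at x)"
  shows "deriv \<phi> x = dird 1 \<phi> x"
  using dird_compose_real[of "\<lambda>x. x" x \<phi> 1] assms dird_eq[OF has_derivative_ident, of 1 x] by simp

text \<open>
  The right-hand sides are the entries of the pullback of \<open>k\<close> times the off-diagonal form, the
  left-hand sides those of the form \<open>n\<close>.
\<close>

lemma offdiagonal_form:
  fixes A B C D :: real
  assumes "A * D - C * B \<noteq> 0"
    and e1: "(n11 * A + n21 * B) * A + (n12 * A + n22 * B) * B = 2 * k * A * B"
    and e2: "(n11 * A + n21 * B) * C + (n12 * A + n22 * B) * D = k * (A * D + B * C)"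
    and e3: "(n11 * C + n21 * D) * A + (n12 * C + n22 * D) * B = k * (A * D + B * C)"
    and e4: "(n11 * C + n21 * D) * C + (n12 * C + n22 * D) * D = 2 * k * C * D"
  shows "n11 = 0" "n22 = 0"
proof -
  \<comment> \<open>The form \<open>n\<close> is evaluated on
    \<open>D * (A, B) - B * (C, D) = (A * D - B * C, 0)\<close>, a multiple of the first basis
    vector, on which the off-diagonal form vanishes. The combination used for \<open>n22\<close> is
    \<open>C * (A, B) - A * (C, D)\<close>.\<close>
  have "(A * D - C * B)\<^sup>2 * n11 = D\<^sup>2 * ((n11 * A + n21 * B) * A + (n12 * A + n22 * B) * B)
      - B * D * (((n11 * A + n21 * B) * C + (n12 * A + n22 * B) * D)
        + ((n11 * C + n21 * D) * A + (n12 * C + n22 * D) * B))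
      + B\<^sup>2 * ((n11 * C + n21 * D) * C + (n12 * C + n22 * D) * D)"
    by (simp add: algebra_simps power2_eq_square)
  also have "\<dots> = 0" unfolding e1 e2 e3 e4 by (simp add: algebra_simps power2_eq_square)
  finally have 1: "(A * D - C * B)\<^sup>2 * n11 = 0" .
  have "(A * D - C * B)\<^sup>2 * n22 = C\<^sup>2 * ((n11 * A + n21 * B) * A + (n12 * A + n22 * B) * B)
      - A * C * (((n11 * A + n21 * B) * C + (n12 * A + n22 * B) * D)
        + ((n11 * C + n21 * D) * A + (n12 * C + n22 * D) * B))
      + A\<^sup>2 * ((n11 * C + n21 * D) * C + (n12 * C + n22 * D) * D)"
    by (simp add: algebra_simps power2_eq_square)
  also have "\<dots> = 0" unfolding e1 e2 e3 e4 by (simp add: algebra_simps power2_eq_square)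
  finally have "(A * D - C * B)\<^sup>2 * n22 = 0" .
  with 1 show "n11 = 0" "n22 = 0" using assms(1) by simp_all
qed

text \<open>\<open>b\<close> is fixed first, such that the first expression does not vanish
  identically in \<open>a\<close>. Each of the three affine functions of \<open>a\<close> then has
  at most one root. This supplies first jets \<open>a = u_t\<close>, \<open>b = u_x\<close> at which
  the total Jacobian and two given total derivatives are all nonzero.\<close>

lemma affine_functions_nonzero:
  fixes j0 j1 j2 c d c' d' :: real
  assumes "j0 \<noteq> 0 \<or> j1 \<noteq> 0 \<or> j2 \<noteq> 0" "c \<noteq> 0 \<or> d \<noteq> 0" "c' \<noteq> 0 \<or> d' \<noteq> 0"
  obtains a b where "j0 + a * j1 + b * j2 \<noteq> 0" "c + a * d \<noteq> 0" "c' + a * d' \<noteq> 0"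
proof -
  have fin: "finite {a. c + a * d = 0}" if "c \<noteq> 0 \<or> d \<noteq> 0" for c d :: real
  proof (cases "d = 0")
    case False
    then have "{a. c + a * d = 0} \<subseteq> {- c / d}" by (auto simp: field_simps)
    then show ?thesis by (rule finite_subset) simp
  qed (use that in auto)
  obtain b where b: "j0 + b * j2 \<noteq> 0 \<or> j1 \<noteq> 0"
    using assms(1) that[of 0] that[of 1] by fastforce
  have "finite ({a. (j0 + b * j2) + a * j1 = 0} \<union> {a. c + a * d = 0} \<union> {a. c' + a * d' = 0})"
    using fin[OF b] fin[OF assms(2)] fin[OF assms(3)] by blast
  then have "\<exists>a. a \<notin> {a. (j0 + b * j2) + a * j1 = 0} \<union> {a. c + a * d = 0} \<union> {a. c' + a * d' = 0}"
    by (rule ex_new_if_finite[OF infinite_UNIV_char_0])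
  then show thesis using that[of _ b] by (auto simp: algebra_simps)
qed

lemma quadratic_coefficients:
  fixes A0 A1 A2 A3 :: real
  assumes "\<And>b m. A0 + A1 * b + A2 * b\<^sup>2 + A3 * m = 0"
  shows "A1 = 0" "A2 = 0" "A3 = 0"
  using assms[of 0 0] assms[of 1 0] assms[of "- 1" 0] assms[of 0 1] by simp_all

lemma total2_e11: "total2 e1 e1 c d k F p = dird et (dird et F) p + c * dird eu (dird et F) p
    + k * dird eu F p + d * (dird et (dird eu F) p + c * dird eu (dird eu F) p)"
  and total2_e22: "total2 e2 e2 c d k F p = dird ex (dird ex F) p + c * dird eu (dird ex F) p
    + k * dird eu F p + d * (dird ex (dird eu F) p + c * dird eu (dird eu F) p)"
  by (simp_all add: total2_def)

subsection \<open>Determining equations of the equivalence group\<close>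

lemma total2_add: "total2 z w c d (k + l) F p = total2 z w c d k F p + l * dird eu F p"
  by (simp add: total2_def algebra_simps)

lemma x_range_I: "(t, x, u) \<in> \<Omega> \<Longrightarrow> x \<in> x_range \<Omega>"
  by (force simp: x_range_def)

lemma u_range_I: "(t, x, u) \<in> \<Omega> \<Longrightarrow> u \<in> u_range \<Omega>"
  by (force simp: u_range_def)

lemma admissible_elementsD:
  assumes "(f, h, H, K) \<in> admissible_elements \<Omega>"
  shows "smooth_on (x_range \<Omega>) f" "smooth_on (x_range \<Omega>) h"
    "smooth_on (u_range \<Omega>) H" "smooth_on (u_range \<Omega>) K"
    "x \<in> x_range \<Omega> \<Longrightarrow> f x \<noteq> 0" "x \<in> x_range \<Omega> \<Longrightarrow> h x \<noteq> 0" "u \<in> u_range \<Omega> \<Longrightarrow> H u \<noteq> 0"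
proof -
  \<comment> \<open>The clause on \<open>(H_u, K_u)\<close> provides a point of the domain, so both
    ranges are nonempty and the condition on the product can be split into its factors.\<close>
  have ne: "x_range \<Omega> \<noteq> {}" "u_range \<Omega> \<noteq> {}"
    using assms by (auto simp: admissible_elements_def x_range_def u_range_def)
  show "smooth_on (x_range \<Omega>) f" "smooth_on (x_range \<Omega>) h"
    "smooth_on (u_range \<Omega>) H" "smooth_on (u_range \<Omega>) K"
    using assms by (simp_all add: admissible_elements_def)
  have *: "f x * h x * H u \<noteq> 0" if "x \<in> x_range \<Omega>" "u \<in> u_range \<Omega>" for x u
    using assms that by (simp add: admissible_elements_def)
  show "f x \<noteq> 0" "h x \<noteq> 0" if "x \<in> x_range \<Omega>"
    using *[OF that] ne(2) by fastforce+
  show "H u \<noteq> 0" if "u \<in> u_range \<Omega>"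
    using *[OF _ that] ne(1) by fastforce
qed

text \<open>\<open>K = u\<close> has derivative 1, which settles the condition on
  \<open>(H_u, K_u)\<close> for every \<open>H\<close>. The constant \<open>c\<close> rescales
  \<open>f\<close> while \<open>h\<close> and \<open>H\<close> stay fixed.\<close>

lemma test_elements_admissible:
  assumes "\<Omega> \<noteq> {}" "c \<noteq> 0" "smooth_on UNIV H" "\<And>u. H u \<noteq> 0"
  shows "(\<lambda>_. c, \<lambda>_. 1, H, \<lambda>u. u) \<in> admissible_elements \<Omega>"
proof -
  have "u_range \<Omega> \<noteq> {}" using assms(1) by (simp add: u_range_def)
  then show ?thesis
    using assms smooth_on_subset[OF assms(3)] by (auto simp: admissible_elements_def)
qed

text \<open>\<open>nondegenerate\<close> is bijectivity of the derivative of the point map, phrased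
  as linear independence of the differentials of \<open>T\<close>, \<open>X\<close> and
  \<open>U\<close> at each point.\<close>

locale equivalence_transformation =
  fixes \<Omega> :: "point set" and T X U :: "point \<Rightarrow> real"
    and \<Psi> :: "arbitrary_elements \<Rightarrow> arbitrary_elements"
  assumes open_domain: "open \<Omega>" and nonempty: "\<Omega> \<noteq> {}"
    and smooth: "smooth_on \<Omega> T" "smooth_on \<Omega> X" "smooth_on \<Omega> U"
    and nondegenerate: "\<And>p c1 c2 c3. p \<in> \<Omega> \<Longrightarrow>
      (\<And>w. c1 * dird w T p + c2 * dird w X p + c3 * dird w U p = 0) \<Longrightarrow> c1 = 0 \<and> c2 = 0 \<and> c3 = 0"
    and admissible: "\<And>\<theta>. \<theta> \<in> admissible_elements \<Omega> \<Longrightarrow>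
      \<Psi> \<theta> \<in> admissible_elements ((\<lambda>p. (T p, X p, U p)) ` \<Omega>)"
    and maps: "\<And>\<theta>. \<theta> \<in> admissible_elements \<Omega> \<Longrightarrow>
      maps_equation \<Omega> (\<lambda>p. (T p, X p, U p)) \<theta> (\<Psi> \<theta>)"
begin

abbreviation "image_domain \<equiv> (\<lambda>p. (T p, X p, U p)) ` \<Omega>"

lemma differentiable:
  "p \<in> \<Omega> \<Longrightarrow> T differentiable (at p)" "p \<in> \<Omega> \<Longrightarrow> X differentiable (at p)"
  "p \<in> \<Omega> \<Longrightarrow> U differentiable (at p)" "p \<in> \<Omega> \<Longrightarrow> dird w T differentiable (at p)"
  "p \<in> \<Omega> \<Longrightarrow> dird w X differentiable (at p)" "p \<in> \<Omega> \<Longrightarrow> dird w U differentiable (at p)"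
  using smooth smooth_on_dird smooth_on_differentiable by blast+

lemma nondegenerate_basis:
  assumes "p \<in> \<Omega>"
    and "c1 * dird et T p + c2 * dird et X p + c3 * dird et U p = 0"
    and "c1 * dird ex T p + c2 * dird ex X p + c3 * dird ex U p = 0"
    and "c1 * dird eu T p + c2 * dird eu X p + c3 * dird eu U p = 0"
  shows "c1 = 0" "c2 = 0" "c3 = 0"
proof -
  have "c1 * dird w T p + c2 * dird w X p + c3 * dird w U p = 0" for w
  proof -
    obtain a b c where w: "w = (a, b, c)" by (cases w)
    have "c1 * dird w T p + c2 * dird w X p + c3 * dird w U p =
      a * (c1 * dird et T p + c2 * dird et X p + c3 * dird et U p)
      + b * (c1 * dird ex T p + c2 * dird ex X p + c3 * dird ex U p)
      + c * (c1 * dird eu T p + c2 * dird eu X p + c3 * dird eu U p)"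
      unfolding w dird_triple[OF differentiable(1)[OF assms(1)], of a b c]
        dird_triple[OF differentiable(2)[OF assms(1)], of a b c]
        dird_triple[OF differentiable(3)[OF assms(1)], of a b c]
      by (simp only: real_scaleR_def) algebra
    then show ?thesis unfolding assms(2-4) by simp
  qed
  from nondegenerate[OF assms(1) this] show "c1 = 0" "c2 = 0" "c3 = 0" by simp_all
qed

lemma image_range:
  assumes "p \<in> \<Omega>"
  shows "X p \<in> x_range image_domain" "U p \<in> u_range image_domain"
  using assms by (force simp: x_range_def u_range_def)+

lemma elements:
  assumes \<theta>: "(f, h, H, K) \<in> admissible_elements \<Omega>" "\<Psi> (f, h, H, K) = (f', h', H', K')"
    and p: "(t, x, u) \<in> \<Omega>"
  shows "h differentiable (at x)" "H differentiable (at u)"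
    "h' differentiable (at (X (t, x, u)))" "H' differentiable (at (U (t, x, u)))"
    "f x \<noteq> 0" "h x \<noteq> 0" "H u \<noteq> 0"
    "f' (X (t, x, u)) \<noteq> 0" "h' (X (t, x, u)) \<noteq> 0" "H' (U (t, x, u)) \<noteq> 0"
proof -
  have "(f', h', H', K') \<in> admissible_elements image_domain"
    using admissible[OF \<theta>(1)] by (simp add: \<theta>(2))
  from admissible_elementsD[OF \<theta>(1)] admissible_elementsD[OF this] x_range_I[OF p] u_range_I[OF p]
    image_range[OF p] smooth_on_differentiable
  show "h differentiable (at x)" "H differentiable (at u)"
    "h' differentiable (at (X (t, x, u)))" "H' differentiable (at (U (t, x, u)))"
    "f x \<noteq> 0" "h x \<noteq> 0" "H u \<noteq> 0"
    "f' (X (t, x, u)) \<noteq> 0" "h' (X (t, x, u)) \<noteq> 0" "H' (U (t, x, u)) \<noteq> 0"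
    by blast+
qed

lemma jet_transformation_elements:
  fixes t x u :: real
  assumes \<theta>: "(f, h, H, K) \<in> admissible_elements \<Omega>" "\<Psi> (f, h, H, K) = (f', h', H', K')"
  defines "p \<equiv> (t, x, u)"
  assumes p: "p \<in> \<Omega>"
    and J: "total1 e1 a T p * total1 e2 b X p - total1 e2 b T p * total1 e1 a X p \<noteq> 0"
  obtains P1 P2 N11 N12 N21 N22 where "jet_relation T X U p a b r s m P1 P2 N11 N12 N21 N22"
    "jet_equation (f, h, H, K) x u b r m \<longleftrightarrow> jet_equation (f', h', H', K') (X p) (U p) P2 N11 N22"
proof -
  have "maps_equation \<Omega> (\<lambda>p. (T p, X p, U p)) (f, h, H, K) (f', h', H', K')"
    using maps[OF \<theta>(1)] by (simp add: \<theta>(2))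
  note jt = jet_transformation[OF open_domain smooth _ this p[unfolded p_def]
      elements(1-4)[OF \<theta> p[unfolded p_def]] J[unfolded p_def], folded p_def]
  show thesis by (rule jt[of r s m thesis]) (simp, rule that)
qed

text \<open>Two source jets are compared whose second derivatives differ by the pullback of the
  symmetric form \<open>dT dX\<close> under the total differential. Their images agree except in the
  mixed second derivatives, which the new equation does not contain. Hence both source jets satisfy
  the old equation or neither does, and subtracting the two instances leaves the claim.\<close>

lemma cross_term:
  fixes t x u :: real
  assumes \<theta>: "(f, h, H, K) \<in> admissible_elements \<Omega>"
  defines "p \<equiv> (t, x, u)"
  assumes p: "p \<in> \<Omega>"
    and J: "total1 e1 a T p * total1 e2 b X p - total1 e2 b T p * total1 e1 a X p \<noteq> 0"
  shows "f x * (total1 e1 a T p * total1 e1 a X p) = h x * H u * (total1 e2 b T p * total1 e2 b X p)"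
proof -
  obtain f' h' H' K' where \<theta>': "\<Psi> (f, h, H, K) = (f', h', H', K')" by (metis prod_cases4)
  have f: "f x \<noteq> 0" using elements(5)[OF \<theta> \<theta>' p[unfolded p_def]] .
  define A where "A = total1 e1 a T p"
  define B where "B = total1 e1 a X p"
  define C where "C = total1 e2 b T p"
  define D where "D = total1 e2 b X p"
  note ABCD = A_def[symmetric] B_def[symmetric] C_def[symmetric] D_def[symmetric]
  have J': "A * D - C * B \<noteq> 0" using J unfolding ABCD .
  \<comment> \<open>The value of \<open>u_tt\<close> that makes the first jet, with
    \<open>u_xx = 0\<close>, satisfy the equation.\<close>
  define r where "r = (deriv h x * H u * b + h x * deriv H u * b\<^sup>2 + h x * K u * b) / f x"
  have jet: "jet_equation (f, h, H, K) x u b r 0"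
    using f by (simp add: jet_equation_def r_def)
  obtain P1 P2 N11 N12 N21 N22 where
    R: "jet_relation T X U p a b r 0 0 P1 P2 N11 N12 N21 N22" and
    E: "jet_equation (f, h, H, K) x u b r 0 \<longleftrightarrow> jet_equation (f', h', H', K') (X p) (U p) P2 N11 N22"
    unfolding p_def by (rule jet_transformation_elements[OF \<theta> \<theta>' p[unfolded p_def] J[unfolded p_def]])
  \<comment> \<open>The increments \<open>2 * A * B\<close>, \<open>A * D + B * C\<close>,
    \<open>2 * C * D\<close> are the entries of the pulled-back form; the first derivatives are
    unchanged, so \<open>P1\<close> and \<open>P2\<close> are unchanged by Cramer's rule.\<close>
  obtain P1' P2' N11' N12' N21' N22' where
    R': "jet_relation T X U p a b (r + 2 * A * B) (0 + (A * D + B * C)) (0 + 2 * C * D) P1' P2' N11' N12' N21' N22'" and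
    E': "jet_equation (f, h, H, K) x u b (r + 2 * A * B) (0 + 2 * C * D) \<longleftrightarrow>
      jet_equation (f', h', H', K') (X p) (U p) P2' N11' N22'"
    unfolding p_def by (rule jet_transformation_elements[OF \<theta> \<theta>' p[unfolded p_def] J[unfolded p_def]])
  note R = R[unfolded jet_relation_def, unfolded ABCD]
  note R' = R'[unfolded jet_relation_def total2_add, unfolded ABCD]
  have P: "P1' = P1" "P2' = P2"
  proof -
    have "A * (P1' - P1) + B * (P2' - P2) = 0" "C * (P1' - P1) + D * (P2' - P2) = 0"
      using R R' by (simp_all add: algebra_simps)
    moreover have "(A * D - C * B) * (P1' - P1) =
        D * (A * (P1' - P1) + B * (P2' - P2)) - B * (C * (P1' - P1) + D * (P2' - P2))"
      "(A * D - C * B) * (P2' - P2) =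
        A * (C * (P1' - P1) + D * (P2' - P2)) - C * (A * (P1' - P1) + B * (P2' - P2))"
      by (simp_all add: algebra_simps)
    ultimately have "(A * D - C * B) * (P1' - P1) = 0" "(A * D - C * B) * (P2' - P2) = 0" by simp_all
    with J' show "P1' = P1" "P2' = P2" by simp_all
  qed
  \<comment> \<open>The second derivatives of the source enter the second-order relations linearly,
    through \<open>U_u - P1 * T_u - P2 * X_u\<close>; an increment of them is therefore multiplied
    by \<open>k\<close>.\<close>
  define k where "k = dird eu U p - P1 * dird eu T p - P2 * dird eu X p"
  let ?n11 = "N11' - N11" and ?n12 = "N12' - N12" and ?n21 = "N21' - N21" and ?n22 = "N22' - N22"
  have "(?n11 * A + ?n21 * B) * A + (?n12 * A + ?n22 * B) * B = 2 * k * A * B"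
    "(?n11 * A + ?n21 * B) * C + (?n12 * A + ?n22 * B) * D = k * (A * D + B * C)"
    "(?n11 * C + ?n21 * D) * A + (?n12 * C + ?n22 * D) * B = k * (A * D + B * C)"
    "(?n11 * C + ?n21 * D) * C + (?n12 * C + ?n22 * D) * D = 2 * k * C * D"
    using R R' unfolding P k_def by (simp_all add: algebra_simps)
  from offdiagonal_form[OF J' this] have "N11' = N11" "N22' = N22" by simp_all
  with E E' P have "jet_equation (f, h, H, K) x u b (r + 2 * A * B) (0 + 2 * C * D)"
    using jet by simp
  with jet show ?thesis
    unfolding ABCD by (simp add: jet_equation_def algebra_simps)
qed

text \<open>For \<open>f = 1\<close> and \<open>f = 2\<close> with the same \<open>h\<close> and
  \<open>H\<close>, \<open>cross_term\<close> forces both of its sides to vanish at every first jet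
  with nonzero total Jacobian. Each side is a product of two affine functions of one jet variable;
  if neither factor vanished identically, a generic jet would give a contradiction.\<close>

lemma product_structure:
  assumes p: "p \<in> \<Omega>"
  shows "dird ex T p = 0 \<and> dird eu T p = 0 \<and> dird et X p = 0 \<and> dird eu X p = 0 \<or>
    dird et T p = 0 \<and> dird eu T p = 0 \<and> dird ex X p = 0 \<and> dird eu X p = 0"
proof -
  obtain t x u where txu: "p = (t, x, u)" by (cases p)
  define j0 where "j0 = dird et T p * dird ex X p - dird ex T p * dird et X p"
  define j1 where "j1 = dird eu T p * dird ex X p - dird ex T p * dird eu X p"
  define j2 where "j2 = dird et T p * dird eu X p - dird eu T p * dird et X p"
  have J: "total1 e1 a T p * total1 e2 b X p - total1 e2 b T p * total1 e1 a X p = j0 + a * j1 + b * j2" for a b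
    by (simp add: j0_def j1_def j2_def algebra_simps)
  have zero: "(dird et T p + a * dird eu T p) * (dird et X p + a * dird eu X p) = 0 \<and>
      (dird ex T p + b * dird eu T p) * (dird ex X p + b * dird eu X p) = 0"
    if "j0 + a * j1 + b * j2 \<noteq> 0" for a b
  proof -
    have "(\<lambda>_. 1, \<lambda>_. 1, \<lambda>_. 1, \<lambda>u. u) \<in> admissible_elements \<Omega>"
      "(\<lambda>_. 2, \<lambda>_. 1, \<lambda>_. 1, \<lambda>u. u) \<in> admissible_elements \<Omega>"
      by (rule test_elements_admissible[OF nonempty]; simp)+
    from this[THEN cross_term, of t x u a b]
    have "1 * (total1 e1 a T p * total1 e1 a X p) = 1 * 1 * (total1 e2 b T p * total1 e2 b X p)"
      "2 * (total1 e1 a T p * total1 e1 a X p) = 1 * 1 * (total1 e2 b T p * total1 e2 b X p)"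
      using that p unfolding txu[symmetric] J by blast+
    then have "total1 e1 a T p * total1 e1 a X p = 0" "total1 e2 b T p * total1 e2 b X p = 0"
      by linarith+
    then show ?thesis by simp
  qed
  have T: "\<not> (dird et T p = 0 \<and> dird ex T p = 0 \<and> dird eu T p = 0)"
    using nondegenerate_basis(1)[OF p, of 1 0 0] by auto
  have X: "\<not> (dird et X p = 0 \<and> dird ex X p = 0 \<and> dird eu X p = 0)"
    using nondegenerate_basis(2)[OF p, of 0 1 0] by auto
  \<comment> \<open>\<open>j0\<close>, \<open>j1\<close>, \<open>j2\<close> are the 2x2 minors of
    the differentials of \<open>T\<close> and \<open>X\<close>. If all vanish,
    \<open>X_w dT - T_w dX = 0\<close> for each coordinate \<open>w\<close>, and nondegeneracy gives
    \<open>dX = 0\<close>.\<close>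
  have j: "j0 \<noteq> 0 \<or> j1 \<noteq> 0 \<or> j2 \<noteq> 0"
  proof (rule ccontr)
    assume "\<not> ?thesis"
    then have "dird et X p = 0" "dird ex X p = 0" "dird eu X p = 0"
      using nondegenerate_basis(1)[OF p, of "dird et X p" "- dird et T p" 0]
        nondegenerate_basis(1)[OF p, of "dird ex X p" "- dird ex T p" 0]
        nondegenerate_basis(1)[OF p, of "dird eu X p" "- dird eu T p" 0]
      by (simp_all add: j0_def j1_def j2_def algebra_simps)
    with X show False by simp
  qed
  have 1: "dird et T p = 0 \<and> dird eu T p = 0 \<or> dird et X p = 0 \<and> dird eu X p = 0"
  proof (rule ccontr)
    assume "\<not> ?thesis"
    then have "dird et T p \<noteq> 0 \<or> dird eu T p \<noteq> 0" "dird et X p \<noteq> 0 \<or> dird eu X p \<noteq> 0" by auto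
    from affine_functions_nonzero[OF j this] zero show False by (metis mult_eq_0_iff)
  qed
  have 2: "dird ex T p = 0 \<and> dird eu T p = 0 \<or> dird ex X p = 0 \<and> dird eu X p = 0"
  proof (rule ccontr)
    assume "\<not> ?thesis"
    then have n: "dird ex T p \<noteq> 0 \<or> dird eu T p \<noteq> 0" "dird ex X p \<noteq> 0 \<or> dird eu X p \<noteq> 0" by auto
    have "j0 \<noteq> 0 \<or> j2 \<noteq> 0 \<or> j1 \<noteq> 0" using j by auto
    from affine_functions_nonzero[OF this n] obtain a b where
      "j0 + a * j2 + b * j1 \<noteq> 0" "dird ex T p + a * dird eu T p \<noteq> 0" "dird ex X p + a * dird eu X p \<noteq> 0" .
    then show False using zero[of b a] by (simp add: add.assoc add.commute[of "a * j2"])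
  qed
  from 1 2 T X show ?thesis by auto
qed

text \<open>
  The coefficients of \<open>u\<^sub>x\<^sup>2\<close> and \<open>u\<^sub>x\<^sub>x\<close> in the transformed equation, under the assumption that
  \<open>t\<close> and \<open>x\<close> are interchanged.
\<close>

lemma swap_coefficients:
  fixes t x u :: real
  assumes \<theta>: "(\<lambda>_. 1, \<lambda>_. 1, H, \<lambda>u. u) \<in> admissible_elements \<Omega>" and p: "(t, x, u) \<in> \<Omega>"
  defines "p \<equiv> (t, x, u)"
  assumes z: "dird et T p = 0" "dird eu T p = 0" "dird ex X p = 0" "dird eu X p = 0"
  shows "dird eu (dird eu U) p * H u = dird eu U p * deriv H u" "dird eu U p \<noteq> 0"
proof -
  note p = p[folded p_def]
  have Tx: "dird ex T p \<noteq> 0" and Xt: "dird et X p \<noteq> 0"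
    using nondegenerate_basis(1)[OF p, of 1 0 0] nondegenerate_basis(2)[OF p, of 0 1 0] z by auto
  show Uu: "dird eu U p \<noteq> 0"
    using nondegenerate_basis(3)[OF p, of "- dird ex U p / dird ex T p" "- dird et U p / dird et X p" 1] z Tx Xt
    by auto
  \<comment> \<open>\<open>T_x\<close> being nonzero excludes the first alternative of
    \<open>product_structure\<close>. The swapped case thus persists on this open set, and its
    vanishing derivatives may be differentiated once more.\<close>
  define S where "S = {q \<in> \<Omega>. dird ex T q \<noteq> 0}"
  have "S = \<Omega> \<inter> dird ex T -` (- {0})" by (auto simp: S_def)
  then have S: "open S"
    using continuous_open_preimage[OF smooth_on_continuous[OF smooth_on_dird[OF smooth(1)]] open_domain, of "- {0}"]
    by auto
  have pS: "p \<in> S" using p Tx by (simp add: S_def)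
  have zS: "dird et T q = 0" "dird eu T q = 0" "dird ex X q = 0" "dird eu X q = 0" if "q \<in> S" for q
    using product_structure[of q] that by (auto simp: S_def)
  have sS: "smooth_on S T" "smooth_on S X"
    using smooth smooth_on_subset[of \<Omega> _ S] by (auto simp: S_def)
  have z2: "dird w (dird et T) p = 0" "dird w (dird eu T) p = 0" "dird w (dird ex X) p = 0" "dird w (dird eu X) p = 0" for w
    by (rule dird_zero_on[OF S pS]; rule zS; assumption)+
  have z3: "dird eu (dird w T) p = 0" "dird eu (dird w X) p = 0" for w
    by (rule dird_commute_zero[OF S sS(1) _ pS] dird_commute_zero[OF S sS(2) _ pS]; rule zS; assumption)+
  obtain f' h' H' K' where \<theta>': "\<Psi> (\<lambda>_. 1, \<lambda>_. 1, H, \<lambda>u. u) = (f', h', H', K')" by (metis prod_cases4)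
  note el = elements[OF \<theta> \<theta>' p[unfolded p_def], folded p_def]
  define i where "i = 1 / (dird ex T p)\<^sup>2"
  define j where "j = 1 / (dird et X p)\<^sup>2"
  define P2 where "P2 = dird et U p / dird et X p"
  define Q where "Q = dird ex (dird ex T) p / dird ex T p"
  \<comment> \<open>In the swapped case the new \<open>x\<close>-derivative \<open>P2\<close> stems
    from \<open>u_t\<close>, which is set to 0 below. The first-order terms of the new equation,
    collected in \<open>c\<close>, are therefore constant in \<open>b\<close> and
    \<open>m\<close>.\<close>
  define c where "c = deriv h' (X p) * H' (U p) * P2 + h' (X p) * deriv H' (U p) * P2\<^sup>2 + h' (X p) * K' (U p) * P2"
  let ?Uu = "dird eu U p" and ?Uuu = "dird eu (dird eu U) p"
  let ?F = "f' (X p) * i" and ?G = "h' (X p) * H' (U p) * j"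
  have id: "(?F * (dird ex (dird ex U) p - dird ex U p * Q)
        - ?G * (dird et (dird et U) p - P2 * dird et (dird et X) p) - c)
      + (?F * (dird eu (dird ex U) p + dird ex (dird eu U) p - ?Uu * Q) - ?G * (u * ?Uu)) * b
      + (?F * ?Uuu - ?G * (deriv H u * ?Uu)) * b\<^sup>2
      + (?F * ?Uu - ?G * (H u * ?Uu)) * m = 0" for b m
  proof -
    define r where "r = H u * m + deriv H u * b\<^sup>2 + u * b"
    have jet: "jet_equation (\<lambda>_. 1, \<lambda>_. 1, H, \<lambda>u. u) x u b r m"
      by (simp add: jet_equation_def r_def)
    have J: "total1 e1 0 T p * total1 e2 b X p - total1 e2 b T p * total1 e1 0 X p \<noteq> 0"
      using z Tx Xt by simp
    obtain P1 P2' N11 N12 N21 N22 where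
      R: "jet_relation T X U p 0 b r 0 m P1 P2' N11 N12 N21 N22" and
      E: "jet_equation (\<lambda>_. 1, \<lambda>_. 1, H, \<lambda>u. u) x u b r m \<longleftrightarrow>
        jet_equation (f', h', H', K') (X p) (U p) P2' N11 N22"
      unfolding p_def by (rule jet_transformation_elements[OF \<theta> \<theta>' p[unfolded p_def] J[unfolded p_def]])
    note R = R[unfolded jet_relation_def total2_e11 total2_e22 total1_simps z z2 z3]
    have P2: "P2' = P2" using R Xt by (simp add: P2_def)
    have P1: "P1 = (dird ex U p + b * ?Uu) / dird ex T p"
      using R Tx by simp
    have N22: "N22 = (dird et (dird et U) p + r * ?Uu - P2 * dird et (dird et X) p) * j"
      using R Xt unfolding P2 by (simp add: j_def power2_eq_square)
    have N11: "N11 = (dird ex (dird ex U) p + b * (dird eu (dird ex U) p + dird ex (dird eu U) p)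
        + b\<^sup>2 * ?Uuu + m * ?Uu - (dird ex U p + b * ?Uu) * Q) * i"
      using R Tx unfolding P1 by (simp add: i_def Q_def field_simps power2_eq_square)
    have "f' (X p) * N11 = h' (X p) * H' (U p) * N22 + c"
      using E jet unfolding P2 by (simp add: jet_equation_def c_def)
    then show ?thesis
      unfolding N11 N22 r_def by (simp add: algebra_simps)
  qed
  note co = quadratic_coefficients[OF id]
  have ij: "i \<noteq> 0" "j \<noteq> 0" using Tx Xt by (simp_all add: i_def j_def)
  have FG: "?F = ?G * H u" using co(3) Uu by (simp add: algebra_simps)
  have "?G * H u * ?Uuu = ?G * (deriv H u * ?Uu)" using co(2) unfolding FG by simp
  then show "?Uuu * H u = ?Uu * deriv H u"
    using el ij by (simp add: algebra_simps)
qed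

lemma deriv_exp_real: "deriv exp (u::real) = exp u"
  by (rule DERIV_imp_deriv) (rule DERIV_exp)

lemma smooth_exp: "smooth_on UNIV (exp :: real \<Rightarrow> real)"
  using smooth_on_exp[of UNIV "\<lambda>x. x"] by simp

lemma direct_structure:
  assumes p: "p \<in> \<Omega>"
  shows "dird ex T p = 0" "dird eu T p = 0" "dird et X p = 0" "dird eu X p = 0"
    "dird et T p \<noteq> 0" "dird ex X p \<noteq> 0" "dird eu U p \<noteq> 0"
proof -
  obtain t x u where txu: "p = (t, x, u)" by (cases p)
  have "\<not> (dird et T p = 0 \<and> dird eu T p = 0 \<and> dird ex X p = 0 \<and> dird eu X p = 0)"
  proof
    assume a: "dird et T p = 0 \<and> dird eu T p = 0 \<and> dird ex X p = 0 \<and> dird eu X p = 0"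
    have "(\<lambda>_. 1, \<lambda>_. 1, \<lambda>_. 1, \<lambda>u. u) \<in> admissible_elements \<Omega>"
      "(\<lambda>_. 1, \<lambda>_. 1, exp, \<lambda>u. u) \<in> admissible_elements \<Omega>"
      by (rule test_elements_admissible[OF nonempty]; simp add: smooth_exp)+
    then have "dird eu (dird eu U) p * 1 = dird eu U p * deriv (\<lambda>_. 1) u"
      "dird eu (dird eu U) p * exp u = dird eu U p * deriv exp u" "dird eu U p \<noteq> 0"
      using swap_coefficients[of _ t x u] a p unfolding txu by blast+
    then show False by (simp add: deriv_exp_real)
  qed
  with product_structure[OF p] show z: "dird ex T p = 0" "dird eu T p = 0" "dird et X p = 0" "dird eu X p = 0"
    by auto
  show Tt: "dird et T p \<noteq> 0" using nondegenerate_basis(1)[OF p, of 1 0 0] z by auto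
  show Xx: "dird ex X p \<noteq> 0" using nondegenerate_basis(2)[OF p, of 0 1 0] z by auto
  show "dird eu U p \<noteq> 0"
    using nondegenerate_basis(3)[OF p, of "- dird et U p / dird et T p" "- dird ex U p / dird ex X p" 1] z Tt Xx
    by auto
qed

end

section \<open>Affine functions and exponential test elements\<close>

lemma affine_if_dird_constant:
  fixes F :: "point \<Rightarrow> real"
  assumes "open S" "connected S" "smooth_on S F"
    and "\<And>p. p \<in> S \<Longrightarrow> dird et F p = a" "\<And>p. p \<in> S \<Longrightarrow> dird ex F p = b" "\<And>p. p \<in> S \<Longrightarrow> dird eu F p = c"
  obtains d where "\<And>t x u. (t, x, u) \<in> S \<Longrightarrow> F (t, x, u) = a * t + b * x + c * u + d"
proof -
  define L where "L p = a * fst p + b * fst (snd p) + c * snd (snd p)" for p :: point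
  have L: "smooth_on S L"
    unfolding L_def by (intro smooth_on_intros assms(1))
  have dL: "dird w L p = a * fst w + b * fst (snd w) + c * snd (snd w)" for w p
    unfolding L_def by (rule dird_eq) (auto intro!: derivative_eq_intros)
  have d: "dird w (\<lambda>p. F p - L p) p = dird w F p - dird w L p" if "p \<in> S" for w p
    by (rule dird_eq) (intro has_derivative_diff smooth_on_has_derivative[OF assms(3) that] smooth_on_has_derivative[OF L that])
  obtain d where "\<And>p. p \<in> S \<Longrightarrow> F p - L p = d"
    by (rule constant_if_dird_zero[OF assms(1,2) smooth_on_diff[OF assms(1,3) L]])
      (simp_all add: d dL assms(4-6))
  then have "F (t, x, u) = a * t + b * x + c * u + d" if "(t, x, u) \<in> S" for t x u
    using that by (force simp: L_def algebra_simps)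
  then show thesis by (rule that)
qed

text \<open>Nowhere zero, with logarithmic derivative \<open>c + d * u\<close>;
  \<open>gauss_constraints\<close> depends on \<open>H\<close> only through this quotient.\<close>

definition gauss_element :: "real \<Rightarrow> real \<Rightarrow> real \<Rightarrow> real" where
  "gauss_element c d u = exp (c * u + d / 2 * u\<^sup>2)"

lemma smooth_gauss_element: "smooth_on UNIV (gauss_element c d)"
proof -
  have "smooth_on UNIV (\<lambda>u::real. exp (c * u + d / 2 * (u * u)))"
    by (intro smooth_on_intros open_UNIV)
  then show ?thesis by (simp add: gauss_element_def[abs_def] power2_eq_square)
qed

lemma deriv_gauss_element: "deriv (gauss_element c d) u = (c + d * u) * gauss_element c d u"
  unfolding gauss_element_def[abs_def]
  by (rule DERIV_imp_deriv) (auto intro!: derivative_eq_intros simp: algebra_simps)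

context equivalence_transformation
begin

section \<open>Consequences of the equation when \<open>T = T(t)\<close> and
  \<open>X = X(x)\<close>\<close>

lemma direct_second_derivatives:
  assumes p: "p \<in> \<Omega>"
  shows "dird w (dird ex T) p = 0" "dird w (dird eu T) p = 0"
    "dird w (dird et X) p = 0" "dird w (dird eu X) p = 0"
    "dird ex (dird w T) p = 0" "dird eu (dird w T) p = 0"
    "dird et (dird w X) p = 0" "dird eu (dird w X) p = 0"
  by (rule dird_zero_on[OF open_domain p]; rule direct_structure; assumption)+
    (rule dird_commute_zero[OF open_domain smooth(1) _ p] dird_commute_zero[OF open_domain smooth(2) _ p];
      rule direct_structure; assumption)+

text \<open>
  The coefficients of \<open>u\<^sub>t\<^sup>2\<close>, \<open>u\<^sub>x\<^sub>x\<close>, \<open>u\<^sub>x\<^sup>2\<close> and \<open>u\<^sub>x\<close> in the transformed equation.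
\<close>

lemma direct_coefficients:
  fixes t x u :: real
  assumes \<theta>: "(f, h, H, K) \<in> admissible_elements \<Omega>" "\<Psi> (f, h, H, K) = (f', h', H', K')"
  defines "p \<equiv> (t, x, u)"
  assumes p: "p \<in> \<Omega>"
  defines "R \<equiv> f' (X p) / (f x * (dird et T p)\<^sup>2)"
  shows "dird eu (dird eu U) p = 0"
    and "R * h x * H u * (dird ex X p)\<^sup>2 = h' (X p) * H' (U p)"
    and "R * h x * deriv H u * (dird ex X p)\<^sup>2 = h' (X p) * deriv H' (U p) * dird eu U p"
    and "R * dird eu U p * (deriv h x * H u + h x * K u) =
      h' (X p) * H' (U p) * (dird eu (dird ex U) p + dird ex (dird eu U) p
        - dird eu U p * dird ex (dird ex X) p / dird ex X p) / (dird ex X p)\<^sup>2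
      + (deriv h' (X p) * H' (U p) + h' (X p) * K' (U p)) * dird eu U p / dird ex X p
      + 2 * h' (X p) * deriv H' (U p) * dird ex U p * dird eu U p / (dird ex X p)\<^sup>2"
proof -
  note z = direct_structure[OF p] direct_second_derivatives[OF p]
  note el = elements[OF \<theta> p[unfolded p_def], folded p_def]
  define i where "i = 1 / dird ex X p"
  define j where "j = 1 / (dird et T p)\<^sup>2"
  define Q where "Q = dird et (dird et T) p / dird et T p"
  define g where "g = 1 / f x"
  let ?Uu = "dird eu U p" and ?Uuu = "dird eu (dird eu U) p"
  let ?B = "dird eu (dird et U) p + dird et (dird eu U) p"
  let ?S = "dird eu (dird ex U) p + dird ex (dird eu U) p"
  let ?F = "f' (X p) * j" and ?G = "h' (X p) * H' (U p) * i\<^sup>2"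
  let ?c = "deriv h' (X p) * H' (U p) + h' (X p) * K' (U p)"
  \<comment> \<open>The old equation is solved for \<open>u_tt\<close>, so \<open>a\<close>,
    \<open>b\<close>, \<open>m\<close> remain free and both sides are polynomials in them; the new
    \<open>t\<close>-derivative \<open>P1\<close> has been eliminated from
    \<open>N11\<close>.\<close>
  have id: "?F * (dird et (dird et U) p + a * ?B + a\<^sup>2 * ?Uuu
      + (h x * H u * m + (deriv h x * H u + h x * K u) * b + h x * deriv H u * b\<^sup>2) * g * ?Uu
      - (dird et U p + a * ?Uu) * Q) =
    ?G * (dird ex (dird ex U) p + b * ?S + b\<^sup>2 * ?Uuu + m * ?Uu
      - (dird ex U p + b * ?Uu) * i * dird ex (dird ex X) p)
    + ?c * ((dird ex U p + b * ?Uu) * i) + h' (X p) * deriv H' (U p) * ((dird ex U p + b * ?Uu) * i)\<^sup>2" for a b m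
  proof -
    define r where "r = (h x * H u * m + (deriv h x * H u + h x * K u) * b + h x * deriv H u * b\<^sup>2) * g"
    have jet: "jet_equation (f, h, H, K) x u b r m"
      using el by (simp add: jet_equation_def r_def g_def algebra_simps)
    have J: "total1 e1 a T p * total1 e2 b X p - total1 e2 b T p * total1 e1 a X p \<noteq> 0"
      using z by simp
    obtain P1 P2 N11 N12 N21 N22 where
      R: "jet_relation T X U p a b r 0 m P1 P2 N11 N12 N21 N22" and
      E: "jet_equation (f, h, H, K) x u b r m \<longleftrightarrow> jet_equation (f', h', H', K') (X p) (U p) P2 N11 N22"
      unfolding p_def by (rule jet_transformation_elements[OF \<theta> p[unfolded p_def] J[unfolded p_def]])
    note R = R[unfolded jet_relation_def total2_e11 total2_e22 total1_simps z(1-4) z(8-)]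
    have P2: "P2 = (dird ex U p + b * ?Uu) * i" using R z(6) by (simp add: i_def)
    have P1: "P1 = (dird et U p + a * ?Uu) / dird et T p"
      using R z(5) by simp
    have N22: "N22 = (dird ex (dird ex U) p + b * ?S + b\<^sup>2 * ?Uuu + m * ?Uu - P2 * dird ex (dird ex X) p) * i\<^sup>2"
      using R z(6) by (simp add: i_def field_simps power2_eq_square)
    have N11: "N11 = (dird et (dird et U) p + a * ?B + a\<^sup>2 * ?Uuu + r * ?Uu - (dird et U p + a * ?Uu) * Q) * j"
      using R z(5) unfolding P1 by (simp add: j_def Q_def field_simps power2_eq_square)
    have "f' (X p) * N11 = h' (X p) * H' (U p) * N22 + ?c * P2 + h' (X p) * deriv H' (U p) * P2\<^sup>2"
      using E jet by (simp add: jet_equation_def algebra_simps)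
    then show ?thesis
      unfolding N11 N22 unfolding P2 r_def by (simp add: algebra_simps)
  qed
  have ij: "i \<noteq> 0" "j \<noteq> 0" "g \<noteq> 0" "?F \<noteq> 0" "?Uu \<noteq> 0" using z el by (simp_all add: i_def j_def g_def)
  \<comment> \<open>Only \<open>N11\<close> depends on \<open>a = u_t\<close>, so nothing else can
    balance its quadratic term. The lemma on coefficients is applied with \<open>a\<close> in the
    place of \<open>b\<close>.\<close>
  have "?F * ?Uuu = 0"
  proof (rule quadratic_coefficients(2))
    show "(?F * (dird et (dird et U) p - dird et U p * Q) - ?G * (dird ex (dird ex U) p
        - dird ex U p * i * dird ex (dird ex X) p)
       - ?c * (dird ex U p * i) - h' (X p) * deriv H' (U p) * (dird ex U p * i)\<^sup>2)
      + (?F * (?B - ?Uu * Q)) * a + ?F * ?Uuu * a\<^sup>2 + 0 * m = 0" for a m :: real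
      using id[of a 0 0] by (simp add: algebra_simps)
  qed
  then show Uuu: "?Uuu = 0" using ij by simp
  \<comment> \<open>With \<open>a = 0\<close> and \<open>U_uu = 0\<close>, the coefficients of
    \<open>m\<close>, \<open>b\<close> squared and \<open>b\<close> are the three remaining
    claims.\<close>
  have id2: "(?F * (dird et (dird et U) p - dird et U p * Q) - ?G * (dird ex (dird ex U) p
        - dird ex U p * i * dird ex (dird ex X) p)
       - ?c * (dird ex U p * i) - h' (X p) * deriv H' (U p) * (dird ex U p * i)\<^sup>2)
      + (?F * g * ?Uu * (deriv h x * H u + h x * K u) - ?G * (?S - ?Uu * i * dird ex (dird ex X) p)
        - ?c * ?Uu * i - 2 * h' (X p) * deriv H' (U p) * dird ex U p * ?Uu * i\<^sup>2) * b
      + (?F * g * h x * deriv H u * ?Uu - h' (X p) * deriv H' (U p) * ?Uu\<^sup>2 * i\<^sup>2) * b\<^sup>2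
      + (?F * g * h x * H u * ?Uu - ?G * ?Uu) * m = 0" for b m
    using id[of 0 m b] unfolding Uuu by (simp add: algebra_simps power2_eq_square)
  note co = quadratic_coefficients[OF id2]
  have R: "R = ?F * g" by (simp add: R_def j_def g_def)
  show "R * h x * H u * (dird ex X p)\<^sup>2 = h' (X p) * H' (U p)"
    using co(3) ij z(6) unfolding R[symmetric] by (simp add: i_def field_simps)
  show "R * h x * deriv H u * (dird ex X p)\<^sup>2 = h' (X p) * deriv H' (U p) * ?Uu"
    using co(2) ij z(6) unfolding R[symmetric] by (simp add: i_def field_simps power2_eq_square)
  show "R * dird eu U p * (deriv h x * H u + h x * K u) =
      h' (X p) * H' (U p) * (dird eu (dird ex U) p + dird ex (dird eu U) p
        - dird eu U p * dird ex (dird ex X) p / dird ex X p) / (dird ex X p)\<^sup>2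
      + (deriv h' (X p) * H' (U p) + h' (X p) * K' (U p)) * dird eu U p / dird ex X p
      + 2 * h' (X p) * deriv H' (U p) * dird ex U p * dird eu U p / (dird ex X p)\<^sup>2"
    using co(1) unfolding R[symmetric] by (simp add: i_def algebra_simps power2_eq_square power_divide
        add_divide_distrib diff_divide_distrib)
qed

text \<open>The derivative of \<open>h'\<close> is written \<open>dird 1 h'\<close>, since in this
  form it inherits smoothness from \<open>h'\<close>; \<open>deriv_eq_dird\<close> translates
  back.\<close>

lemma smooth_compose_image:
  assumes "(f', h', H', K') \<in> admissible_elements image_domain"
  shows "smooth_on \<Omega> (\<lambda>p. f' (X p))" "smooth_on \<Omega> (\<lambda>p. h' (X p))"
    "smooth_on \<Omega> (\<lambda>p. H' (U p))" "smooth_on \<Omega> (\<lambda>p. K' (U p))" "smooth_on \<Omega> (\<lambda>p. dird 1 h' (X p))"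
proof -
  note ad = admissible_elementsD(1-4)[OF assms]
  show "smooth_on \<Omega> (\<lambda>p. f' (X p))" "smooth_on \<Omega> (\<lambda>p. h' (X p))"
    "smooth_on \<Omega> (\<lambda>p. H' (U p))" "smooth_on \<Omega> (\<lambda>p. K' (U p))" "smooth_on \<Omega> (\<lambda>p. dird 1 h' (X p))"
    using smooth_on_compose[OF open_domain ad(1) smooth(2) image_range(1)]
      smooth_on_compose[OF open_domain ad(2) smooth(2) image_range(1)]
      smooth_on_compose[OF open_domain ad(3) smooth(3) image_range(2)]
      smooth_on_compose[OF open_domain ad(4) smooth(3) image_range(2)]
      smooth_on_compose[OF open_domain smooth_on_dird[OF ad(2)] smooth(2) image_range(1)]
    by simp_all
qed

lemma image_elements_of_gauss:
  assumes "\<Psi> (\<lambda>_. 1, \<lambda>_. 1, gauss_element c d, \<lambda>u. u) = (f', h', H', K')"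
  shows "(\<lambda>_. 1, \<lambda>_. 1, gauss_element c d, \<lambda>u. u) \<in> admissible_elements \<Omega>"
    "(f', h', H', K') \<in> admissible_elements image_domain"
proof -
  show "(\<lambda>_. 1, \<lambda>_. 1, gauss_element c d, \<lambda>u. u) \<in> admissible_elements \<Omega>"
    by (rule test_elements_admissible[OF nonempty]) (simp_all add: smooth_gauss_element, simp add: gauss_element_def)
  from admissible[OF this] show "(f', h', H', K') \<in> admissible_elements image_domain"
    by (simp add: assms)
qed

lemma dird_compose_X:
  fixes \<phi> :: "real \<Rightarrow> real"
  assumes "p \<in> \<Omega>" "\<phi> differentiable (at (X p))"
  shows "dird et (\<lambda>p. \<phi> (X p)) p = 0" "dird eu (\<lambda>p. \<phi> (X p)) p = 0"
  using dird_compose_real[OF differentiable(2)[OF assms(1)] assms(2)] direct_structure[OF assms(1)] by simp_all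

text \<open>
  By the second and third coefficient equations, \<open>H'(U) = G H\<close> for a function \<open>G\<close> that does not
  depend on \<open>u\<close>; both claims arise by differentiating this relation.
\<close>

lemma gauss_constraints:
  fixes c d :: real
  assumes p: "p \<in> \<Omega>"
  shows "- 2 * dird et (dird et T) p * dird eu U p =
      dird et T p * (c + d * snd (snd p)) * dird et U p"
    and "d * dird ex U p + (c + d * snd (snd p)) * dird eu (dird ex U) p = 0"
proof -
  obtain f' h' H' K' where \<theta>': "\<Psi> (\<lambda>_. 1, \<lambda>_. 1, gauss_element c d, \<lambda>u. u) = (f', h', H', K')"
    by (metis prod_cases4)
  note \<theta> = image_elements_of_gauss[OF \<theta>']
  note sm = smooth_compose_image[OF \<theta>(2)] smooth smooth_on_dird[OF smooth(1)] smooth_on_dird[OF smooth(2)]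
  note el = elements[OF \<theta>(1) \<theta>']
  have h': "h' (X q) \<noteq> 0" "f' (X q) \<noteq> 0" if "q \<in> \<Omega>" for q
    using el(8,9)[of "fst q" "fst (snd q)" "snd (snd q)"] that by simp_all
  \<comment> \<open>For \<open>f = h = 1\<close> this is the quotient in the coefficient of
    \<open>u_xx\<close>, solved for \<open>H'(U)\<close>. Products with \<open>inverse\<close> let
    the closure rules for smoothness apply.\<close>
  define G where "G q = f' (X q) * inverse (h' (X q)) * (dird ex X q * dird ex X q)
    * inverse (dird et T q * dird et T q)" for q
  let ?H = "\<lambda>q. gauss_element c d (snd (snd q))"
  let ?k = "\<lambda>q. c + d * snd (snd q)"
  have G: "smooth_on \<Omega> G"
    unfolding G_def using h' direct_structure(5)
    by (intro smooth_on_mult smooth_on_inverse sm open_domain) auto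
  have G0: "G q \<noteq> 0" if "q \<in> \<Omega>" for q
    using h'[OF that] direct_structure(5,6)[OF that] by (simp add: G_def)
  have H0: "?H q \<noteq> 0" for q by (simp add: gauss_element_def)
  have rel: "G q * ?H q = H' (U q)" "G q * (?k q * ?H q) = deriv H' (U q) * dird eu U q" if "q \<in> \<Omega>" for q
  proof -
    have q: "(fst q, fst (snd q), snd (snd q)) \<in> \<Omega>" using that by simp
    from direct_coefficients(2,3)[OF \<theta>(1) \<theta>' q] h'[OF that] direct_structure(5)[OF that]
    show "G q * ?H q = H' (U q)" "G q * (?k q * ?H q) = deriv H' (U q) * dird eu U q"
      unfolding G_def deriv_gauss_element by (simp_all add: field_simps power2_eq_square)
  qed
  have dH: "(?H has_derivative (\<lambda>w. ?k q * ?H q * snd (snd w))) (at q)" for q :: point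
    unfolding gauss_element_def
    by (auto intro!: derivative_eq_intros simp: algebra_simps)
  have Hd: "?H differentiable (at q)" for q :: point
    using dH differentiable_def by blast
  have Gd: "G differentiable (at q)" if "q \<in> \<Omega>" for q
    by (rule smooth_on_differentiable[OF G that])
  have key: "G q * (?k q * ?H q * snd (snd w)) + dird w G q * ?H q = deriv H' (U q) * dird w U q"
    if "q \<in> \<Omega>" for q w
  proof -
    have "dird w (\<lambda>q. G q * ?H q) q = dird w (\<lambda>q. H' (U q)) q"
      by (rule dird_cong[OF open_domain that rel(1)])
    also have "\<dots> = deriv H' (U q) * dird w U q"
      using el(4)[of "fst q" "fst (snd q)" "snd (snd q)"] that
      by (intro dird_compose_real differentiable) simp_all
    finally show ?thesis
      unfolding dird_mult[OF Gd[OF that] Hd] dird_eq[OF dH] .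
  qed
  \<comment> \<open>In the direction \<open>eu\<close> the derivative of the first relation in
    \<open>rel\<close> is the second relation plus a term with \<open>G_u\<close>.\<close>
  have Gu: "dird eu G q = 0" if "q \<in> \<Omega>" for q
    using key[OF that, of eu] rel(2)[OF that] H0[of q] by simp
  \<comment> \<open>Multiplication by \<open>U_u\<close> turns the unknown derivative of
    \<open>H'\<close> into the right-hand expression known from \<open>rel\<close>, so
    \<open>H'\<close> drops out.\<close>
  have Gw: "dird w G q * dird eu U q = G q * (?k q * dird w U q)" if "q \<in> \<Omega>" "snd (snd w) = 0" for q w
  proof -
    have "dird w G q * ?H q * dird eu U q = (deriv H' (U q) * dird eu U q) * dird w U q"
      using key[OF that(1), of w] that(2) by simp
    then show ?thesis unfolding rel(2)[OF that(1), symmetric] using H0[of q] by simp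
  qed
  \<comment> \<open>\<open>G\<close> times the square of \<open>T_t\<close> is built from functions
    of \<open>X\<close> and from \<open>X_x\<close>, none of which depends on \<open>t\<close>. So
    \<open>t\<close> enters \<open>G\<close> only through \<open>T_t\<close>, and \<open>G_t\<close>
    is expressed by \<open>T_tt\<close>.\<close>
  have "dird et (\<lambda>q. dird et T q * dird et T q * G q) p =
      dird et (\<lambda>q. f' (X q) * inverse (h' (X q)) * (dird ex X q * dird ex X q)) p"
    by (rule dird_cong[OF open_domain p]) (use direct_structure(5) in \<open>simp add: G_def field_simps\<close>)
  also have "\<dots> = 0"
  proof -
    have *: "f' differentiable (at (X p))" "h' differentiable (at (X p))"
      using admissible_elementsD(1,2)[OF \<theta>(2)] image_range(1)[OF p] smooth_on_differentiable by blast+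
    then have \<phi>: "(\<lambda>x. f' x * inverse (h' x)) differentiable (at (X p))"
      using h'[OF p] by (intro differentiable_mult differentiable_inverse)
    have dX: "(\<lambda>q. dird ex X q * dird ex X q) differentiable (at p)"
      by (intro differentiable_mult differentiable p)
    have \<phi>X: "(\<lambda>q. f' (X q) * inverse (h' (X q))) differentiable (at p)"
      using h' by (intro smooth_on_differentiable[OF _ p] smooth_on_mult smooth_on_inverse sm open_domain) auto
    show ?thesis
      using dird_compose_X(1)[OF p \<phi>] direct_second_derivatives(7)[OF p]
      by (simp add: dird_mult[OF \<phi>X dX] dird_mult[OF differentiable(5)[OF p] differentiable(5)[OF p]])
  qed
  finally have "dird et T p * dird et T p * dird et G p + 2 * dird et T p * dird et (dird et T) p * G p = 0"
    using Gd[OF p] differentiable(4)[OF p]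
    by (simp add: dird_mult differentiable_mult algebra_simps)
  then have "dird et T p * (dird et T p * dird et G p + 2 * dird et (dird et T) p * G p) = 0"
    by (simp add: algebra_simps)
  then have Gt: "dird et T p * dird et G p = - 2 * dird et (dird et T) p * G p"
    using direct_structure(5)[OF p] by simp
  have "G p * (- 2 * dird et (dird et T) p * dird eu U p) = dird et T p * dird et G p * dird eu U p"
    unfolding Gt by simp
  also have "\<dots> = dird et T p * (dird et G p * dird eu U p)" by simp
  also have "\<dots> = G p * (dird et T p * ?k p * dird et U p)"
    using Gw[OF p, of et] by simp
  finally have "G p * (- 2 * dird et (dird et T) p * dird eu U p) = G p * (dird et T p * ?k p * dird et U p)" .
  then show "- 2 * dird et (dird et T) p * dird eu U p = dird et T p * ?k p * dird et U p"
    using G0[OF p] by (subst (asm) mult_left_cancel)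
  \<comment> \<open>\<open>Gw\<close> in the direction \<open>ex\<close> is differentiated by
    \<open>u\<close>. The left side contributes nothing since \<open>G_u\<close> and
    \<open>U_uu\<close> vanish, and on the right \<open>G\<close> factors out.\<close>
  have "dird eu (\<lambda>q. dird ex G q * dird eu U q) p = dird eu (\<lambda>q. G q * (?k q * dird ex U q)) p"
    by (rule dird_cong[OF open_domain p]) (simp add: Gw)
  moreover have "dird eu (\<lambda>q. dird ex G q * dird eu U q) p = 0"
  proof -
    have "dird eu (dird ex G) p = 0"
      by (rule dird_commute_zero[OF open_domain G Gu p])
    moreover have "dird eu (dird eu U) p = 0"
      using direct_coefficients(1)[OF \<theta>(1) \<theta>', of "fst p" "fst (snd p)" "snd (snd p)"] p by simp
    ultimately show ?thesis
      using smooth_on_differentiable[OF smooth_on_dird[OF G] p] differentiable(6)[OF p]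
      by (simp add: dird_mult)
  qed
  moreover have "dird eu (\<lambda>q. G q * (?k q * dird ex U q)) p =
      G p * (d * dird ex U p + ?k p * dird eu (dird ex U) p)"
  proof -
    have k: "(?k has_derivative (\<lambda>w. d * snd (snd w))) (at p)"
      by (auto intro!: derivative_eq_intros)
    then have kd: "?k differentiable (at p)" by (auto simp: differentiable_def)
    show ?thesis
      using Gd[OF p] differentiable(6)[OF p] kd
      by (simp add: dird_mult differentiable_mult Gu[OF p] dird_eq[OF k])
  qed
  ultimately show "d * dird ex U p + ?k p * dird eu (dird ex U) p = 0"
    using G0[OF p] by simp
qed

text \<open>\<open>T\<close> and \<open>U\<close> are the same for all \<open>c\<close>,
  \<open>d\<close>. With \<open>c = d = 0\<close> the first constraint gives
  \<open>T_tt = 0\<close>, and then \<open>c = 1\<close> gives \<open>U_t = 0\<close>. In the second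
  one \<open>(1, 0)\<close> gives \<open>U_xu = 0\<close>, after which \<open>(0, 1)\<close> leaves
  \<open>U_x = 0\<close>.\<close>

lemma derivatives_vanish:
  assumes p: "p \<in> \<Omega>"
  shows "dird et (dird et T) p = 0" "dird et U p = 0" "dird ex U p = 0" "dird eu (dird eu U) p = 0"
proof -
  show Ttt: "dird et (dird et T) p = 0"
    using gauss_constraints(1)[OF p, of 0 0] direct_structure[OF p] by simp
  show "dird et U p = 0"
    using gauss_constraints(1)[OF p, of 1 0] direct_structure[OF p] Ttt by simp
  show "dird ex U p = 0"
    using gauss_constraints(2)[OF p, of 1 0] gauss_constraints(2)[OF p, of 0 1] by simp
  obtain f' h' H' K' where \<theta>': "\<Psi> (\<lambda>_. 1, \<lambda>_. 1, gauss_element 0 0, \<lambda>u. u) = (f', h', H', K')"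
    by (metis prod_cases4)
  show "dird eu (dird eu U) p = 0"
    using direct_coefficients(1)[OF image_elements_of_gauss(1)[OF \<theta>'] \<theta>', of "fst p" "fst (snd p)" "snd (snd p)"] p
    by simp
qed

text \<open>For \<open>H = 1\<close> and \<open>K = u\<close> the coefficient of \<open>u_x\<close>
  relates \<open>u * X_x + X_xx\<close> to functions of \<open>X\<close>, to \<open>X_x\<close> and
  to \<open>V = K'(U) / H'(U)\<close>. Its \<open>u\<close>-derivative reduces to
  \<open>X_x * V_u = 1\<close>. As \<open>V\<close> does not depend on \<open>x\<close>, neither
  does \<open>X_x\<close>.\<close>

lemma X_second_derivative:
  assumes p: "p \<in> \<Omega>"
  shows "dird ex (dird ex X) p = 0"
proof -
  obtain f' h' H' K' where \<theta>': "\<Psi> (\<lambda>_. 1, \<lambda>_. 1, gauss_element 0 0, \<lambda>u. u) = (f', h', H', K')"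
    by (metis prod_cases4)
  note \<theta> = image_elements_of_gauss[OF \<theta>']
  note el = elements[OF \<theta>(1) \<theta>']
  note sm = smooth_compose_image[OF \<theta>(2)]
  have nz: "h' (X q) \<noteq> 0" "H' (U q) \<noteq> 0" and dh': "h' differentiable (at (X q))" if "q \<in> \<Omega>" for q
    using el(3,9,10)[of "fst q" "fst (snd q)" "snd (snd q)"] that by simp_all
  define V where "V q = K' (U q) * inverse (H' (U q))" for q
  have V: "smooth_on \<Omega> V"
    unfolding V_def using nz by (intro smooth_on_mult smooth_on_inverse sm open_domain) auto
  have Vx: "dird ex V q = 0" if "q \<in> \<Omega>" for q
  proof -
    have *: "H' differentiable (at (U q))" "K' differentiable (at (U q))"
      using admissible_elementsD(3,4)[OF \<theta>(2)] image_range(2)[OF that] smooth_on_differentiable by blast+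
    then have "(\<lambda>u. K' u * inverse (H' u)) differentiable (at (U q))"
      using nz[OF that] by (intro differentiable_mult differentiable_inverse)
    from dird_compose_real[OF differentiable(3)[OF that] this] derivatives_vanish(3)[OF that]
    show ?thesis by (simp add: V_def[abs_def])
  qed
  have rel: "(snd (snd q) * dird ex X q + dird ex (dird ex X) q) * h' (X q) =
      (dird ex X q * dird ex X q) * (dird 1 h' (X q) + h' (X q) * V q)" if "q \<in> \<Omega>" for q
  proof -
    have q: "(fst q, fst (snd q), snd (snd q)) \<in> \<Omega>" using that by simp
    have "dird eu (dird ex U) q = 0"
      by (rule dird_zero_on[OF open_domain that derivatives_vanish(3)])
    moreover have "dird ex (dird eu U) q = 0"
      by (rule dird_commute_zero[OF open_domain smooth(3) derivatives_vanish(3) that])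
    moreover have g: "gauss_element 0 0 = (\<lambda>_. 1)" by (simp add: gauss_element_def fun_eq_iff)
    moreover have "deriv H' (U q) = 0"
      using direct_coefficients(3)[OF \<theta>(1) \<theta>' q] nz[OF that] direct_structure(7)[OF that]
      unfolding g by simp
    moreover have R: "f' (X q) / (1 * (dird et T q)\<^sup>2) = h' (X q) * H' (U q) / (dird ex X q)\<^sup>2"
      using direct_coefficients(2)[OF \<theta>(1) \<theta>' q] direct_structure[OF that]
      unfolding g by (simp add: field_simps)
    ultimately have eq: "h' (X q) * H' (U q) / (dird ex X q)\<^sup>2 * dird eu U q * snd (snd q) =
        h' (X q) * H' (U q) * (- (dird eu U q * dird ex (dird ex X) q / dird ex X q)) / (dird ex X q)\<^sup>2
        + (dird 1 h' (X q) * H' (U q) + h' (X q) * K' (U q)) * dird eu U q / dird ex X q"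
      using direct_coefficients(4)[OF \<theta>(1) \<theta>' q]
      unfolding prod.collapse R deriv_eq_dird[OF dh'[OF that]] by simp
    note n = direct_structure(6,7)[OF that] nz[OF that]
    have "h' (X q) * H' (U q) * snd (snd q) * dird ex X q =
        (dird ex X q) ^ 3 / dird eu U q * (h' (X q) * H' (U q) / (dird ex X q)\<^sup>2 * dird eu U q * snd (snd q))"
      using n by (simp add: power2_eq_square power3_eq_cube)
    also have "\<dots> = - h' (X q) * H' (U q) * dird ex (dird ex X) q
        + (dird 1 h' (X q) * H' (U q) + h' (X q) * K' (U q)) * (dird ex X q)\<^sup>2"
      unfolding eq using n by (simp add: power2_eq_square power3_eq_cube field_simps)
    finally show ?thesis
      using n by (simp add: V_def field_simps power2_eq_square)
  qed
  have Vu: "dird ex X q * dird eu V q = 1" if q: "q \<in> \<Omega>" for q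
  proof -
    have d: "(\<lambda>q. h' (X q)) differentiable (at q)" "(\<lambda>q. dird 1 h' (X q)) differentiable (at q)"
      "V differentiable (at q)" "dird ex X differentiable (at q)" "dird ex (dird ex X) differentiable (at q)"
      using sm(2,5) V smooth_on_dird[OF smooth(2)] smooth_on_dird[OF smooth_on_dird[OF smooth(2)]]
        smooth_on_differentiable q by blast+
    have s: "((\<lambda>q::point. snd (snd q)) has_derivative (\<lambda>w. snd (snd w))) (at q)"
      by (auto intro!: derivative_eq_intros)
    then have sd: "(\<lambda>q::point. snd (snd q)) differentiable (at q)" by (auto simp: differentiable_def)
    have "dird 1 h' differentiable (at (X q))"
      using smooth_on_differentiable[OF smooth_on_dird[OF admissible_elementsD(2)[OF \<theta>(2)]] image_range(1)[OF q]] .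
    then have z: "dird eu (\<lambda>q. h' (X q)) q = 0" "dird eu (\<lambda>q. dird 1 h' (X q)) q = 0"
      using dird_compose_X(2)[OF q] dh'[OF q] by blast+
    have zx: "dird eu (dird ex X) q = 0" by (rule direct_second_derivatives[OF q])
    have zxx: "dird eu (dird ex (dird ex X)) q = 0"
      by (rule dird_commute_zero[OF open_domain smooth_on_dird[OF smooth(2)] direct_second_derivatives(8) q])
    have "dird eu (\<lambda>q. (snd (snd q) * dird ex X q + dird ex (dird ex X) q) * h' (X q)) q =
      dird eu (\<lambda>q. (dird ex X q * dird ex X q) * (dird 1 h' (X q) + h' (X q) * V q)) q"
      by (rule dird_cong[OF open_domain q rel])
    then have "dird ex X q * h' (X q) = (dird ex X q * dird ex X q) * (h' (X q) * dird eu V q)"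
      using d sd by (simp add: dird_mult dird_add differentiable_mult differentiable_add z zx zxx dird_eq[OF s])
    then show ?thesis using direct_structure(6)[OF q] nz[OF q] by simp
  qed
  have "dird ex (\<lambda>q. dird ex X q * dird eu V q) p = dird ex (\<lambda>q. 1) p"
    by (rule dird_cong[OF open_domain p Vu])
  moreover have "dird ex (dird eu V) p = 0"
    by (rule dird_commute_zero[OF open_domain V Vx p])
  moreover have "dird eu V differentiable (at p)"
    using smooth_on_differentiable[OF smooth_on_dird[OF V] p] .
  ultimately have "dird ex (dird ex X) p * dird eu V p = 0"
    using dird_eq[OF has_derivative_const, of ex 1 p] differentiable(5)[OF p] by (simp add: dird_mult)
  then show ?thesis using Vu[OF p] by auto
qed

lemma affine:
  assumes conn: "connected \<Omega>"
  obtains \<epsilon>1 \<epsilon>2 \<epsilon>3 \<epsilon>4 \<epsilon>5 \<epsilon>6 where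
    "\<And>t x u. (t, x, u) \<in> \<Omega> \<Longrightarrow> T (t, x, u) = \<epsilon>1 * t + \<epsilon>2"
    "\<And>t x u. (t, x, u) \<in> \<Omega> \<Longrightarrow> X (t, x, u) = \<epsilon>5 * x + \<epsilon>6"
    "\<And>t x u. (t, x, u) \<in> \<Omega> \<Longrightarrow> U (t, x, u) = \<epsilon>3 * u + \<epsilon>4"
    "\<And>p. p \<in> \<Omega> \<Longrightarrow> dird et T p = \<epsilon>1" "\<And>p. p \<in> \<Omega> \<Longrightarrow> dird ex X p = \<epsilon>5"
    "\<And>p. p \<in> \<Omega> \<Longrightarrow> dird eu U p = \<epsilon>3" "\<epsilon>1 * \<epsilon>3 * \<epsilon>5 \<noteq> 0"
proof -
  have Uu: "dird et (dird eu U) p = 0" "dird ex (dird eu U) p = 0" if "p \<in> \<Omega>" for p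
    using dird_commute_zero[OF open_domain smooth(3) _ that] derivatives_vanish by blast+
  obtain \<epsilon>1 where 1: "\<And>p. p \<in> \<Omega> \<Longrightarrow> dird et T p = \<epsilon>1"
    by (rule constant_if_dird_zero[OF open_domain conn smooth_on_dird[OF smooth(1)]])
      (use derivatives_vanish direct_second_derivatives in auto)
  obtain \<epsilon>5 where 5: "\<And>p. p \<in> \<Omega> \<Longrightarrow> dird ex X p = \<epsilon>5"
    by (rule constant_if_dird_zero[OF open_domain conn smooth_on_dird[OF smooth(2)]])
      (use X_second_derivative direct_second_derivatives in auto)
  obtain \<epsilon>3 where 3: "\<And>p. p \<in> \<Omega> \<Longrightarrow> dird eu U p = \<epsilon>3"
    by (rule constant_if_dird_zero[OF open_domain conn smooth_on_dird[OF smooth(3)]])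
      (use derivatives_vanish Uu in auto)
  obtain \<epsilon>2 where 2: "\<And>t x u. (t, x, u) \<in> \<Omega> \<Longrightarrow> T (t, x, u) = \<epsilon>1 * t + 0 * x + 0 * u + \<epsilon>2"
    using affine_if_dird_constant[OF open_domain conn smooth(1) 1 direct_structure(1,2)] by blast
  obtain \<epsilon>6 where 6: "\<And>t x u. (t, x, u) \<in> \<Omega> \<Longrightarrow> X (t, x, u) = 0 * t + \<epsilon>5 * x + 0 * u + \<epsilon>6"
    using affine_if_dird_constant[OF open_domain conn smooth(2) direct_structure(3) 5 direct_structure(4)] by blast
  obtain \<epsilon>4 where 4: "\<And>t x u. (t, x, u) \<in> \<Omega> \<Longrightarrow> U (t, x, u) = 0 * t + 0 * x + \<epsilon>3 * u + \<epsilon>4"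
    using affine_if_dird_constant[OF open_domain conn smooth(3) derivatives_vanish(2,3) 3] by blast
  show thesis
  proof (rule that[of \<epsilon>1 \<epsilon>2 \<epsilon>5 \<epsilon>6 \<epsilon>3 \<epsilon>4])
    obtain p where "p \<in> \<Omega>" using nonempty by blast
    then show "\<epsilon>1 * \<epsilon>3 * \<epsilon>5 \<noteq> 0" using direct_structure(5-7)[of p] 1 3 5 by auto
  qed (use 1 2 3 4 5 6 in auto)
qed

end

subsection \<open>Transformation of the arbitrary elements\<close>

lemma open_x_range: "open \<Omega> \<Longrightarrow> open (x_range \<Omega>)"
  and open_u_range: "open \<Omega> \<Longrightarrow> open (u_range \<Omega>)"
  and connected_x_range: "connected \<Omega> \<Longrightarrow> connected (x_range \<Omega>)"
proof -
  have x: "x_range \<Omega> = fst ` snd ` \<Omega>" and u: "u_range \<Omega> = snd ` snd ` \<Omega>"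
    by (auto simp: x_range_def u_range_def image_image split_def)
  show "open (x_range \<Omega>)" "open (u_range \<Omega>)" if "open \<Omega>"
    unfolding x u by (intro open_image_fst open_image_snd that)+
  show "connected (x_range \<Omega>)" if "connected \<Omega>"
    unfolding x by (intro connected_continuous_image continuous_intros that)
qed

text \<open>Two points of the domain need not be joined by changing one variable at a time. Near a
  given point, however, \<open>x\<close> can be varied with \<open>u\<close> held fixed, so \<phi>
  is locally constant along the domain, and connectedness does the rest.\<close>

lemma separated_variables_constant:
  fixes \<phi> \<psi> :: "real \<Rightarrow> real"
  assumes "open \<Omega>" "connected \<Omega>" and eq: "\<And>t x u. (t, x, u) \<in> \<Omega> \<Longrightarrow> \<phi> x = \<psi> u"
  obtains c where "\<And>x. x \<in> x_range \<Omega> \<Longrightarrow> \<phi> x = c" "\<And>u. u \<in> u_range \<Omega> \<Longrightarrow> \<psi> u = c"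
proof (cases "\<Omega> = {}")
  case False
  then obtain p0 where p0: "p0 \<in> \<Omega>" by blast
  have loc: "eventually (\<lambda>q. \<phi> (fst (snd p)) = \<phi> (fst (snd q))) (at p within \<Omega>)" if p: "p \<in> \<Omega>" for p
  proof -
    have "open ((\<lambda>q. (fst q, fst (snd q), snd (snd p))) -` \<Omega>)"
      by (intro open_vimage assms(1) continuous_intros)
    moreover have "p \<in> (\<lambda>q. (fst q, fst (snd q), snd (snd p))) -` \<Omega>" using p by simp
    ultimately have "eventually (\<lambda>q. q \<in> (\<lambda>q. (fst q, fst (snd q), snd (snd p))) -` \<Omega>) (at p within \<Omega>)"
      by (rule eventually_at_in_open'[THEN filter_leD[OF at_le[OF subset_UNIV]]])
    then show ?thesis
    proof (rule eventually_mono)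
      fix q assume "q \<in> (\<lambda>q. (fst q, fst (snd q), snd (snd p))) -` \<Omega>"
      then have "\<phi> (fst (snd q)) = \<psi> (snd (snd p))" using eq by simp
      moreover have "\<phi> (fst (snd p)) = \<psi> (snd (snd p))"
        using p by (intro eq[of "fst p"]) simp
      ultimately show "\<phi> (fst (snd p)) = \<phi> (fst (snd q))" by simp
    qed
  qed
  define c where "c = \<phi> (fst (snd p0))"
  have c: "\<phi> (fst (snd p)) = c" if "p \<in> \<Omega>" for p
    unfolding c_def using loc
    by (intro connected_local_const[OF assms(2) that p0, of "\<lambda>q. \<phi> (fst (snd q))"]) blast
  have "\<phi> x = c" "\<psi> u = c" if "(t, x, u) \<in> \<Omega>" for t x u
    using c[OF that] eq[OF that] by simp_all
  then show thesis by (intro that[of c]) (auto simp: x_range_def u_range_def)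
qed (use that in \<open>auto simp: x_range_def u_range_def\<close>)

lemma deriv_affine_substitution:
  fixes \<phi> \<psi> :: "real \<Rightarrow> real"
  assumes "open S" "x \<in> S" "\<And>y. y \<in> S \<Longrightarrow> \<phi> (a * y + b) = \<psi> y"
    and "\<phi> differentiable (at (a * x + b))" "(\<psi> has_real_derivative d) (at x)"
  shows "deriv \<phi> (a * x + b) * a = d"
proof -
  have "(\<phi> has_real_derivative deriv \<phi> (a * x + b)) (at (a * x + b))"
    using assms(4) by (simp add: DERIV_deriv_iff_real_differentiable)
  moreover have "((\<lambda>y. a * y + b) has_real_derivative a) (at x)"
    by (auto intro!: derivative_eq_intros)
  ultimately have "((\<lambda>y. \<phi> (a * y + b)) has_real_derivative deriv \<phi> (a * x + b) * a) (at x)"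
    by (rule DERIV_chain2)
  moreover have "((\<lambda>y. \<phi> (a * y + b)) has_real_derivative d) (at x)"
    by (rule has_field_derivative_transform_within_open[OF assms(5,1,2)]) (simp add: assms(3))
  ultimately show ?thesis by (rule DERIV_unique)
qed

lemma open_affine_image:
  fixes S :: "real set"
  assumes "open S" "a \<noteq> 0"
  shows "open ((\<lambda>x. a * x + b) ` S)"
proof -
  have "(\<lambda>x. a * x + b) ` S = (\<lambda>y. (y - b) / a) -` S"
  proof (intro equalityI subsetI)
    fix y assume "y \<in> (\<lambda>y. (y - b) / a) -` S"
    then show "y \<in> (\<lambda>x. a * x + b) ` S"
      using assms(2) by (intro image_eqI[of y _ "(y - b) / a"]) simp_all
  qed (use assms(2) in auto)
  then show ?thesis using assms by (auto intro!: open_vimage continuous_intros)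
qed

lemma smooth_on_affine_image:
  fixes \<phi> \<psi> :: "real \<Rightarrow> real"
  assumes "open S" "a \<noteq> 0" "smooth_on S \<psi>" "\<And>x. x \<in> S \<Longrightarrow> \<phi> (a * x + b) = \<psi> x"
  shows "smooth_on ((\<lambda>x. a * x + b) ` S) \<phi>"
proof (rule smooth_on_cong)
  show S: "open ((\<lambda>x. a * x + b) ` S)" by (rule open_affine_image[OF assms(1,2)])
  have "smooth_on ((\<lambda>x. a * x + b) ` S) (\<lambda>y. (y - b) * inverse a)"
    by (intro smooth_on_intros S)
  then show "smooth_on ((\<lambda>x. a * x + b) ` S) (\<lambda>y. \<psi> ((y - b) * inverse a))"
    by (rule smooth_on_compose[OF S assms(3)]) (use assms(2) in \<open>auto simp: field_simps\<close>)
  show "\<psi> ((y - b) * inverse a) = \<phi> y" if "y \<in> (\<lambda>x. a * x + b) ` S" for y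
    using that assms(2,4) by (auto simp: field_simps)
qed

context equivalence_transformation
begin

text \<open>The \<open>u_xx\<close> relation separates and expresses \<open>h'\<close> by the factor
  \<open>R\<close>; inserted into the \<open>u_x\<close> relation, it leaves a linear differential
  equation for \<open>R\<close>.\<close>

lemma element_transformation:
  assumes conn: "connected \<Omega>"
    and X: "\<And>t x u. (t, x, u) \<in> \<Omega> \<Longrightarrow> X (t, x, u) = \<epsilon>5 * x + \<epsilon>6"
    and U: "\<And>t x u. (t, x, u) \<in> \<Omega> \<Longrightarrow> U (t, x, u) = \<epsilon>3 * u + \<epsilon>4"
    and d: "\<And>p. p \<in> \<Omega> \<Longrightarrow> dird et T p = \<epsilon>1" "\<And>p. p \<in> \<Omega> \<Longrightarrow> dird ex X p = \<epsilon>5"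
      "\<And>p. p \<in> \<Omega> \<Longrightarrow> dird eu U p = \<epsilon>3"
    and \<epsilon>: "\<epsilon>1 * \<epsilon>3 * \<epsilon>5 \<noteq> 0"
    and \<theta>: "(f, h, H, K) \<in> admissible_elements \<Omega>" "\<Psi> (f, h, H, K) = (f', h', H', K')"
  obtains \<epsilon>7 \<epsilon>8 \<epsilon>9 where "\<epsilon>1 * \<epsilon>3 * \<epsilon>5 * \<epsilon>7 * \<epsilon>9 \<noteq> 0"
    "\<And>x. x \<in> x_range \<Omega> \<Longrightarrow> f' (\<epsilon>5 * x + \<epsilon>6) = \<epsilon>1\<^sup>2 * inverse \<epsilon>5 * \<epsilon>9 * f x * exp (\<epsilon>8 * x)"
    "\<And>x. x \<in> x_range \<Omega> \<Longrightarrow> h' (\<epsilon>5 * x + \<epsilon>6) = \<epsilon>9 * inverse \<epsilon>7 * h x * exp (\<epsilon>8 * x)"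
    "\<And>u. u \<in> u_range \<Omega> \<Longrightarrow> H' (\<epsilon>3 * u + \<epsilon>4) = \<epsilon>5 * \<epsilon>7 * H u"
    "\<And>u. u \<in> u_range \<Omega> \<Longrightarrow> K' (\<epsilon>3 * u + \<epsilon>4) = \<epsilon>7 * (K u - \<epsilon>8 * H u)"
proof -
  have \<epsilon>0: "\<epsilon>1 \<noteq> 0" "\<epsilon>3 \<noteq> 0" "\<epsilon>5 \<noteq> 0" using \<epsilon> by auto
  \<comment> \<open>Up to the constant \<epsilon>3, the factor by which the old equation is
    multiplied when the new one is written in the old variables.\<close>
  define R where "R x = f' (\<epsilon>5 * x + \<epsilon>6) / (f x * \<epsilon>1\<^sup>2)" for x
  have el: "h differentiable (at x)" "H differentiable (at u)"
    "h' differentiable (at (\<epsilon>5 * x + \<epsilon>6))"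
    "f x \<noteq> 0" "h x \<noteq> 0" "H u \<noteq> 0"
    "f' (\<epsilon>5 * x + \<epsilon>6) \<noteq> 0" "h' (\<epsilon>5 * x + \<epsilon>6) \<noteq> 0" "H' (\<epsilon>3 * u + \<epsilon>4) \<noteq> 0"
    if "(t, x, u) \<in> \<Omega>" for t x u
    using elements[OF \<theta> that] unfolding X[OF that] U[OF that] by blast+
  have m: "R x * h x * H u * \<epsilon>5\<^sup>2 = h' (\<epsilon>5 * x + \<epsilon>6) * H' (\<epsilon>3 * u + \<epsilon>4)"
    if "(t, x, u) \<in> \<Omega>" for t x u
    using direct_coefficients(2)[OF \<theta> that] unfolding R_def X[OF that] U[OF that] d[OF that] .
  have b: "\<epsilon>5 * R x * (deriv h x * H u + h x * K u) =
      deriv h' (\<epsilon>5 * x + \<epsilon>6) * H' (\<epsilon>3 * u + \<epsilon>4) + h' (\<epsilon>5 * x + \<epsilon>6) * K' (\<epsilon>3 * u + \<epsilon>4)"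
    if p: "(t, x, u) \<in> \<Omega>" for t x u
  proof -
    have "dird eu (dird ex U) (t, x, u) = 0"
      by (rule dird_zero_on[OF open_domain p derivatives_vanish(3)])
    moreover have "dird ex (dird eu U) (t, x, u) = 0"
      by (rule dird_commute_zero[OF open_domain smooth(3) derivatives_vanish(3) p])
    ultimately have "R x * \<epsilon>3 * (deriv h x * H u + h x * K u) =
        (deriv h' (\<epsilon>5 * x + \<epsilon>6) * H' (\<epsilon>3 * u + \<epsilon>4) + h' (\<epsilon>5 * x + \<epsilon>6) * K' (\<epsilon>3 * u + \<epsilon>4)) * \<epsilon>3 / \<epsilon>5"
      using direct_coefficients(4)[OF \<theta> p] X_second_derivative[OF p] derivatives_vanish(3)[OF p]
      unfolding R_def X[OF p] U[OF p] d[OF p] by simp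
    then have "\<epsilon>3 * (\<epsilon>5 * R x * (deriv h x * H u + h x * K u)) = \<epsilon>3 *
        (deriv h' (\<epsilon>5 * x + \<epsilon>6) * H' (\<epsilon>3 * u + \<epsilon>4) + h' (\<epsilon>5 * x + \<epsilon>6) * K' (\<epsilon>3 * u + \<epsilon>4))"
      using \<epsilon>0 by (simp add: field_simps)
    then show ?thesis using \<epsilon>0(2) by (subst (asm) mult_left_cancel)
  qed
  have "R x * h x * \<epsilon>5\<^sup>2 / h' (\<epsilon>5 * x + \<epsilon>6) = H' (\<epsilon>3 * u + \<epsilon>4) / H u" if "(t, x, u) \<in> \<Omega>" for t x u
    using m[OF that] el[OF that] by (simp add: field_simps)
  then obtain c where c: "\<And>x. x \<in> x_range \<Omega> \<Longrightarrow> R x * h x * \<epsilon>5\<^sup>2 / h' (\<epsilon>5 * x + \<epsilon>6) = c"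
    "\<And>u. u \<in> u_range \<Omega> \<Longrightarrow> H' (\<epsilon>3 * u + \<epsilon>4) / H u = c"
    using separated_variables_constant[OF open_domain conn,
      of "\<lambda>x. R x * h x * \<epsilon>5\<^sup>2 / h' (\<epsilon>5 * x + \<epsilon>6)" "\<lambda>u. H' (\<epsilon>3 * u + \<epsilon>4) / H u"] by blast
  \<comment> \<open>The separation constant \<open>c\<close> is the ratio of \<open>H'\<close> to
    \<open>H\<close>; splitting off \<epsilon>5 gives the normalisation of the theorem.\<close>
  define \<epsilon>7 where "\<epsilon>7 = c / \<epsilon>5"
  obtain t0 x0 u0 where p0: "(t0, x0, u0) \<in> \<Omega>" using nonempty by auto
  have c0: "c \<noteq> 0" using c(2)[OF u_range_I[OF p0]] el[OF p0] by auto
  then have \<epsilon>7: "\<epsilon>7 \<noteq> 0" using \<epsilon>0 by (simp add: \<epsilon>7_def)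
  have x_el: "h differentiable (at x)" "h' differentiable (at (\<epsilon>5 * x + \<epsilon>6))" "f x \<noteq> 0" "h x \<noteq> 0"
    "f' (\<epsilon>5 * x + \<epsilon>6) \<noteq> 0" "h' (\<epsilon>5 * x + \<epsilon>6) \<noteq> 0" "R x \<noteq> 0" "R differentiable (at x)"
    if "x \<in> x_range \<Omega>" for x
  proof -
    obtain t u where p: "(t, x, u) \<in> \<Omega>"
      using \<open>x \<in> x_range \<Omega>\<close> by (auto simp: x_range_def)
    show "h differentiable (at x)" "h' differentiable (at (\<epsilon>5 * x + \<epsilon>6))" "f x \<noteq> 0" "h x \<noteq> 0"
      "f' (\<epsilon>5 * x + \<epsilon>6) \<noteq> 0" "h' (\<epsilon>5 * x + \<epsilon>6) \<noteq> 0"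
      using el[OF p] by blast+
    then show "R x \<noteq> 0" using \<epsilon>0 by (simp add: R_def)
    have "(f', h', H', K') \<in> admissible_elements image_domain"
      using admissible[OF \<theta>(1)] by (simp add: \<theta>(2))
    then have "f' differentiable (at (\<epsilon>5 * x + \<epsilon>6))"
      by (rule smooth_on_differentiable[OF admissible_elementsD(1) image_range(1)[OF p, unfolded X[OF p]]])
    moreover have "(\<lambda>x. \<epsilon>5 * x + \<epsilon>6) differentiable (at x)"
      by (rule smooth_on_differentiable[of UNIV]) (intro smooth_on_intros open_UNIV UNIV_I)+
    ultimately have "(\<lambda>x. f' (\<epsilon>5 * x + \<epsilon>6)) differentiable (at x)"
      by (rule differentiable_compose)
    moreover have "f differentiable (at x)"
      using smooth_on_differentiable[OF admissible_elementsD(1)[OF \<theta>(1)] that] .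
    ultimately show "R differentiable (at x)"
      unfolding R_def using \<open>f x \<noteq> 0\<close> \<epsilon>0
      by (intro differentiable_divide differentiable_mult differentiable_const) simp_all
  qed
  have H': "H' (\<epsilon>3 * u + \<epsilon>4) = \<epsilon>5 * \<epsilon>7 * H u" if "u \<in> u_range \<Omega>" for u
  proof -
    have "H u \<noteq> 0" by (rule admissible_elementsD(7)[OF \<theta>(1) that])
    then show ?thesis using c(2)[OF that] \<epsilon>0 by (simp add: \<epsilon>7_def field_simps)
  qed
  have h': "h' (\<epsilon>5 * x + \<epsilon>6) = \<epsilon>5 / \<epsilon>7 * (R x * h x)" if "x \<in> x_range \<Omega>" for x
    using c(1)[OF that] x_el[OF that] c0 \<epsilon>0 by (simp add: \<epsilon>7_def field_simps power2_eq_square)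
  have dh': "deriv h' (\<epsilon>5 * x + \<epsilon>6) = (R x * deriv h x + deriv R x * h x) / \<epsilon>7" if "x \<in> x_range \<Omega>" for x
  proof -
    have "((\<lambda>x. \<epsilon>5 / \<epsilon>7 * (R x * h x)) has_real_derivative \<epsilon>5 / \<epsilon>7 * (R x * deriv h x + deriv R x * h x)) (at x)"
      using x_el(1,8)[OF that, folded DERIV_deriv_iff_real_differentiable]
      using \<epsilon>7 by (auto intro!: derivative_eq_intros simp: field_simps)
    from deriv_affine_substitution[OF open_x_range[OF open_domain] that h' x_el(2)[OF that] this]
    have "\<epsilon>5 * deriv h' (\<epsilon>5 * x + \<epsilon>6) = \<epsilon>5 * ((R x * deriv h x + deriv R x * h x) / \<epsilon>7)"
      by (simp add: mult.commute)
    then show ?thesis using \<epsilon>0(3) by (subst (asm) mult_left_cancel)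
  qed
  \<comment> \<open>After \<open>h'\<close>, its derivative and \<open>H'\<close> are inserted, the
    terms with the derivative of \<open>h\<close> cancel and \<open>h\<close> itself factors
    out.\<close>
  have sep: "deriv R x / R x = (K u - K' (\<epsilon>3 * u + \<epsilon>4) / \<epsilon>7) / H u" if p: "(t, x, u) \<in> \<Omega>" for t x u
  proof -
    note xr = x_range_I[OF p] and ur = u_range_I[OF p]
    have "\<epsilon>5 * h x * (R x * K u) = \<epsilon>5 * h x * (deriv R x * H u + R x * K' (\<epsilon>3 * u + \<epsilon>4) / \<epsilon>7)"
      using b[OF p] \<epsilon>7 unfolding H'[OF ur] h'[OF xr] dh'[OF xr] by (simp add: field_simps)
    then have "R x * K u = deriv R x * H u + R x * K' (\<epsilon>3 * u + \<epsilon>4) / \<epsilon>7"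
      using \<epsilon>0 x_el(4)[OF xr] by simp
    then show ?thesis using x_el(7)[OF xr] el(6)[OF p] by (simp add: field_simps)
  qed
  obtain \<epsilon>8 where \<epsilon>8: "\<And>x. x \<in> x_range \<Omega> \<Longrightarrow> deriv R x / R x = \<epsilon>8"
    "\<And>u. u \<in> u_range \<Omega> \<Longrightarrow> (K u - K' (\<epsilon>3 * u + \<epsilon>4) / \<epsilon>7) / H u = \<epsilon>8"
    using separated_variables_constant[OF open_domain conn,
      of "\<lambda>x. deriv R x / R x" "\<lambda>u. (K u - K' (\<epsilon>3 * u + \<epsilon>4) / \<epsilon>7) / H u"] sep by blast
  have K': "K' (\<epsilon>3 * u + \<epsilon>4) = \<epsilon>7 * (K u - \<epsilon>8 * H u)" if "u \<in> u_range \<Omega>" for u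
    using \<epsilon>8(2)[OF that] admissible_elementsD(7)[OF \<theta>(1) that] \<epsilon>7 by (simp add: field_simps)
  \<comment> \<open>\<open>R\<close> satisfies \<open>deriv R x = \<epsilon>8 * R x\<close>;
    dividing by the exponential solution leaves a function with zero derivative on the connected
    range of \<open>x\<close>.\<close>
  have R': "((\<lambda>x. R x * exp (- (\<epsilon>8 * x))) has_real_derivative 0) (at x)" if "x \<in> x_range \<Omega>" for x
  proof -
    have "deriv R x = \<epsilon>8 * R x" using \<epsilon>8(1)[OF that] x_el(7)[OF that] by (simp add: field_simps)
    then have "(R has_real_derivative \<epsilon>8 * R x) (at x)"
      using x_el(8)[OF that] by (simp flip: DERIV_deriv_iff_real_differentiable)
    then show ?thesis by (auto intro!: derivative_eq_intros)
  qed
  define C where "C = R x0 * exp (- (\<epsilon>8 * x0))"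
  have "R x * exp (- (\<epsilon>8 * x)) = C" if "x \<in> x_range \<Omega>" for x
    unfolding C_def
    using R' by (intro has_derivative_zero_unique_connected[OF open_x_range[OF open_domain]
        connected_x_range[OF conn] _ that x_range_I[OF p0], of "\<lambda>x. R x * exp (- (\<epsilon>8 * x))"])
      (simp add: has_field_derivative_def lambda_zero)
  then have R: "R x = C * exp (\<epsilon>8 * x)" if "x \<in> x_range \<Omega>" for x
    using that by (simp add: exp_minus field_simps)
  have C: "C \<noteq> 0" using x_el(7)[OF x_range_I[OF p0]] by (simp add: C_def)
  \<comment> \<open>The constant of integration, scaled to compensate the factor
    \<open>inverse \<epsilon>5\<close> in the formula for \<open>f'\<close>.\<close>
  define \<epsilon>9 where "\<epsilon>9 = \<epsilon>5 * C"
  show thesis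
  proof (rule that[of \<epsilon>7 \<epsilon>9 \<epsilon>8])
    show "\<epsilon>1 * \<epsilon>3 * \<epsilon>5 * \<epsilon>7 * \<epsilon>9 \<noteq> 0" using \<epsilon>0 \<epsilon>7 C by (simp add: \<epsilon>9_def)
    fix x assume x: "x \<in> x_range \<Omega>"
    have "f' (\<epsilon>5 * x + \<epsilon>6) = R x * f x * \<epsilon>1\<^sup>2"
      using x_el[OF x] \<epsilon>0 by (simp add: R_def)
    then show "f' (\<epsilon>5 * x + \<epsilon>6) = \<epsilon>1\<^sup>2 * inverse \<epsilon>5 * \<epsilon>9 * f x * exp (\<epsilon>8 * x)"
      using \<epsilon>0 by (simp add: R[OF x] \<epsilon>9_def)
    show "h' (\<epsilon>5 * x + \<epsilon>6) = \<epsilon>9 * inverse \<epsilon>7 * h x * exp (\<epsilon>8 * x)"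
      unfolding h'[OF x] R[OF x] \<epsilon>9_def using \<epsilon>7 by (simp add: field_simps)
  qed (use H' K' in auto)
qed

end

text \<open>Independence of the differentials follows from surjectivity of the derivative: preimages
  of the basis vectors, inserted into a vanishing combination, isolate its coefficients.\<close>

lemma equivalence_transformationI:
  assumes "open \<Omega>" "\<Omega> \<noteq> {}" and gr: "(\<Phi>, \<Psi>) \<in> extended_equivalence_group \<Omega>"
  shows "equivalence_transformation \<Omega> (\<lambda>p. fst (\<Phi> p)) (\<lambda>p. fst (snd (\<Phi> p))) (\<lambda>p. snd (snd (\<Phi> p))) \<Psi>"
proof
  have sm: "smooth_on \<Omega> \<Phi>" and bij: "\<And>p. p \<in> \<Omega> \<Longrightarrow> bij (frechet_derivative \<Phi> (at p))"
    using gr by (auto simp: extended_equivalence_group_def point_transformation_def)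
  show "smooth_on \<Omega> (\<lambda>p. fst (\<Phi> p))" "smooth_on \<Omega> (\<lambda>p. fst (snd (\<Phi> p)))" "smooth_on \<Omega> (\<lambda>p. snd (snd (\<Phi> p)))"
    by (intro smooth_on_fst smooth_on_snd assms(1) sm)+
  fix p :: point and c1 c2 c3 :: real
  assume p: "p \<in> \<Omega>"
    and z: "\<And>w. c1 * dird w (\<lambda>p. fst (\<Phi> p)) p + c2 * dird w (\<lambda>p. fst (snd (\<Phi> p))) p
      + c3 * dird w (\<lambda>p. snd (snd (\<Phi> p))) p = 0"
  note D = smooth_on_has_derivative[OF sm p]
  have comp: "dird w (\<lambda>p. fst (\<Phi> p)) p = fst (dird w \<Phi> p)"
    "dird w (\<lambda>p. fst (snd (\<Phi> p))) p = fst (snd (dird w \<Phi> p))"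
    "dird w (\<lambda>p. snd (snd (\<Phi> p))) p = snd (snd (dird w \<Phi> p))" for w
    by (rule dird_eq; intro has_derivative_fst has_derivative_snd D)+
  have surj: "\<exists>w. dird w \<Phi> p = y" for y
    using bij[OF p] unfolding dird_def by (metis bij_pointE)
  show "c1 = 0 \<and> c2 = 0 \<and> c3 = 0"
  proof -
    obtain w1 w2 w3 where "dird w1 \<Phi> p = et" "dird w2 \<Phi> p = ex" "dird w3 \<Phi> p = eu"
      using surj by meson
    then show ?thesis
      using z[unfolded comp, of w1] z[unfolded comp, of w2] z[unfolded comp, of w3] by simp
  qed
next
  fix \<theta> assume "\<theta> \<in> admissible_elements \<Omega>"
  then show "\<Psi> \<theta> \<in> admissible_elements ((\<lambda>p. (fst (\<Phi> p), fst (snd (\<Phi> p)), snd (snd (\<Phi> p)))) ` \<Omega>)"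
    "maps_equation \<Omega> (\<lambda>p. (fst (\<Phi> p), fst (snd (\<Phi> p)), snd (snd (\<Phi> p)))) \<theta> (\<Psi> \<theta>)"
    using gr by (auto simp: extended_equivalence_group_def)
qed (use assms in auto)

section \<open>Affine transformations belong to the group\<close>

lemma dird_affine:
  "dird w (\<lambda>p::point. a * fst p + b) p = a * fst w"
  "dird w (\<lambda>p::point. a * fst (snd p) + b) p = a * fst (snd w)"
  "dird w (\<lambda>p::point. a * snd (snd p) + b) p = a * snd (snd w)"
  by (rule dird_eq; auto intro!: derivative_eq_intros)+

lemma dird_dird_affine:
  "dird z (dird w (\<lambda>p::point. a * fst p + b)) p = 0"
  "dird z (dird w (\<lambda>p::point. a * fst (snd p) + b)) p = 0"
  "dird z (dird w (\<lambda>p::point. a * snd (snd p) + b)) p = 0"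
proof -
  have "dird z (\<lambda>_::point. c) p = 0" for c :: real
    by (rule dird_eq[OF has_derivative_const])
  then show "dird z (dird w (\<lambda>p::point. a * fst p + b)) p = 0"
    "dird z (dird w (\<lambda>p::point. a * fst (snd p) + b)) p = 0"
    "dird z (dird w (\<lambda>p::point. a * snd (snd p) + b)) p = 0"
    unfolding dird_affine[abs_def] by simp_all
qed

lemma smooth_on_affine_coordinates:
  assumes "open \<Omega>"
  shows "smooth_on \<Omega> (\<lambda>p::point. a * fst p + b)" "smooth_on \<Omega> (\<lambda>p::point. a * fst (snd p) + b)"
    "smooth_on \<Omega> (\<lambda>p::point. a * snd (snd p) + b)"
  by (intro smooth_on_intros assms)+

lemma affine_point_transformation:
  assumes "open \<Omega>"
    and \<Phi>: "\<forall>p\<in>\<Omega>. \<Phi> p = (\<epsilon>1 * fst p + \<epsilon>2, \<epsilon>5 * fst (snd p) + \<epsilon>6, \<epsilon>3 * snd (snd p) + \<epsilon>4)"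
    and \<epsilon>: "\<epsilon>1 * \<epsilon>3 * \<epsilon>5 \<noteq> 0"
  shows "point_transformation \<Omega> \<Phi>"
  unfolding point_transformation_def
proof (intro conjI ballI)
  let ?L = "\<lambda>p::point. (\<epsilon>1 * fst p + \<epsilon>2, \<epsilon>5 * fst (snd p) + \<epsilon>6, \<epsilon>3 * snd (snd p) + \<epsilon>4)"
  have L: "smooth_on \<Omega> ?L"
    by (intro smooth_on_intros assms(1))
  then show "smooth_on \<Omega> \<Phi>"
    by (rule smooth_on_cong[OF assms(1), rotated]) (use \<Phi> in simp)
  show "inj_on \<Phi> \<Omega>"
    using \<Phi> \<epsilon> by (auto simp: inj_on_def)
  fix p assume p: "p \<in> \<Omega>"
  have "(?L has_derivative (\<lambda>w. (\<epsilon>1 * fst w, \<epsilon>5 * fst (snd w), \<epsilon>3 * snd (snd w)))) (at p)"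
    by (auto intro!: derivative_eq_intros)
  then have "(\<Phi> has_derivative (\<lambda>w. (\<epsilon>1 * fst w, \<epsilon>5 * fst (snd w), \<epsilon>3 * snd (snd w)))) (at p)"
    by (rule has_derivative_transform_within_open[OF _ assms(1) p]) (use \<Phi> in simp)
  then have "frechet_derivative \<Phi> (at p) = (\<lambda>w. (\<epsilon>1 * fst w, \<epsilon>5 * fst (snd w), \<epsilon>3 * snd (snd w)))"
    by (rule frechet_derivative_at[symmetric])
  moreover have "bij (\<lambda>w::point. (\<epsilon>1 * fst w, \<epsilon>5 * fst (snd w), \<epsilon>3 * snd (snd w)))"
    by (rule o_bij[of "\<lambda>w. (fst w / \<epsilon>1, fst (snd w) / \<epsilon>5, snd (snd w) / \<epsilon>3)"])
      (use \<epsilon> in \<open>auto simp: fun_eq_iff\<close>)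
  ultimately show "bij (frechet_derivative \<Phi> (at p))" by simp
qed

text \<open>Under the affine map the jet variables are merely rescaled, and the new equation is a
  nonzero multiple of the old one. The term with \<epsilon>8 that arises from differentiating the
  exponential in \<open>h'\<close> is cancelled by the summand \<open>- \<epsilon>8 * H u\<close> in
  \<open>K'\<close>.\<close>

lemma affine_transformation_of_elements:
  fixes \<Omega> :: "point set"
  assumes \<Omega>: "open \<Omega>"
    and \<Phi>: "\<forall>p\<in>\<Omega>. \<Phi> p = (\<epsilon>1 * fst p + \<epsilon>2, \<epsilon>5 * fst (snd p) + \<epsilon>6, \<epsilon>3 * snd (snd p) + \<epsilon>4)"
    and \<theta>: "(f, h, H, K) \<in> admissible_elements \<Omega>"
    and \<epsilon>: "\<epsilon>1 * \<epsilon>3 * \<epsilon>5 * \<epsilon>7 * \<epsilon>9 \<noteq> 0"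
    and f': "\<And>x. x \<in> x_range \<Omega> \<Longrightarrow> f' (\<epsilon>5 * x + \<epsilon>6) = \<epsilon>1\<^sup>2 * inverse \<epsilon>5 * \<epsilon>9 * f x * exp (\<epsilon>8 * x)"
    and h': "\<And>x. x \<in> x_range \<Omega> \<Longrightarrow> h' (\<epsilon>5 * x + \<epsilon>6) = \<epsilon>9 * inverse \<epsilon>7 * h x * exp (\<epsilon>8 * x)"
    and H': "\<And>u. u \<in> u_range \<Omega> \<Longrightarrow> H' (\<epsilon>3 * u + \<epsilon>4) = \<epsilon>5 * \<epsilon>7 * H u"
    and K': "\<And>u. u \<in> u_range \<Omega> \<Longrightarrow> K' (\<epsilon>3 * u + \<epsilon>4) = \<epsilon>7 * (K u - \<epsilon>8 * H u)"
  shows "(f', h', H', K') \<in> admissible_elements (\<Phi> ` \<Omega>)"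
    and "maps_equation \<Omega> \<Phi> (f, h, H, K) (f', h', H', K')"
proof -
  have \<epsilon>0: "\<epsilon>1 \<noteq> 0" "\<epsilon>3 \<noteq> 0" "\<epsilon>5 \<noteq> 0" "\<epsilon>7 \<noteq> 0" "\<epsilon>9 \<noteq> 0" using \<epsilon> by auto
  note ad = admissible_elementsD[OF \<theta>]
  note xo = open_x_range[OF \<Omega>] and uo = open_u_range[OF \<Omega>]
  have xr: "x_range (\<Phi> ` \<Omega>) = (\<lambda>x. \<epsilon>5 * x + \<epsilon>6) ` x_range \<Omega>"
    and ur: "u_range (\<Phi> ` \<Omega>) = (\<lambda>u. \<epsilon>3 * u + \<epsilon>4) ` u_range \<Omega>"
    using \<Phi> by (auto simp: x_range_def u_range_def image_image split_def)
  have sm: "smooth_on (x_range (\<Phi> ` \<Omega>)) f'" "smooth_on (x_range (\<Phi> ` \<Omega>)) h'"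
    "smooth_on (u_range (\<Phi> ` \<Omega>)) H'" "smooth_on (u_range (\<Phi> ` \<Omega>)) K'"
  proof -
    have "smooth_on (x_range \<Omega>) (\<lambda>x. \<epsilon>1\<^sup>2 * inverse \<epsilon>5 * \<epsilon>9 * f x * exp (\<epsilon>8 * x))"
      "smooth_on (x_range \<Omega>) (\<lambda>x. \<epsilon>9 * inverse \<epsilon>7 * h x * exp (\<epsilon>8 * x))"
      "smooth_on (u_range \<Omega>) (\<lambda>u. \<epsilon>5 * \<epsilon>7 * H u)" "smooth_on (u_range \<Omega>) (\<lambda>u. \<epsilon>7 * (K u - \<epsilon>8 * H u))"
      by (intro smooth_on_mult smooth_on_diff smooth_on_exp smooth_on_const smooth_on_ident ad xo uo)+
    then show "smooth_on (x_range (\<Phi> ` \<Omega>)) f'" "smooth_on (x_range (\<Phi> ` \<Omega>)) h'"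
      "smooth_on (u_range (\<Phi> ` \<Omega>)) H'" "smooth_on (u_range (\<Phi> ` \<Omega>)) K'"
      unfolding xr ur using f' h' H' K'
      by (auto intro: smooth_on_affine_image[OF xo \<epsilon>0(3)] smooth_on_affine_image[OF uo \<epsilon>0(2)])
  qed
  have dh': "deriv h' (\<epsilon>5 * x + \<epsilon>6) * \<epsilon>5 = \<epsilon>9 * inverse \<epsilon>7 * exp (\<epsilon>8 * x) * (deriv h x + \<epsilon>8 * h x)"
    if x: "x \<in> x_range \<Omega>" for x
  proof (rule deriv_affine_substitution[where \<psi> = "\<lambda>x. \<epsilon>9 * inverse \<epsilon>7 * h x * exp (\<epsilon>8 * x)", OF xo x h'])
    show "h' differentiable (at (\<epsilon>5 * x + \<epsilon>6))"
      using sm(2) x by (intro smooth_on_differentiable) (auto simp: xr)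
    have "(h has_real_derivative deriv h x) (at x)"
      using smooth_on_differentiable[OF ad(2) x] by (simp add: DERIV_deriv_iff_real_differentiable)
    then show "((\<lambda>x. \<epsilon>9 * inverse \<epsilon>7 * h x * exp (\<epsilon>8 * x)) has_real_derivative
        \<epsilon>9 * inverse \<epsilon>7 * exp (\<epsilon>8 * x) * (deriv h x + \<epsilon>8 * h x)) (at x)"
      by (auto intro!: derivative_eq_intros simp: algebra_simps)
  qed
  have dH: "(H has_real_derivative deriv H u) (at u)" "(K has_real_derivative deriv K u) (at u)"
    if "u \<in> u_range \<Omega>" for u
    using smooth_on_differentiable[OF ad(3) that] smooth_on_differentiable[OF ad(4) that]
    by (simp_all add: DERIV_deriv_iff_real_differentiable)
  have dH': "deriv H' (\<epsilon>3 * u + \<epsilon>4) * \<epsilon>3 = \<epsilon>5 * \<epsilon>7 * deriv H u" if u: "u \<in> u_range \<Omega>" for u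
  proof (rule deriv_affine_substitution[where \<psi> = "\<lambda>u. \<epsilon>5 * \<epsilon>7 * H u", OF uo u H'])
    show "H' differentiable (at (\<epsilon>3 * u + \<epsilon>4))"
      using sm(3) u by (intro smooth_on_differentiable) (auto simp: ur)
    show "((\<lambda>u. \<epsilon>5 * \<epsilon>7 * H u) has_real_derivative \<epsilon>5 * \<epsilon>7 * deriv H u) (at u)"
      by (rule DERIV_cmult[OF dH(1)[OF u]])
  qed
  have dK': "deriv K' (\<epsilon>3 * u + \<epsilon>4) * \<epsilon>3 = \<epsilon>7 * (deriv K u - \<epsilon>8 * deriv H u)"
    if u: "u \<in> u_range \<Omega>" for u
  proof (rule deriv_affine_substitution[where \<psi> = "\<lambda>u. \<epsilon>7 * (K u - \<epsilon>8 * H u)", OF uo u K'])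
    show "K' differentiable (at (\<epsilon>3 * u + \<epsilon>4))"
      using sm(4) u by (intro smooth_on_differentiable) (auto simp: ur)
    show "((\<lambda>u. \<epsilon>7 * (K u - \<epsilon>8 * H u)) has_real_derivative \<epsilon>7 * (deriv K u - \<epsilon>8 * deriv H u)) (at u)"
      by (intro DERIV_cmult DERIV_diff dH[OF u])
  qed
  show adm: "(f', h', H', K') \<in> admissible_elements (\<Phi> ` \<Omega>)"
  proof -
    have "f' x * h' x * H' u \<noteq> 0" if "x \<in> x_range (\<Phi> ` \<Omega>)" "u \<in> u_range (\<Phi> ` \<Omega>)" for x u
      using that \<epsilon>0 ad(5-7) by (auto simp: xr ur f' h' H')
    moreover obtain u where u: "u \<in> u_range \<Omega>" "(deriv H u, deriv K u) \<noteq> (0, 0)"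
      using \<theta> by (auto simp: admissible_elements_def)
    \<comment> \<open>Up to nonzero constants the new pair of derivatives is a triangular linear
      image of the old pair, so both vanish only together.\<close>
    then have "(deriv H' (\<epsilon>3 * u + \<epsilon>4), deriv K' (\<epsilon>3 * u + \<epsilon>4)) \<noteq> (0, 0)"
      using dH'[OF u(1)] dK'[OF u(1)] \<epsilon>0 by auto
    ultimately show ?thesis
      using sm u(1) by (auto simp: admissible_elements_def ur)
  qed
  show "maps_equation \<Omega> \<Phi> (f, h, H, K) (f', h', H', K')"
    unfolding maps_equation_def
  proof (intro allI impI, elim conjE)
    fix W v W' v' t x t' x' u'
    assume W: "open W" "smooth_on W v" "graph_over W v \<subseteq> \<Omega>"
      and W': "open W'" "smooth_on W' v'" "\<Phi> ` graph_over W v = graph_over W' v'"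
      and q: "(t, x) \<in> W" and im: "\<Phi> (t, x, v (t, x)) = (t', x', u')"
    have p: "(t, x, v (t, x)) \<in> \<Omega>" using W(3) q by (auto simp: graph_over_def)
    note gt = graph_transformation[OF smooth_on_affine_coordinates[OF \<Omega>] \<Phi> W W' q,
        unfolded fst_conv snd_conv]
    have t'x': "t' = \<epsilon>1 * t + \<epsilon>2" "x' = \<epsilon>5 * x + \<epsilon>6" "u' = \<epsilon>3 * v (t, x) + \<epsilon>4"
      using im \<Phi> p by auto
    note x = x_range_I[OF p] and u = u_range_I[OF p]
    let ?r = "dird e1 (dird e1 v) (t, x)" and ?m = "dird e2 (dird e2 v) (t, x)" and ?b = "dird e2 v (t, x)"
    let ?N11 = "dird e1 (dird e1 v') (t', x')" and ?N22 = "dird e2 (dird e2 v') (t', x')" and ?P2 = "dird e2 v' (t', x')"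
    note jets = gt(3)[of e2] gt(4)[of e1 e1] gt(4)[of e2 e2]
    note jets = jets[unfolded total1_simps total2_e11 total2_e22 dird_dird_affine dird_affine, folded t'x']
    have "?b * \<epsilon>3 = ?P2 * \<epsilon>5" "?r * \<epsilon>3 = ?N11 * \<epsilon>1 * \<epsilon>1" "?m * \<epsilon>3 = ?N22 * \<epsilon>5 * \<epsilon>5"
      using jets by simp_all
    then have P2: "?P2 = \<epsilon>3 * ?b / \<epsilon>5" and N11: "?N11 = \<epsilon>3 * ?r / \<epsilon>1\<^sup>2" and N22: "?N22 = \<epsilon>3 * ?m / \<epsilon>5\<^sup>2"
      using \<epsilon>0 by (simp_all add: field_simps power2_eq_square)
    have hH: "h differentiable (at x)" "H differentiable (at (v (t, x)))"
      using smooth_on_differentiable[OF ad(2) x] smooth_on_differentiable[OF ad(3) u] .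
    have v': "(t', x') \<in> W'" "u' = v' (t', x')"
      using gt(1,2) unfolding t'x' by simp_all
    have "x' \<in> x_range (\<Phi> ` \<Omega>)" "u' \<in> u_range (\<Phi> ` \<Omega>)"
      unfolding xr ur t'x' by (intro imageI x u)+
    then have hH': "h' differentiable (at x')" "H' differentiable (at (v' (t', x')))"
      unfolding v'(2)[symmetric]
      using smooth_on_differentiable[OF sm(2)] smooth_on_differentiable[OF sm(3)] by simp_all
    \<comment> \<open>The common multiplier of both sides of the equation.\<close>
    define c where "c = \<epsilon>9 * \<epsilon>3 / \<epsilon>5 * exp (\<epsilon>8 * x)"
    have c: "c \<noteq> 0" using \<epsilon>0 by (simp add: c_def)
    have dh'x: "deriv h' x' = \<epsilon>9 * inverse \<epsilon>7 * exp (\<epsilon>8 * x) * (deriv h x + \<epsilon>8 * h x) / \<epsilon>5"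
      using dh'[OF x] \<epsilon>0 unfolding t'x' by (simp add: field_simps)
    have dH'u: "deriv H' u' = \<epsilon>5 * \<epsilon>7 * deriv H (v (t, x)) / \<epsilon>3"
      using dH'[OF u] \<epsilon>0 unfolding t'x' by (simp add: field_simps)
    have vals: "f' x' = \<epsilon>1\<^sup>2 * inverse \<epsilon>5 * \<epsilon>9 * f x * exp (\<epsilon>8 * x)"
      "h' x' = \<epsilon>9 * inverse \<epsilon>7 * h x * exp (\<epsilon>8 * x)"
      "H' u' = \<epsilon>5 * \<epsilon>7 * H (v (t, x))" "K' u' = \<epsilon>7 * (K (v (t, x)) - \<epsilon>8 * H (v (t, x)))"
      using f'[OF x] h'[OF x] H'[OF u] K'[OF u] unfolding t'x' by simp_all
    have L: "f' x' * ?N11 = c * (f x * ?r)"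
      unfolding vals N11 c_def using \<epsilon>0 by (simp add: field_simps)
    have R: "h' x' * H' u' * ?N22 + deriv h' x' * H' u' * ?P2 + h' x' * deriv H' u' * ?P2\<^sup>2 + h' x' * K' u' * ?P2 =
        c * (h x * H (v (t, x)) * ?m + deriv h x * H (v (t, x)) * ?b
          + h x * deriv H (v (t, x)) * ?b\<^sup>2 + h x * K (v (t, x)) * ?b)"
      unfolding vals N22 P2 dh'x dH'u c_def using \<epsilon>0 by (simp add: field_simps power2_eq_square)
    have "equation_holds_at (f, h, H, K) v (t, x) \<longleftrightarrow> jet_equation (f, h, H, K) x (v (t, x)) ?b ?r ?m"
      by (rule equation_holds_at_iff[OF W(1,2) q hH])
    also have "\<dots> \<longleftrightarrow> jet_equation (f', h', H', K') x' u' ?P2 ?N11 ?N22"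
      unfolding jet_equation_def prod.case L R using c by simp
    also have "\<dots> \<longleftrightarrow> equation_holds_at (f', h', H', K') v' (t', x')"
      unfolding v'(2) by (rule equation_holds_at_iff[OF W'(1,2) v'(1) hH', symmetric])
    finally show "equation_holds_at (f, h, H, K) v (t, x) \<longleftrightarrow> equation_holds_at (f', h', H', K') v' (t', x')" .
  qed
qed

text \<open>\<epsilon>1 to \<epsilon>6 belong to the point map and are chosen once, whereas
  \<epsilon>7 to \<epsilon>9 may change with the quadruple, because \<Psi> is an arbitrary rule.
  Conversely, every rule that picks such constants for each admissible quadruple yields a member;
  the new elements are prescribed only on the ranges of the image domain.\<close>

theorem theorem6:
  fixes \<Omega> :: "point set"
    and \<Phi> :: "point \<Rightarrow> point"
    and \<Psi> :: "arbitrary_elements \<Rightarrow> arbitrary_elements"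
  assumes "open \<Omega>" and "connected \<Omega>" and "\<Omega> \<noteq> {}"
  shows "(\<Phi>, \<Psi>) \<in> extended_equivalence_group \<Omega> \<longleftrightarrow>
    (\<exists>\<epsilon>1 \<epsilon>2 \<epsilon>3 \<epsilon>4 \<epsilon>5 \<epsilon>6 :: real.
       (\<forall>t x u. (t, x, u) \<in> \<Omega> \<longrightarrow>
          \<Phi> (t, x, u) = (\<epsilon>1 * t + \<epsilon>2, \<epsilon>5 * x + \<epsilon>6, \<epsilon>3 * u + \<epsilon>4)) \<and>
       \<epsilon>1 * \<epsilon>3 * \<epsilon>5 \<noteq> 0 \<and>
       (\<forall>f h H K f' h' H' K'.
          (f, h, H, K) \<in> admissible_elements \<Omega> \<and> \<Psi> (f, h, H, K) = (f', h', H', K') \<longrightarrow>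
          (\<exists>\<epsilon>7 \<epsilon>8 \<epsilon>9 :: real.
             \<epsilon>1 * \<epsilon>3 * \<epsilon>5 * \<epsilon>7 * \<epsilon>9 \<noteq> 0 \<and>
             (\<forall>x\<in>x_range \<Omega>.
                f' (\<epsilon>5 * x + \<epsilon>6) = \<epsilon>1\<^sup>2 * inverse \<epsilon>5 * \<epsilon>9 * f x * exp (\<epsilon>8 * x) \<and>
                h' (\<epsilon>5 * x + \<epsilon>6) = \<epsilon>9 * inverse \<epsilon>7 * h x * exp (\<epsilon>8 * x)) \<and>
             (\<forall>u\<in>u_range \<Omega>.
                H' (\<epsilon>3 * u + \<epsilon>4) = \<epsilon>5 * \<epsilon>7 * H u \<and>
                K' (\<epsilon>3 * u + \<epsilon>4) = \<epsilon>7 * (K u - \<epsilon>8 * H u)))))"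
    (is "_ \<longleftrightarrow> (\<exists>\<epsilon>1 \<epsilon>2 \<epsilon>3 \<epsilon>4 \<epsilon>5 \<epsilon>6. ?rule \<epsilon>1 \<epsilon>2 \<epsilon>3 \<epsilon>4 \<epsilon>5 \<epsilon>6)")
proof
  assume "(\<Phi>, \<Psi>) \<in> extended_equivalence_group \<Omega>"
  then interpret equivalence_transformation \<Omega> "\<lambda>p. fst (\<Phi> p)" "\<lambda>p. fst (snd (\<Phi> p))"
    "\<lambda>p. snd (snd (\<Phi> p))" \<Psi>
    by (rule equivalence_transformationI[OF assms(1,3)])
  obtain \<epsilon>1 \<epsilon>2 \<epsilon>3 \<epsilon>4 \<epsilon>5 \<epsilon>6 where
    T: "\<And>t x u. (t, x, u) \<in> \<Omega> \<Longrightarrow> fst (\<Phi> (t, x, u)) = \<epsilon>1 * t + \<epsilon>2"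
    and X: "\<And>t x u. (t, x, u) \<in> \<Omega> \<Longrightarrow> fst (snd (\<Phi> (t, x, u))) = \<epsilon>5 * x + \<epsilon>6"
    and U: "\<And>t x u. (t, x, u) \<in> \<Omega> \<Longrightarrow> snd (snd (\<Phi> (t, x, u))) = \<epsilon>3 * u + \<epsilon>4"
    and d: "\<And>p. p \<in> \<Omega> \<Longrightarrow> dird et (\<lambda>p. fst (\<Phi> p)) p = \<epsilon>1"
      "\<And>p. p \<in> \<Omega> \<Longrightarrow> dird ex (\<lambda>p. fst (snd (\<Phi> p))) p = \<epsilon>5"
      "\<And>p. p \<in> \<Omega> \<Longrightarrow> dird eu (\<lambda>p. snd (snd (\<Phi> p))) p = \<epsilon>3" "\<epsilon>1 * \<epsilon>3 * \<epsilon>5 \<noteq> 0"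
    by (rule affine[OF assms(2)]) (rule that)
  have "?rule \<epsilon>1 \<epsilon>2 \<epsilon>3 \<epsilon>4 \<epsilon>5 \<epsilon>6"
  proof (intro conjI allI impI, goal_cases)
    case (1 t x u)
    then show ?case using T X U by (intro prod_eqI) simp_all
  next
    case 2
    show ?case by (rule d(4))
  next
    case (3 f h H K f' h' H' K')
    then have \<theta>: "(f, h, H, K) \<in> admissible_elements \<Omega>" "\<Psi> (f, h, H, K) = (f', h', H', K')"
      by simp_all
    show ?case
    proof (rule element_transformation[OF assms(2) _ _ _ _ _ d(4) \<theta>])
      show "fst (snd (\<Phi> (t, x, u))) = \<epsilon>5 * x + \<epsilon>6" if "(t, x, u) \<in> \<Omega>" for t x u using that by (rule X)
      show "snd (snd (\<Phi> (t, x, u))) = \<epsilon>3 * u + \<epsilon>4" if "(t, x, u) \<in> \<Omega>" for t x u using that by (rule U)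
      show "dird et (\<lambda>p. fst (\<Phi> p)) p = \<epsilon>1" if "p \<in> \<Omega>" for p using that by (rule d(1))
      show "dird ex (\<lambda>p. fst (snd (\<Phi> p))) p = \<epsilon>5" if "p \<in> \<Omega>" for p using that by (rule d(2))
      show "dird eu (\<lambda>p. snd (snd (\<Phi> p))) p = \<epsilon>3" if "p \<in> \<Omega>" for p using that by (rule d(3))
    qed blast
  qed
  then show "\<exists>\<epsilon>1 \<epsilon>2 \<epsilon>3 \<epsilon>4 \<epsilon>5 \<epsilon>6. ?rule \<epsilon>1 \<epsilon>2 \<epsilon>3 \<epsilon>4 \<epsilon>5 \<epsilon>6" by blast
next
  assume "\<exists>\<epsilon>1 \<epsilon>2 \<epsilon>3 \<epsilon>4 \<epsilon>5 \<epsilon>6. ?rule \<epsilon>1 \<epsilon>2 \<epsilon>3 \<epsilon>4 \<epsilon>5 \<epsilon>6"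
  then obtain \<epsilon>1 \<epsilon>2 \<epsilon>3 \<epsilon>4 \<epsilon>5 \<epsilon>6 where rule: "?rule \<epsilon>1 \<epsilon>2 \<epsilon>3 \<epsilon>4 \<epsilon>5 \<epsilon>6" by blast
  then have \<Phi>: "\<forall>p\<in>\<Omega>. \<Phi> p = (\<epsilon>1 * fst p + \<epsilon>2, \<epsilon>5 * fst (snd p) + \<epsilon>6, \<epsilon>3 * snd (snd p) + \<epsilon>4)"
    by auto
  have "\<Psi> \<theta> \<in> admissible_elements (\<Phi> ` \<Omega>) \<and> maps_equation \<Omega> \<Phi> \<theta> (\<Psi> \<theta>)"
    if \<theta>: "\<theta> \<in> admissible_elements \<Omega>" for \<theta>
  proof -
    obtain f h H K f' h' H' K' where eq: "\<theta> = (f, h, H, K)" "\<Psi> (f, h, H, K) = (f', h', H', K')"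
      by (metis prod_cases4)
    obtain \<epsilon>7 \<epsilon>8 \<epsilon>9 where \<epsilon>: "\<epsilon>1 * \<epsilon>3 * \<epsilon>5 * \<epsilon>7 * \<epsilon>9 \<noteq> 0"
      and x: "\<forall>x\<in>x_range \<Omega>.
                f' (\<epsilon>5 * x + \<epsilon>6) = \<epsilon>1\<^sup>2 * inverse \<epsilon>5 * \<epsilon>9 * f x * exp (\<epsilon>8 * x) \<and>
                h' (\<epsilon>5 * x + \<epsilon>6) = \<epsilon>9 * inverse \<epsilon>7 * h x * exp (\<epsilon>8 * x)"
      and u: "\<forall>u\<in>u_range \<Omega>.
                H' (\<epsilon>3 * u + \<epsilon>4) = \<epsilon>5 * \<epsilon>7 * H u \<and>
                K' (\<epsilon>3 * u + \<epsilon>4) = \<epsilon>7 * (K u - \<epsilon>8 * H u)"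
      using rule \<theta> eq by blast
    show ?thesis
      unfolding eq
      using affine_transformation_of_elements[OF assms(1) \<Phi> \<theta>[unfolded eq(1)] \<epsilon>, of f' \<epsilon>8 h' H' K'] x u
      by blast
  qed
  moreover have "point_transformation \<Omega> \<Phi>"
    using affine_point_transformation[OF assms(1) \<Phi>] rule by blast
  ultimately show "(\<Phi>, \<Psi>) \<in> extended_equivalence_group \<Omega>"
    by (simp add: extended_equivalence_group_def)
qed

end
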